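(* Let $f$, $h^*$, $s$, $g$, $A$ and $L$ be as in the context, and assume $A^\dagger A$ is invertible. Consider the preconditioned gradient flow $$\dot w=-\frac{1}{s|\alpha_s|}(A^\dagger A)^{-1}\nabla L(w).$$ For a parameter $w$ define the summary statistics $m=\langle Aw,h^*\rangle\in\mathbb{C}$, written in polar form $m=re^{i\theta}$, and $v=\|P_{h^*}^\perp Aw\|^2$, where $P_{h^*}^\perp$ is the orthogonal projection onto the orthogonal complement of $h^*$. Let $\delta:=1-\|P_Ah^*\|^2$, where $P_A$ is the orthogonal projection onto the range of $A$. Then along the flow the summary statistics satisfy $$\dot r=(1-\delta)r^{s-1}\cos s\theta-(v+r^2)^{s-1}r,$$ $$\frac{d}{dt}\cos s\theta=(1-\delta)\,s\,r^{s-2}(1-\cos^2 s\theta),$$ $$\dot v=2\delta r^s\cos s\theta-2(v+r^2)^{s-1}v.$$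
   Context: For $x\in\mathbb{C}^N$, $p_k(x)=\frac1{\sqrt k}\sum_{n=1}^Nx_n^k$ and $p(x)=(p_1(x),p_2(x),\dots)$. For square-summable $u,v\in\mathbb{C}^\infty$, $\langle u,v\rangle=\sum_iu_i\overline{v_i}$, $\|u\|^2=\langle u,u\rangle$, and $\langle u,p(x)\rangle=\sum_ju_j\overline{p_j(x)}$. $V$ is the distribution on $(S^1)^N$ of the eigenvalues of an $N\times N$ Haar unitary matrix (density proportional to $\prod_{i<j}|x_i-x_j|^2$). Teacher: $f(z)=\sum_{j=1}^{\sqrt N}\frac{\alpha_j}{\sqrt{j!}}z^j$, and $h^*\in\mathbb{C}^\infty$ has unit norm and is supported on its first $\sqrt N$ coordinates. The information exponent is $s=\min\{j\ge1:\alpha_j\ne0\}$ (assumed to exist). Student link: $g(z)=\frac{\alpha_s}{|\alpha_s|\sqrt{s!}}z^s$. $A\in\mathbb{C}^{\infty\times M}$ has entries $A_{km}=c_k\sqrt k\,a_m^k$ with $a_m\in S^1$ and $\sigma(z)=\sum_kc_kz^k$ the activation (with $Aw$ square-summable); $A^\dagger$ is its conjugate transpose. The loss is $$L(w)=\mathbb{E}_{x\sim V}\Big[-\operatorname{Re}\Big(f(\langle h^*,p(x)\rangle)\overline{g(\langle Aw,p(x)\rangle)}\Big)\Big]+\frac{|\alpha_s|}{2}\|Aw\|^{2s},\quad w\in\mathbb{C}^M.$$ Writing $w=w_R+iw_C$ with $w_R,w_C\in\mathbb{R}^M$, $\nabla L:=\nabla_{w_R}L+i\nabla_{w_C}L$,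 and $\dot w:=\dot w_R+i\dot w_C$ (ordinary gradient flow on the real pair $(w_R,w_C)$, preconditioned as stated). *)

theory Defs
  imports "HOL-Analysis.Analysis" "HOL-Probability.Probability"
begin

text \<open>Vectors in C^infinity are modelled as functions nat => complex; the coordinate
  index 0 is unused (kept equal to 0), coordinates are 1, 2, 3, ...\<close>

definition ip :: "(nat \<Rightarrow> complex) \<Rightarrow> (nat \<Rightarrow> complex) \<Rightarrow> complex" where
  "ip u v = (\<Sum>i. u i * cnj (v i))"

definition sqnorm :: "(nat \<Rightarrow> complex) \<Rightarrow> real" where
  "sqnorm u = (\<Sum>i. (cmod (u i))\<^sup>2)"

definition sq_summable :: "(nat \<Rightarrow> complex) \<Rightarrow> bool" where
  "sq_summable u \<longleftrightarrow> summable (\<lambda>i. (cmod (u i))\<^sup>2)"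

definition l2 :: "(nat \<Rightarrow> complex) set" where
  "l2 = {u. u 0 = 0 \<and> sq_summable u}"

definition proj :: "(nat \<Rightarrow> complex) set \<Rightarrow> (nat \<Rightarrow> complex) \<Rightarrow> (nat \<Rightarrow> complex)" where
  "proj S u = (THE y. y \<in> S \<and> (\<forall>z\<in>S. ip (\<lambda>i. u i - y i) z = 0))"

definition psum :: "nat \<Rightarrow> nat \<Rightarrow> (nat \<Rightarrow> complex) \<Rightarrow> complex" where
  "psum N k x = complex_of_real (1 / sqrt (real k)) * (\<Sum>n<N. x n ^ k)"

definition pvec :: "nat \<Rightarrow> (nat \<Rightarrow> complex) \<Rightarrow> (nat \<Rightarrow> complex)" where
  "pvec N x = (\<lambda>k. psum N k x)"

definition circle_unif :: "complex measure" where
  "circle_unif = distr (uniform_measure lborel {0..2*pi}) borel cis"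

definition weyl :: "nat \<Rightarrow> (nat \<Rightarrow> complex) \<Rightarrow> real" where
  "weyl N x = (\<Prod>i<N. \<Prod>j\<in>{i<..<N}. (cmod (x i - x j))\<^sup>2)"

text \<open>Distribution V of the eigenvalues of an N x N Haar unitary: density proportional to
  prod_{i<j} |x_i - x_j|^2 with respect to the Haar measure on (S^1)^N.\<close>
definition haar_eig :: "nat \<Rightarrow> (nat \<Rightarrow> complex) measure" where
  "haar_eig N = (let \<mu> = PiM {..<N} (\<lambda>_. circle_unif)
                 in density \<mu> (\<lambda>x. ennreal (weyl N x / (\<integral>y. weyl N y \<partial>\<mu>))))"

definition EV :: "nat \<Rightarrow> ((nat \<Rightarrow> complex) \<Rightarrow> real) \<Rightarrow> real" where
  "EV N F = (\<integral>x. F x \<partial>haar_eig N)"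

definition Kcut :: "nat \<Rightarrow> nat" where
  "Kcut N = nat \<lfloor>sqrt (real N)\<rfloor>"

definition teacher :: "nat \<Rightarrow> (nat \<Rightarrow> complex) \<Rightarrow> complex \<Rightarrow> complex" where
  "teacher N \<alpha> z = (\<Sum>j=1..Kcut N. \<alpha> j / complex_of_real (sqrt (fact j)) * z ^ j)"

definition info_exp :: "nat \<Rightarrow> (nat \<Rightarrow> complex) \<Rightarrow> nat" where
  "info_exp N \<alpha> = (LEAST j. 1 \<le> j \<and> j \<le> Kcut N \<and> \<alpha> j \<noteq> 0)"

definition student :: "nat \<Rightarrow> (nat \<Rightarrow> complex) \<Rightarrow> complex \<Rightarrow> complex" where
  "student N \<alpha> z = (let s = info_exp N \<alpha> in
     \<alpha> s / complex_of_real (cmod (\<alpha> s) * sqrt (fact s)) * z ^ s)"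

definition Amat :: "(nat \<Rightarrow> complex) \<Rightarrow> ('m \<Rightarrow> complex) \<Rightarrow> nat \<Rightarrow> 'm \<Rightarrow> complex" where
  "Amat c a k m = c k * complex_of_real (sqrt (real k)) * a m ^ k"

definition Amul :: "(nat \<Rightarrow> complex) \<Rightarrow> ('m::finite \<Rightarrow> complex) \<Rightarrow> complex^'m \<Rightarrow> (nat \<Rightarrow> complex)" where
  "Amul c a w = (\<lambda>k. \<Sum>m\<in>UNIV. Amat c a k m * w $ m)"

definition AdagA :: "(nat \<Rightarrow> complex) \<Rightarrow> ('m::finite \<Rightarrow> complex) \<Rightarrow> complex^'m^'m" where
  "AdagA c a = (\<chi> i j. \<Sum>k. cnj (Amat c a k i) * Amat c a k j)"

definition rangeA :: "(nat \<Rightarrow> complex) \<Rightarrow> ('m::finite \<Rightarrow> complex) \<Rightarrow> (nat \<Rightarrow> complex) set" where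
  "rangeA c a = range (Amul c a)"

definition orth_compl :: "(nat \<Rightarrow> complex) \<Rightarrow> (nat \<Rightarrow> complex) set" where
  "orth_compl h = {y \<in> l2. ip y h = 0}"

definition loss :: "nat \<Rightarrow> (nat \<Rightarrow> complex) \<Rightarrow> (nat \<Rightarrow> complex) \<Rightarrow> (nat \<Rightarrow> complex)
                     \<Rightarrow> ('m::finite \<Rightarrow> complex) \<Rightarrow> complex^'m \<Rightarrow> real" where
  "loss N \<alpha> h c a w =
     EV N (\<lambda>x. - Re (teacher N \<alpha> (ip h (pvec N x)) *
                      cnj (student N \<alpha> (ip (Amul c a w) (pvec N x)))))
     + cmod (\<alpha> (info_exp N \<alpha>)) / 2 * (sqnorm (Amul c a w)) ^ (info_exp N \<alpha>)"

definition overlap :: "(nat \<Rightarrow> complex) \<Rightarrow> ('m::finite \<Rightarrow> complex) \<Rightarrow> (nat \<Rightarrow> complex) \<Rightarrow> complex^'m \<Rightarrow> complex" where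
  "overlap c a h w = ip (Amul c a w) h"

definition vstat :: "(nat \<Rightarrow> complex) \<Rightarrow> ('m::finite \<Rightarrow> complex) \<Rightarrow> (nat \<Rightarrow> complex) \<Rightarrow> complex^'m \<Rightarrow> real" where
  "vstat c a h w = sqnorm (proj (orth_compl h) (Amul c a w))"

definition delta :: "(nat \<Rightarrow> complex) \<Rightarrow> ('m::finite \<Rightarrow> complex) \<Rightarrow> (nat \<Rightarrow> complex) \<Rightarrow> real" where
  "delta c a h = 1 - sqnorm (proj (rangeA c a) h)"

end

theory Submission
  imports Defs
begin

text \<open>The power sums \<open>P\<^sub>k = \<Sum>n. x\<^sub>n ^ k\<close> of Haar eigenvalues have, up to degree \<open>N\<close>, the moments of
  independent complex Gaussians of variance \<open>k\<close>. Integrating \<open>x\<^sub>n \<partial>/\<partial>x\<^sub>n\<close> of \<open>x\<^sub>n ^ k * F\<close> against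
  the Weyl density and summing over \<open>n\<close> gives linear loop equations between these moments. The
  Gaussian moments solve them, and in degree at most \<open>N\<close> they are diagonally dominant, so the
  solution is unique. Since \<open>sqrt N * sqrt N \<le> N\<close>, Wick's formula reduces the expectation in the
  loss to \<open>|\<alpha>\<^sub>s| Re (m ^ s)\<close>. Here \<open>\<langle>Aw, p(x)\<rangle>\<close> is an infinite series with \<open>p(x)\<close> not
  square-summable; it converges almost everywhere, dominated by a function in every \<open>L\<^sup>q\<close>, by a
  dyadic decomposition. With \<open>B = A\<^sup>\<dagger> h\<close>, \<open>K = A\<^sup>\<dagger> A\<close> and \<open>Q = \<parallel>Aw\<parallel>\<^sup>2 = v + r\<^sup>2\<close> the
  flow becomes \<open>w' = cnj m ^ (s - 1) K\<^sup>-\<^sup>1 B - Q ^ (s - 1) w\<close>, where \<open>B\<^sup>\<dagger> K\<^sup>-\<^sup>1 B = 1 - \<delta>\<close>.\<close>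

section \<open>Loop equations and Gaussian moments\<close>

text \<open>The two fields in the loss are unequal: the teacher's has frequencies up to sqrt N, the
  student's has all of them, while Gaussian moments are available only up to degree
  \<open>N\<close>. Moments of unequal degrees vanish, however, so it suffices to bound the degree
  on one side. On the teacher's side the term of order \<open>j\<close> expands into products of
  \<open>j\<close> power sums of index at most sqrt N, with \<open>j\<close> itself at most sqrt N.
  Cauchy-Schwarz over all frequencies cannot control the student's series: \<open>|p_k(x)|\<close>
  is bounded only by \<open>N / sqrt k\<close>, and the sum of \<open>1 / k\<close> diverges. Over
  one dyadic block this sum is at most 1, and different frequencies are orthogonal, which yields the
  decay from block to block. The preconditioner closes the system: pairing the velocity with
  \<open>B\<close> or with \<open>K w\<close> returns only \<open>m\<close>, \<open>Q\<close> and
  \<open>1 - \<delta>\<close>. The argument of \<open>m\<close> is never differentiated; the cosine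
  is handled as \<open>Re (m ^ s) / |m| ^ s\<close>.\<close>

lemma sum_image_mset_eq_sum_count:
  fixes f :: "'a \<Rightarrow> 'b::comm_semiring_1"
  assumes "finite A" "set_mset X \<subseteq> A"
  shows "(\<Sum>l\<in>#X. f l) = (\<Sum>l\<in>A. of_nat (count X l) * f l)"
  using assms(2)
proof (induction X)
  case (add x X)
  have "(\<Sum>l\<in>A. of_nat (count (add_mset x X) l) * f l)
      = (\<Sum>l\<in>A. of_nat (count X l) * f l + (if l = x then f l else 0))"
    by (intro sum.cong) (auto simp: algebra_simps)
  also have "\<dots> = (\<Sum>l\<in>A. of_nat (count X l) * f l) + f x"
    using add.prems assms(1) by (simp add: sum.distrib)
  finally show ?case using add by (simp add: add.commute)
qed simp

text \<open>The moment of \<open>(\<Prod>k\<in>#X. Z\<^sub>k) * cnj (\<Prod>k\<in>#Y. Z\<^sub>k)\<close> for independent complex Gaussians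
  \<open>Z\<^sub>k\<close> of variance \<open>k\<close>.\<close>
definition gmom :: "nat multiset \<Rightarrow> nat multiset \<Rightarrow> complex" where
  "gmom X Y = (if X = Y then \<Prod>k\<in>set_mset X. of_nat k ^ count X k * fact (count X k) else 0)"

lemma gmom_commute: "gmom X Y = gmom Y X"
  by (auto simp: gmom_def)

text \<open>Wick contraction: \<open>Z_k\<close> pairs only with a conjugate of the same index, and
  each of the \<open>count Y k\<close> choices contributes the variance \<open>k\<close>. If
  \<open>k\<close> does not occur in \<open>Y\<close>, both sides vanish.\<close>

lemma gmom_add_mset_left:
  "gmom (add_mset k X) Y = of_nat k * of_nat (count Y k) * gmom X (Y - {#k#})"
proof (cases "k \<in># Y")
  case False
  then show ?thesis by (auto simp: gmom_def not_in_iff)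
next
  case True
  then obtain Y' where Y: "Y = add_mset k Y'" by (blast dest: multi_member_split)
  let ?f = "\<lambda>X k. of_nat k ^ count X k * fact (count X k) :: complex"
  have z: "(\<Prod>i\<in>set_mset (add_mset k X). ?f (add_mset k X) i)
     = of_nat k * of_nat (Suc (count X k)) * (\<Prod>i\<in>set_mset X. ?f X i)" (is "?l = ?r")
  proof -
    have "?l = ?f (add_mset k X) k * (\<Prod>i\<in>set_mset X - {k}. ?f (add_mset k X) i)"
      by (subst prod.remove[of _ k]) auto
    also have "(\<Prod>i\<in>set_mset X - {k}. ?f (add_mset k X) i) = (\<Prod>i\<in>set_mset X - {k}. ?f X i)"
      by (intro prod.cong) auto
    also have "?f (add_mset k X) k * \<dots> = of_nat k * of_nat (Suc (count X k))
        * (?f X k * (\<Prod>i\<in>set_mset X - {k}. ?f X i))"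
      by (simp add: algebra_simps)
    also have "?f X k * (\<Prod>i\<in>set_mset X - {k}. ?f X i) = (\<Prod>i\<in>set_mset X. ?f X i)"
    proof (cases "k \<in># X")
      case True
      then show ?thesis by (subst prod.remove[of "set_mset X" k]) auto
    next
      case False
      then show ?thesis by (simp add: not_in_iff)
    qed
    finally show ?thesis .
  qed
  show ?thesis
    unfolding Y gmom_def using z by (auto simp del: prod.insert)
qed

lemma gmom_add_mset_right:
  "gmom X (add_mset k Y) = of_nat k * of_nat (count X k) * gmom (X - {#k#}) Y"
  by (metis gmom_add_mset_left gmom_commute)

text \<open>On the unit circle \<open>x ^ k * cnj x ^ l\<close> collapses to a power of
  \<open>x\<close>, to 1, or to a power of \<open>cnj x\<close>. The branches record the sum of this
  over the \<open>N\<close> coordinates, inserted into the remaining moment.\<close>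

definition loop_rest :: "nat \<Rightarrow> (nat multiset \<Rightarrow> nat multiset \<Rightarrow> complex) \<Rightarrow>
    nat \<Rightarrow> nat \<Rightarrow> nat multiset \<Rightarrow> nat multiset \<Rightarrow> complex" where
  "loop_rest N \<phi> k l X Y = (if l < k then \<phi> (add_mset (k - l) X) Y
     else if l = k then of_nat N * \<phi> X Y else \<phi> X (add_mset (l - k) Y))"

text \<open>A Schwinger-Dyson equation. The first two terms combine the derivatives of
  \<open>x n ^ k\<close> and of the Weyl density, the third differentiates the factors in
  \<open>X\<close>. The right-hand side differentiates the conjugated factors in \<open>Y\<close>,
  whose derivative has the opposite sign.\<close>

definition loop_eq :: "nat \<Rightarrow> (nat multiset \<Rightarrow> nat multiset \<Rightarrow> complex) \<Rightarrow>
    nat \<Rightarrow> nat multiset \<Rightarrow> nat multiset \<Rightarrow> bool" where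
  "loop_eq N \<phi> k X Y \<longleftrightarrow>
     of_nat N * \<phi> (add_mset k X) Y
     + (\<Sum>j=1..<k. \<phi> (add_mset j (add_mset (k - j) X)) Y)
     + (\<Sum>l\<in>#X. of_nat l * \<phi> (add_mset (k + l) (X - {#l#})) Y)
     = (\<Sum>l\<in>#Y. of_nat l * loop_rest N \<phi> k l X (Y - {#l#}))"

text \<open>After contraction the two sides match range by range: \<open>l = k\<close> on the right
  gives the term with \<open>N\<close>, \<open>l < k\<close> gives the splittings of
  \<open>k\<close>, and \<open>l > k\<close> gives the sum over \<open>X\<close>, shifted by
  \<open>k\<close>.\<close>

lemma gmom_loop:
  assumes "0 \<notin># X" "0 \<notin># Y" "0 < k"
  shows "loop_eq N gmom k X Y"
proof -
  obtain D where D: "set_mset X \<subseteq> {..D}" "set_mset Y \<subseteq> {..D}"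
    by (metis finite_UnI finite_set_mset finite_nat_set_iff_bounded_le atMost_iff subsetI UnCI)
  \<comment> \<open>The range for \<open>Y\<close> is enlarged to \<open>D + k\<close> so that its
    part above \<open>k\<close> is the shift by \<open>k\<close> of the range for
    \<open>X\<close>.\<close>
  have X: "set_mset X \<subseteq> {1..D}" and Y: "set_mset Y \<subseteq> {1..D + k}"
    using D assms by (auto simp: Suc_le_eq subset_iff intro!: gr0I trans_le_add1)
  let ?r = "\<lambda>l. of_nat (count Y l) * (of_nat l * loop_rest N gmom k l X (Y - {#l#}))"
  have "(\<Sum>l\<in>#Y. of_nat l * loop_rest N gmom k l X (Y - {#l#})) = (\<Sum>l\<in>{1..D+k}. ?r l)"
    by (rule sum_image_mset_eq_sum_count) (use Y in auto)
  also have "{1..D+k} = insert k ({1..<k} \<union> {1+k..D+k})" using assms by auto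
  also have "(\<Sum>l\<in>insert k ({1..<k} \<union> {1+k..D+k}). ?r l)
      = ?r k + ((\<Sum>l\<in>{1..<k}. ?r l) + (\<Sum>l\<in>{1+k..D+k}. ?r l))"
    by (subst sum.insert) (auto intro!: arg_cong2[of _ _ _ _ "(+)"] sum.union_disjoint)
  also have "(\<Sum>l\<in>{1+k..D+k}. ?r l) = (\<Sum>l\<in>{1..D}. ?r (l + k))"
    by (rule sum.shift_bounds_cl_nat_ivl)
  also have "\<dots> = (\<Sum>l\<in>#X. of_nat l * gmom (add_mset (k + l) (X - {#l#})) Y)"
    by (subst sum_image_mset_eq_sum_count[OF _ X])
      (auto simp: loop_rest_def gmom_add_mset_left gmom_add_mset_right algebra_simps intro!: sum.cong)
  also have "(\<Sum>l\<in>{1..<k}. ?r l) = (\<Sum>j=1..<k. gmom (add_mset j (add_mset (k - j) X)) Y)"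
    by (intro sum.cong) (auto simp: loop_rest_def gmom_add_mset_left[of _ "add_mset _ _"])
  also have "?r k = of_nat N * gmom (add_mset k X) Y"
    by (simp add: loop_rest_def gmom_add_mset_left)
  finally show ?thesis unfolding loop_eq_def by (simp only: add.assoc)
qed

text \<open>Positive entries bound both the length and the entries by \<open>d\<close>. Finiteness
  lets the uniqueness argument pick the multiset with the largest discrepancy.\<close>

lemma finite_msets_sum_mset: "finite {X. 0 \<notin># X \<and> \<Sum>\<^sub># X = (d::nat)}"
proof (rule finite_subset)
  show "{X. 0 \<notin># X \<and> \<Sum>\<^sub># X = d} \<subseteq> mset ` {xs. set xs \<subseteq> {..d} \<and> length xs \<le> d}"
  proof safe
    fix X :: "nat multiset" assume X: "0 \<notin># X" and d: "d = \<Sum>\<^sub># X"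
    obtain xs where xs: "X = mset xs" by (metis ex_mset)
    have "set xs \<subseteq> {..sum_list xs}" by (auto intro: member_le_sum_list)
    moreover have "length xs \<le> sum_list xs" if "0 \<notin> set xs" for xs :: "nat list"
      using that by (induction xs) auto
    ultimately show "X \<in> mset ` {xs. set xs \<subseteq> {..\<Sum>\<^sub># X} \<and> length xs \<le> \<Sum>\<^sub># X}"
      using X by (auto simp: xs sum_mset_sum_list)
  qed
qed (intro finite_imageI finite_lists_length_le finite_atMost)

lemma cmod_sum_mset_le:
  fixes f :: "'a \<Rightarrow> complex"
  assumes "\<And>l. l \<in># X \<Longrightarrow> cmod (f l) \<le> g l"
  shows "cmod (\<Sum>l\<in>#X. f l) \<le> (\<Sum>l\<in>#X. g l)"
  using assms by (induction X) (auto intro!: norm_triangle_le add_mono)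

text \<open>The right-hand sides of the loop equations only involve smaller degrees, and on the left
  the terms other than the first have total weight \<open>d - 1 < N\<close>: the equations of degree \<open>d \<le> N\<close>
  are diagonally dominant.\<close>
lemma loop_eq_unique:
  fixes \<phi> :: "nat multiset \<Rightarrow> nat multiset \<Rightarrow> complex"
  assumes one: "\<phi> {#} {#} = 1"
    and deg: "\<And>X Y. \<Sum>\<^sub># X \<noteq> \<Sum>\<^sub># Y \<Longrightarrow> \<phi> X Y = 0"
    and loop: "\<And>k X Y. 0 < k \<Longrightarrow> 0 \<notin># X \<Longrightarrow> 0 \<notin># Y \<Longrightarrow> loop_eq N \<phi> k X Y"
    and "0 \<notin># X" "0 \<notin># Y" "\<Sum>\<^sub># Y \<le> N"
  shows "\<phi> X Y = gmom X Y"
proof (cases "\<Sum>\<^sub># X = \<Sum>\<^sub># Y")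
  case False
  then show ?thesis by (auto simp: deg gmom_def)
next
  case True
  then show ?thesis using assms(4-6)
  proof (induction "\<Sum>\<^sub># Y" arbitrary: X Y rule: less_induct)
    case (less Y X0)
    define d where "d = \<Sum>\<^sub># Y"
    show ?case
    proof (cases "d = 0")
      case True
      then have "\<Sum>\<^sub># X0 = 0" "\<Sum>\<^sub># Y = 0" using less.prems(1) d_def by simp_all
      then have z: "\<forall>x\<in>#X0. x = 0" "\<forall>x\<in>#Y. x = 0"
        by (simp_all only: sum_mset_0_iff)
      have "x \<notin># X0" "x \<notin># Y" for x using z less.prems(2,3) by (metis)+
      then have "X0 = {#}" "Y = {#}" by (auto intro: multiset_eqI simp: not_in_iff)
      then show ?thesis by (simp add: one gmom_def)
    next
      case False
      \<comment> \<open>\<open>Y\<close> stays fixed: the equations couple only moments whose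
        unconjugated part runs over the multisets of degree \<open>d\<close>.\<close>
      define S where "S = {X. 0 \<notin># X \<and> \<Sum>\<^sub># X = d}"
      define \<Delta> where "\<Delta> X = cmod (\<phi> X Y - gmom X Y)" for X
      have fin: "finite S" unfolding S_def by (rule finite_msets_sum_mset)
      have X0: "X0 \<in> S" using less.prems by (auto simp: S_def d_def)
      define M where "M = Max (\<Delta> ` S)"
      have M: "\<Delta> X \<le> M" if "X \<in> S" for X
        unfolding M_def using fin that by auto
      have "M \<in> \<Delta> ` S" unfolding M_def using fin X0 by (intro Max_in) auto
      then obtain X1 where X1: "X1 \<in> S" "M = \<Delta> X1" by blast
      have "X1 \<noteq> {#}" using X1 False by (auto simp: S_def)
      \<comment> \<open>Any element \<open>k\<close> of the maximiser \<open>X1\<close> will do: the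
        loop equation for \<open>k\<close> and \<open>X\<close> has \<open>N\<close> times the
        moment of \<open>X1\<close> as its diagonal term.\<close>
      then obtain k X where kX: "X1 = add_mset k X" by (cases X1) auto
      have k: "0 < k" and X: "0 \<notin># X" and d: "d = k + \<Sum>\<^sub># X"
        using X1 by (auto simp: S_def kX intro: gr0I)
      \<comment> \<open>In the branch \<open>l > k\<close> an entry \<open>l - k\<close> returns to
        the \<open>Y\<close> side, but the degree still drops because \<open>k\<close> is positive.
        The induction hypothesis therefore applies in every branch.\<close>
      have rest: "loop_rest N \<phi> k l X (Y - {#l#}) = loop_rest N gmom k l X (Y - {#l#})" if "l \<in># Y" for l
      proof -
        from multi_member_split[OF that] obtain Y' where Y: "Y = add_mset l Y'" by blast
        have l: "0 < l" "0 \<notin># Y'" "\<Sum>\<^sub># Y = l + \<Sum>\<^sub># Y'" "\<Sum>\<^sub># Y' < \<Sum>\<^sub># Y"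
          using less.prems(3) by (auto simp: Y intro: gr0I)
        have sm: "l + \<Sum>\<^sub># Y' = k + \<Sum>\<^sub># X" using d d_def l by simp
        have *: "\<phi> A B = gmom A B" if "\<Sum>\<^sub># B < \<Sum>\<^sub># Y" "\<Sum>\<^sub># A = \<Sum>\<^sub># B" "0 \<notin># A" "0 \<notin># B" for A B
          using less.hyps[OF that] less.prems that by simp
        show ?thesis unfolding loop_rest_def Y using k l sm X
          by (auto intro!: *)
      qed
      have eq\<phi>: "of_nat N * \<phi> (add_mset k X) Y
           + (\<Sum>j=1..<k. \<phi> (add_mset j (add_mset (k - j) X)) Y)
           + (\<Sum>l\<in>#X. of_nat l * \<phi> (add_mset (k + l) (X - {#l#})) Y)
         = (\<Sum>l\<in>#Y. of_nat l * loop_rest N \<phi> k l X (Y - {#l#}))"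
        using loop[OF k X less.prems(3)] unfolding loop_eq_def .
      have eqg: "of_nat N * gmom (add_mset k X) Y
           + (\<Sum>j=1..<k. gmom (add_mset j (add_mset (k - j) X)) Y)
           + (\<Sum>l\<in>#X. of_nat l * gmom (add_mset (k + l) (X - {#l#})) Y)
         = (\<Sum>l\<in>#Y. of_nat l * loop_rest N gmom k l X (Y - {#l#}))"
        using gmom_loop[OF X less.prems(3) k] unfolding loop_eq_def .
      have reseq: "(\<Sum>l\<in>#Y. of_nat l * loop_rest N \<phi> k l X (Y - {#l#}))
          = (\<Sum>l\<in>#Y. of_nat l * loop_rest N gmom k l X (Y - {#l#}))"
        using rest by (auto intro!: arg_cong[of _ _ sum_mset] image_mset_cong)
      let ?A = "\<Sum>j=1..<k. (\<phi> (add_mset j (add_mset (k - j) X)) Y - gmom (add_mset j (add_mset (k - j) X)) Y)"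
      let ?B = "\<Sum>l\<in>#X. of_nat l * (\<phi> (add_mset (k + l) (X - {#l#})) Y - gmom (add_mset (k + l) (X - {#l#})) Y)"
      have sub: "(\<Sum>l\<in>#Z. f l * (a l - b l)) = (\<Sum>l\<in>#Z. f l * a l) - (\<Sum>l\<in>#Z. f l * b l)"
        for Z :: "nat multiset" and f a b :: "nat \<Rightarrow> complex"
        by (induction Z) (simp_all add: algebra_simps)
      have B: "?B = (\<Sum>l\<in>#X. of_nat l * \<phi> (add_mset (k + l) (X - {#l#})) Y)
          - (\<Sum>l\<in>#X. of_nat l * gmom (add_mset (k + l) (X - {#l#})) Y)"
        by (rule sub)
      have lin: "e * (f - f') = - ((p - p') + (q - q'))"
        if "e * f + p + q = u" "e * f' + p' + q' = u" for e f f' p p' q q' u :: complex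
      proof -
        have "e * f = u - p - q" "e * f' = u - p' - q'" using that by (simp_all add: eq_diff_eq add_ac)
        then show ?thesis by (simp add: right_diff_distrib)
      qed
      have eq: "of_nat N * (\<phi> X1 Y - gmom X1 Y) = - (?A + ?B)"
        unfolding kX B sum_subtractf by (rule lin[OF eq\<phi>[unfolded reseq] eqg])
      have "real N * M = cmod (of_nat N * (\<phi> X1 Y - gmom X1 Y))"
        by (simp only: X1(2) \<Delta>_def norm_mult norm_of_nat)
      also have "\<dots> = cmod (?A + ?B)" unfolding eq by (rule norm_minus_cancel)
      also have "\<dots> \<le> cmod ?A + cmod ?B" by (rule norm_triangle_ineq)
      also have "cmod ?A \<le> (\<Sum>j=1..<k. M)"
      proof (rule sum_norm_le)
        fix j assume "j \<in> {1..<k}"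
        then have "add_mset j (add_mset (k - j) X) \<in> S" using X d by (auto simp: S_def)
        from M[OF this] show "cmod (\<phi> (add_mset j (add_mset (k - j) X)) Y
            - gmom (add_mset j (add_mset (k - j) X)) Y) \<le> M" unfolding \<Delta>_def .
      qed
      also have "cmod ?B \<le> (\<Sum>l\<in>#X. real l * M)"
      proof (rule cmod_sum_mset_le)
        fix l assume l: "l \<in># X"
        then obtain X' where X': "X = add_mset l X'" by (blast dest: multi_member_split)
        have "add_mset (k + l) (X - {#l#}) \<in> S" using X d k unfolding X' by (auto simp: S_def)
        from M[OF this] show "cmod (of_nat l * (\<phi> (add_mset (k + l) (X - {#l#})) Y
            - gmom (add_mset (k + l) (X - {#l#})) Y)) \<le> real l * M"
          unfolding \<Delta>_def by (simp add: norm_mult mult_left_mono)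
      qed
      also have "(\<Sum>l\<in>#X. real l * M) = real (\<Sum>\<^sub># X) * M"
        by (induction X) (auto simp: algebra_simps)
      finally have le: "real N * M \<le> (\<Sum>j=1..<k. M) + real (\<Sum>\<^sub># X) * M" by simp
      \<comment> \<open>The off-diagonal weights are \<open>k - 1\<close> from the splittings and
        \<open>q = d - k\<close> from \<open>X\<close>, so \<open>N * M\<close> is at most
        \<open>(d - 1) * M\<close>, which forces \<open>M\<close> to be nonpositive.\<close>
      define q where "q = real (\<Sum>\<^sub># X)"
      have "real (k - 1) = real d - 1 - q" using d k by (simp add: of_nat_diff q_def)
      then have "(\<Sum>j=1..<k. M) = (real d - 1 - q) * M" by simp
      with le have "(real N - real d + 1) * M \<le> 0" unfolding q_def[symmetric] by (simp add: algebra_simps)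
      moreover have "d \<le> N" using less.prems by (simp add: d_def)
      ultimately have "M \<le> 0" by (simp add: mult_le_0_iff)
      then have "\<Delta> X0 \<le> 0" using M[OF X0] by simp
      then show ?thesis by (simp add: \<Delta>_def)
    qed
  qed
qed

section \<open>Integration by parts on the torus\<close>

lemma measurable_cis [measurable]: "cis \<in> borel_measurable borel"
  by (intro borel_measurable_continuous_onI continuous_intros)

lemma prob_space_circle_unif: "prob_space circle_unif"
  unfolding circle_unif_def
  by (intro prob_space.prob_space_distr prob_space_uniform_measure)
    (auto simp: ennreal_eq_0_iff not_le)

lemma sets_circle_unif [simp, measurable_cong]: "sets circle_unif = sets borel"
  by (simp add: circle_unif_def)

lemma space_circle_unif [simp]: "space circle_unif = UNIV"
  by (simp add: circle_unif_def)

lemma AE_circle_unif_norm: "AE y in circle_unif. cmod y = 1"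
  unfolding circle_unif_def by (subst AE_distr_iff) auto

text \<open>The real part alone leaves at most two angles in a period, and a finite set is null.
  Absence of atoms is what makes coinciding eigenvalues negligible later.\<close>

lemma emeasure_circle_unif_singleton: "emeasure circle_unif {z} = 0"
proof -
  have "cis -` {z} \<inter> {0..2*pi} \<subseteq> {arccos (Re z), 2*pi - arccos (Re z)}"
  proof
    fix t assume "t \<in> cis -` {z} \<inter> {0..2*pi}"
    then have t: "0 \<le> t" "t \<le> 2*pi" and z: "Re z = cos t" by auto
    show "t \<in> {arccos (Re z), 2*pi - arccos (Re z)}"
    proof (cases "pi < t")
      case True
      then have "arccos (cos (2*pi - t)) = 2*pi - t" using t by (intro arccos_cos) auto
      moreover have "cos (2*pi - t) = cos t" by (simp add: cos_diff)
      ultimately show ?thesis by (simp add: z)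
    next
      case False
      then show ?thesis using t by (simp add: z arccos_cos)
    qed
  qed
  then have "finite (cis -` {z} \<inter> {0..2*pi})" by (rule finite_subset) auto
  then have "emeasure lborel ({0..2*pi} \<inter> cis -` {z}) = 0"
    by (simp add: Int_commute emeasure_lborel_countable countable_finite)
  moreover have "cis -` {z} \<in> sets borel"
    using measurable_sets[OF measurable_cis, of "{z}"] by simp
  ultimately show ?thesis
    unfolding circle_unif_def by (subst emeasure_distr) (auto simp: emeasure_uniform_measure)
qed

lemma integral_circle_unif:
  fixes f :: "complex \<Rightarrow> complex"
  assumes [measurable]: "f \<in> borel_measurable borel"
  shows "(\<integral>y. f y \<partial>circle_unif) = (1 / (2*pi)) *\<^sub>R (LINT t:{0..2*pi}|lborel. f (cis t))"
proof -
  have u: "uniform_measure lborel {0..2*pi} = density lborel (\<lambda>t. ennreal (indicator {0..2*pi} t / (2*pi)))"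
    unfolding uniform_measure_def
    by (intro density_cong)
      (auto simp: indicator_def divide_ennreal simp flip: ennreal_1 intro!: AE_I2)
  have "(\<integral>y. f y \<partial>circle_unif) = (\<integral>t. (indicator {0..2*pi} t / (2*pi)) *\<^sub>R f (cis t) \<partial>lborel)"
    unfolding circle_unif_def u by (subst integral_distr) (auto simp: integral_density)
  also have "\<dots> = (\<integral>t. (1 / (2*pi)) *\<^sub>R (indicator {0..2*pi} t *\<^sub>R f (cis t)) \<partial>lborel)"
    by (intro Bochner_Integration.integral_cong) auto
  finally show ?thesis
    by (simp only: set_lebesgue_integral_def Bochner_Integration.integral_scaleR_right)
qed

section \<open>Product measure on the torus and functions bounded there\<close>

abbreviation torus_measure :: "nat \<Rightarrow> (nat \<Rightarrow> complex) measure" where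
  "torus_measure N \<equiv> Pi\<^sub>M {..<N} (\<lambda>_. circle_unif)"

lemma prob_space_torus_measure: "prob_space (torus_measure N)"
  by (intro prob_space_PiM prob_space_circle_unif)

definition torus :: "nat \<Rightarrow> (nat \<Rightarrow> complex) \<Rightarrow> bool" where
  "torus N x \<longleftrightarrow> (\<forall>n<N. cmod (x n) = 1)"

lemma AE_torus: "AE x in torus_measure N. torus N x"
proof -
  have "AE x in torus_measure N. \<forall>n\<in>{..<N}. cmod (x n) = 1"
    by (intro AE_finite_allI AE_PiM_component prob_space_circle_unif AE_circle_unif_norm) auto
  then show ?thesis by eventually_elim (simp add: torus_def)
qed

text \<open>The product measure is carried by the torus but lives on all of complex space, where
  coordinates are unbounded; hence the bound is required on the torus only. The class is closed
  under algebra and conjugation, so integrability of every polynomial expression follows by rule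
  application.\<close>

definition nice :: "nat \<Rightarrow> ((nat \<Rightarrow> complex) \<Rightarrow> complex) \<Rightarrow> bool" where
  "nice N F \<longleftrightarrow> F \<in> borel_measurable (torus_measure N) \<and> (\<exists>C. \<forall>x. torus N x \<longrightarrow> cmod (F x) \<le> C)"

named_theorems nice_intros

lemma nice_const [nice_intros]: "nice N (\<lambda>_. c)"
  by (auto simp: nice_def)

lemma nice_coord [nice_intros]: "n < N \<Longrightarrow> nice N (\<lambda>x. x n)"
  by (auto simp: nice_def torus_def intro!: exI[of _ 1])

lemma nice_add [nice_intros]:
  assumes "nice N F" "nice N G" shows "nice N (\<lambda>x. F x + G x)"
proof -
  from assms obtain C D where "\<forall>x. torus N x \<longrightarrow> cmod (F x) \<le> C" "\<forall>x. torus N x \<longrightarrow> cmod (G x) \<le> D"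
    by (auto simp: nice_def)
  then have "\<forall>x. torus N x \<longrightarrow> cmod (F x + G x) \<le> C + D"
    by (auto intro!: norm_triangle_le add_mono)
  then show ?thesis using assms by (auto simp: nice_def)
qed

lemma nice_mult [nice_intros]:
  assumes "nice N F" "nice N G" shows "nice N (\<lambda>x. F x * G x)"
proof -
  from assms obtain C D where "\<forall>x. torus N x \<longrightarrow> cmod (F x) \<le> C" "\<forall>x. torus N x \<longrightarrow> cmod (G x) \<le> D"
    by (auto simp: nice_def)
  then have "\<forall>x. torus N x \<longrightarrow> cmod (F x * G x) \<le> C * D"
    by (metis norm_mult mult_mono' norm_ge_zero)
  then show ?thesis using assms by (auto simp: nice_def)
qed

lemma nice_cnj [nice_intros]: "nice N F \<Longrightarrow> nice N (\<lambda>x. cnj (F x))"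
  using measurable_compose[OF _ borel_measurable_continuous_onI[OF continuous_on_cnj[OF continuous_on_id]],
      of F "torus_measure N"]
  by (auto simp: nice_def)

lemma nice_uminus [nice_intros]: "nice N F \<Longrightarrow> nice N (\<lambda>x. - F x)"
  by (auto simp: nice_def)

lemma nice_diff [nice_intros]: "nice N F \<Longrightarrow> nice N G \<Longrightarrow> nice N (\<lambda>x. F x - G x)"
  using nice_add[of N F "\<lambda>x. - G x"] nice_uminus[of N G] by simp

lemma nice_power [nice_intros]: "nice N F \<Longrightarrow> nice N (\<lambda>x. F x ^ k)"
  by (induction k) (auto intro!: nice_const nice_mult)

lemma nice_sum [nice_intros]: "(\<And>i. i \<in> S \<Longrightarrow> nice N (F i)) \<Longrightarrow> nice N (\<lambda>x. \<Sum>i\<in>S. F i x)"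
  by (induction S rule: infinite_finite_induct) (auto intro!: nice_const nice_add)

lemma nice_prod [nice_intros]: "(\<And>i. i \<in> S \<Longrightarrow> nice N (F i)) \<Longrightarrow> nice N (\<lambda>x. \<Prod>i\<in>S. F i x)"
  by (induction S rule: infinite_finite_induct) (auto intro!: nice_const nice_mult)

lemma nice_sum_mset [nice_intros]: "(\<And>i. i \<in># S \<Longrightarrow> nice N (F i)) \<Longrightarrow> nice N (\<lambda>x. \<Sum>i\<in>#S. F i x)"
  by (induction S) (auto intro!: nice_const nice_add)

lemma nice_prod_mset [nice_intros]: "(\<And>i. i \<in># S \<Longrightarrow> nice N (F i)) \<Longrightarrow> nice N (\<lambda>x. \<Prod>i\<in>#S. F i x)"
  by (induction S) (auto intro!: nice_const nice_mult)

lemma nice_if [nice_intros]: "(P \<Longrightarrow> nice N F) \<Longrightarrow> (\<not> P \<Longrightarrow> nice N G) \<Longrightarrow> nice N (\<lambda>x. if P then F x else G x)"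
  by (cases P) auto

lemma nice_integrable_torus: "nice N F \<Longrightarrow> integrable (torus_measure N) F"
proof -
  assume F: "nice N F"
  then obtain C where C: "\<forall>x. torus N x \<longrightarrow> cmod (F x) \<le> C" by (auto simp: nice_def)
  interpret prob_space "torus_measure N" by (rule prob_space_torus_measure)
  show ?thesis
  proof (rule integrable_const_bound)
    show "AE x in torus_measure N. cmod (F x) \<le> C"
      using AE_torus by eventually_elim (use C in auto)
  qed (use F in \<open>simp add: nice_def\<close>)
qed

text \<open>\<open>dcirc n F F'\<close> states \<open>x\<^sub>n \<partial>F/\<partial>x\<^sub>n = F'\<close> where \<open>x\<^sub>n\<close> moves on the unit circle.\<close>
definition dcirc :: "nat \<Rightarrow> ((nat \<Rightarrow> complex) \<Rightarrow> complex) \<Rightarrow> ((nat \<Rightarrow> complex) \<Rightarrow> complex) \<Rightarrow> bool" where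
  "dcirc n F F' \<longleftrightarrow> (\<forall>x t. ((\<lambda>t. F (x(n := cis t))) has_vector_derivative \<i> * F' (x(n := cis t))) (at t))"

lemma dcirc_const: "dcirc n (\<lambda>_. c) (\<lambda>_. 0)"
  by (auto simp: dcirc_def)

lemma dcirc_coord: "dcirc n (\<lambda>x. x i) (\<lambda>x. if i = n then x n else 0)"
proof -
  have "(cis has_vector_derivative \<i> * cis t) (at t)" for t
    using has_derivative_cis[of "\<lambda>t. t" "\<lambda>t. t" t UNIV]
    by (auto simp: has_vector_derivative_def scaleR_conv_of_real algebra_simps)
  then show ?thesis by (auto simp: dcirc_def)
qed

lemma dcirc_add: "dcirc n F F' \<Longrightarrow> dcirc n G G' \<Longrightarrow> dcirc n (\<lambda>x. F x + G x) (\<lambda>x. F' x + G' x)"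
  unfolding dcirc_def by (auto simp: distrib_left intro!: has_vector_derivative_add)

text \<open>Conjugation flips the factor i in front of the derivative. This sign is what places the
  \<open>Y\<close> terms on the other side of the loop equations.\<close>

lemma dcirc_cnj: "dcirc n F F' \<Longrightarrow> dcirc n (\<lambda>x. cnj (F x)) (\<lambda>x. - cnj (F' x))"
  unfolding dcirc_def
proof safe
  fix x t assume "\<forall>x t. ((\<lambda>t. F (x(n := cis t))) has_vector_derivative \<i> * F' (x(n := cis t))) (at t)"
  then have "((\<lambda>t. cnj (F (x(n := cis t)))) has_vector_derivative cnj (\<i> * F' (x(n := cis t)))) (at t)"
    by (intro has_vector_derivative_cnj) auto
  then show "((\<lambda>t. cnj (F (x(n := cis t)))) has_vector_derivative \<i> * - cnj (F' (x(n := cis t)))) (at t)"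
    by simp
qed

lemma dcirc_mult:
  assumes "dcirc n F F'" "dcirc n G G'"
  shows "dcirc n (\<lambda>x. F x * G x) (\<lambda>x. F' x * G x + F x * G' x)"
  unfolding dcirc_def
proof safe
  fix x t
  have "((\<lambda>t. F (x(n := cis t)) * G (x(n := cis t))) has_vector_derivative
      F (x(n := cis t)) * (\<i> * G' (x(n := cis t))) + (\<i> * F' (x(n := cis t))) * G (x(n := cis t))) (at t)"
    using assms unfolding dcirc_def by (intro has_vector_derivative_mult) auto
  then show "((\<lambda>t. F (x(n := cis t)) * G (x(n := cis t))) has_vector_derivative
      \<i> * (F' (x(n := cis t)) * G (x(n := cis t)) + F (x(n := cis t)) * G' (x(n := cis t)))) (at t)"
    by (simp add: algebra_simps)
qed

lemma dcirc_cong: "dcirc n F F' \<Longrightarrow> (\<And>x. F x = G x) \<Longrightarrow> (\<And>x. F' x = G' x) \<Longrightarrow> dcirc n G G'"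
  by (auto simp: dcirc_def)

lemma dcirc_diff: "dcirc n F F' \<Longrightarrow> dcirc n G G' \<Longrightarrow> dcirc n (\<lambda>x. F x - G x) (\<lambda>x. F' x - G' x)"
  unfolding dcirc_def by (auto simp: right_diff_distrib intro!: has_vector_derivative_diff)

lemma dcirc_sum: "(\<And>i. i \<in> S \<Longrightarrow> dcirc n (F i) (F' i)) \<Longrightarrow> dcirc n (\<lambda>x. \<Sum>i\<in>S. F i x) (\<lambda>x. \<Sum>i\<in>S. F' i x)"
  by (induction S rule: infinite_finite_induct) (auto intro: dcirc_const dcirc_add)

lemma dcirc_coord_power: "dcirc n (\<lambda>x. x i ^ k) (\<lambda>x. if i = n then of_nat k * x n ^ k else 0)"
proof (induction k)
  case (Suc k)
  show ?case
    by (rule dcirc_cong[OF dcirc_mult[OF dcirc_coord Suc]]) (auto simp: algebra_simps)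
next
  case 0
  show ?case by (cases "i = n") (simp_all add: dcirc_const)
qed

lemma dcirc_prod:
  assumes "finite S" "\<And>i. i \<in> S \<Longrightarrow> dcirc n (F i) (F' i)"
  shows "dcirc n (\<lambda>x. \<Prod>i\<in>S. F i x) (\<lambda>x. \<Sum>i\<in>S. F' i x * (\<Prod>j\<in>S - {i}. F j x))"
  using assms
proof (induction S rule: finite_induct)
  case (insert a S)
  have *: "(\<Sum>i\<in>S. F' i x * (\<Prod>j\<in>insert a S - {i}. F j x)) = F a x * (\<Sum>i\<in>S. F' i x * (\<Prod>j\<in>S - {i}. F j x))" for x
    unfolding sum_distrib_left
  proof (rule sum.cong)
    fix i assume "i \<in> S"
    then have "insert a S - {i} = insert a (S - {i})" using insert by auto
    then show "F' i x * (\<Prod>j\<in>insert a S - {i}. F j x) = F a x * (F' i x * (\<Prod>j\<in>S - {i}. F j x))"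
      using insert by simp
  qed simp
  show ?case
  proof (rule dcirc_cong)
    show "dcirc n (\<lambda>x. F a x * (\<Prod>i\<in>S. F i x))
        (\<lambda>x. F' a x * (\<Prod>i\<in>S. F i x) + F a x * (\<Sum>i\<in>S. F' i x * (\<Prod>j\<in>S - {i}. F j x)))"
      using insert by (intro dcirc_mult) auto
    show "F a x * (\<Prod>i\<in>S. F i x) = (\<Prod>i\<in>insert a S. F i x)" for x
      using insert by simp
    have "insert a S - {a} = S" using insert by auto
    then show "F' a x * (\<Prod>i\<in>S. F i x) + F a x * (\<Sum>i\<in>S. F' i x * (\<Prod>j\<in>S - {i}. F j x))
        = (\<Sum>i\<in>insert a S. F' i x * (\<Prod>j\<in>insert a S - {i}. F j x))" for x
      unfolding sum.insert[OF insert.hyps] * by simp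
  qed
next
  case empty
  show ?case by (simp add: dcirc_const)
qed

text \<open>Fubini isolates the coordinate \<open>n\<close>; on that circle the integrand is the
  derivative of a function of the angle with period \<open>2 * pi\<close>, so the boundary values
  cancel.\<close>

lemma integral_dcirc:
  assumes F: "dcirc n F F'" and n: "n < N" and F': "nice N F'"
  shows "(\<integral>x. F' x \<partial>torus_measure N) = 0"
proof -
  interpret product_sigma_finite "\<lambda>_::nat. circle_unif"
    unfolding product_sigma_finite_def
    using prob_space_circle_unif prob_space_imp_sigma_finite by blast
  define I where "I = {..<N} - {n}"
  have I: "{..<N} = insert n I" "finite I" "n \<notin> I" using n by (auto simp: I_def)
  have inner: "(\<integral>y. F' (x(n := y)) \<partial>circle_unif) = 0" if x: "x \<in> space (Pi\<^sub>M I (\<lambda>_. circle_unif))" for x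
  proof -
    have "(\<lambda>y. x(n := y)) \<in> measurable circle_unif (Pi\<^sub>M (insert n I) (\<lambda>_. circle_unif))"
      using measurable_component_update[OF x I(3)] .
    then have "(\<lambda>y. F' (x(n := y))) \<in> borel_measurable circle_unif"
      using F' unfolding nice_def I(1) by (auto intro: measurable_compose)
    then have m: "(\<lambda>y. F' (x(n := y))) \<in> borel_measurable borel" by (simp cong: measurable_cong_sets)
    let ?f = "\<lambda>t. F' (x(n := cis t))"
    have "(LINT t:{0..2*pi}|lborel. ?f t) = 0"
    \<comment> \<open>A slice that fails to be integrable has integral 0 by convention, so the inner
      integral is 0 for every \<open>x\<close>, without an exceptional set.\<close>
    proof (cases "set_integrable lborel {0..2*pi} ?f")
      case True
      have "((\<lambda>t. \<i> * ?f t) has_integral (F (x(n := cis (2*pi))) - F (x(n := cis 0)))) {0..2*pi}"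
      proof (rule fundamental_theorem_of_calculus)
        fix t
        show "((\<lambda>t. F (x(n := cis t))) has_vector_derivative \<i> * ?f t) (at t within {0..2*pi})"
          using F[unfolded dcirc_def, rule_format, of x t] by (rule has_vector_derivative_at_within)
      qed simp
      then have "((\<lambda>t. \<i> * ?f t) has_integral 0) {0..2*pi}" by simp
      then have "((\<lambda>t. (-\<i>) * (\<i> * ?f t)) has_integral (-\<i>) * 0) {0..2*pi}"
        by (rule has_integral_mult_right)
      then have "(?f has_integral 0) {0..2*pi}" by (simp flip: mult.assoc)
      then show ?thesis using set_borel_integral_eq_integral(2)[OF True] by (simp add: integral_unique)
    next
      case False
      then show ?thesis
        unfolding set_integrable_def set_lebesgue_integral_def by (rule not_integrable_integral_eq)
    qed
    then show ?thesis by (simp add: integral_circle_unif[OF m])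
  qed
  have "(\<integral>x. F' x \<partial>torus_measure N) = (\<integral>x. (\<integral>y. F' (x(n := y)) \<partial>circle_unif) \<partial>Pi\<^sub>M I (\<lambda>_. circle_unif))"
    using nice_integrable_torus[OF F'] unfolding I(1) by (intro product_integral_insert I) auto
  also have "\<dots> = (\<integral>x. 0 \<partial>Pi\<^sub>M I (\<lambda>_. circle_unif))"
    by (intro Bochner_Integration.integral_cong inner) auto
  finally show ?thesis by simp
qed

section \<open>The Weyl density\<close>

definition power_sum :: "nat \<Rightarrow> nat \<Rightarrow> (nat \<Rightarrow> complex) \<Rightarrow> complex" where
  "power_sum N k x = (\<Sum>n<N. x n ^ k)"

lemma power_sum_0 [simp]: "power_sum N 0 x = of_nat N"
  by (simp add: power_sum_def)

definition pairs :: "nat \<Rightarrow> (nat \<times> nat) set" where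
  "pairs N = {(i, j). i < j \<and> j < N}"

lemma finite_pairs [simp]: "finite (pairs N)"
  by (rule finite_subset[of _ "{..<N} \<times> {..<N}"]) (auto simp: pairs_def)

lemma sum_symmetric_pairs:
  fixes f :: "nat \<Rightarrow> nat \<Rightarrow> complex"
  assumes "\<And>i j. f i j = f j i"
  shows "(\<Sum>i<N. \<Sum>j<N. f i j) = 2 * (\<Sum>(i, j)\<in>pairs N. f i j) + (\<Sum>i<N. f i i)"
proof (induction N)
  case (Suc N)
  have p: "pairs (Suc N) = pairs N \<union> (\<lambda>i. (i, N)) ` {..<N}" by (auto simp: pairs_def less_Suc_eq)
  have "(\<Sum>(i, j)\<in>pairs (Suc N). f i j) = (\<Sum>(i, j)\<in>pairs N. f i j) + (\<Sum>(i, j)\<in>(\<lambda>i. (i, N)) ` {..<N}. f i j)"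
    unfolding p by (rule sum.union_disjoint) (simp_all, auto simp: pairs_def)
  also have "(\<Sum>(i, j)\<in>(\<lambda>i. (i, N)) ` {..<N}. f i j) = (\<Sum>i<N. f i N)"
    by (subst sum.reindex) (auto simp: inj_on_def)
  finally have q: "(\<Sum>(i, j)\<in>pairs (Suc N). f i j) = (\<Sum>(i, j)\<in>pairs N. f i j) + (\<Sum>i<N. f i N)" .
  have "(\<Sum>j<N. f N j) = (\<Sum>i<N. f i N)" using assms by (intro sum.cong) auto
  then show ?case using Suc unfolding q by (simp add: sum.distrib algebra_simps)
qed (simp add: pairs_def)

text \<open>The squared distance as a polynomial in the coordinates and their conjugates, the form
  to which the \<open>dcirc\<close> rules apply.\<close>

definition weyl_factor :: "nat \<times> nat \<Rightarrow> (nat \<Rightarrow> complex) \<Rightarrow> complex" where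
  "weyl_factor p x = (x (fst p) - x (snd p)) * (cnj (x (fst p)) - cnj (x (snd p)))"

lemma weyl_eq_prod: "complex_of_real (weyl N x) = (\<Prod>p\<in>pairs N. weyl_factor p x)"
proof -
  have s: "(SIGMA i:{..<N}. {i<..<N}) = pairs N" by (auto simp: pairs_def)
  have "complex_of_real (weyl N x) = (\<Prod>i<N. \<Prod>j\<in>{i<..<N}. weyl_factor (i, j) x)"
    unfolding weyl_def of_real_prod
    by (intro prod.cong) (auto simp: weyl_factor_def complex_norm_square simp flip: of_real_power)
  also have "\<dots> = (\<Prod>(i, j)\<in>pairs N. weyl_factor (i, j) x)"
    unfolding s[symmetric] by (rule prod.Sigma) auto
  finally show ?thesis by (simp add: case_prod_unfold)
qed

text \<open>The angular derivative in \<open>x i\<close> of the squared distance from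
  \<open>x i\<close> to \<open>x j\<close>, after the terms \<open>x i * cnj (x i)\<close> have
  cancelled. It is antisymmetric in \<open>i\<close> and \<open>j\<close>.\<close>

definition dweyl :: "nat \<Rightarrow> nat \<Rightarrow> (nat \<Rightarrow> complex) \<Rightarrow> complex" where
  "dweyl i j x = x j * cnj (x i) - x i * cnj (x j)"

definition dweyl_factor :: "nat \<Rightarrow> nat \<times> nat \<Rightarrow> (nat \<Rightarrow> complex) \<Rightarrow> complex" where
  "dweyl_factor n p x = (if fst p = n then dweyl (fst p) (snd p) x else 0)
     + (if snd p = n then dweyl (snd p) (fst p) x else 0)"

lemma dcirc_weyl_factor: "dcirc n (weyl_factor p) (dweyl_factor n p)"
  by (rule dcirc_cong[OF dcirc_mult[OF dcirc_diff[OF dcirc_coord[of n "fst p"] dcirc_coord[of n "snd p"]]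
        dcirc_diff[OF dcirc_cnj[OF dcirc_coord[of n "fst p"]] dcirc_cnj[OF dcirc_coord[of n "snd p"]]]]])
    (auto simp: weyl_factor_def dweyl_factor_def dweyl_def algebra_simps)

text \<open>Leibniz's rule with the differentiated factor left out of the product, rather than a
  logarithmic derivative: the density vanishes where coordinates coincide.\<close>

definition weyl' :: "nat \<Rightarrow> nat \<Rightarrow> (nat \<Rightarrow> complex) \<Rightarrow> complex" where
  "weyl' N n x = (\<Sum>p\<in>pairs N. dweyl_factor n p x * (\<Prod>q\<in>pairs N - {p}. weyl_factor q x))"

lemma dcirc_weyl: "dcirc n (\<lambda>x. complex_of_real (weyl N x)) (weyl' N n)"
  unfolding weyl_eq_prod weyl'_def by (intro dcirc_prod dcirc_weyl_factor finite_pairs)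

lemma nice_weyl_factor: "p \<in> pairs N \<Longrightarrow> nice N (weyl_factor p)"
  unfolding weyl_factor_def by (intro nice_intros) (auto simp: pairs_def)

lemma nice_weyl: "nice N (\<lambda>x. complex_of_real (weyl N x))"
  unfolding weyl_eq_prod by (intro nice_intros nice_weyl_factor)

lemma nice_weyl': "nice N (weyl' N n)"
  unfolding weyl'_def dweyl_factor_def dweyl_def
  by (intro nice_intros nice_weyl_factor) (auto simp: pairs_def)

text \<open>The polynomial form of \<open>(a ^ k - b ^ k) * (a + b) / (a - b)\<close>, meaningful on
  the diagonal too.\<close>

definition loop_kernel :: "nat \<Rightarrow> complex \<Rightarrow> complex \<Rightarrow> complex" where
  "loop_kernel k a b = (\<Sum>l<k. b ^ (k - Suc l) * a ^ l) * (a + b)"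

lemma loop_kernel_commute: "loop_kernel k a b = loop_kernel k b a"
proof -
  have "(\<Sum>l<k. b ^ (k - Suc l) * a ^ l) = (\<Sum>l<k. a ^ (k - Suc l) * b ^ l)"
    by (subst sum.nat_diff_reindex[symmetric], rule sum.cong) (auto simp: mult.commute)
  then show ?thesis by (simp add: loop_kernel_def add.commute)
qed

definition loop_sum :: "nat \<Rightarrow> nat \<Rightarrow> (nat \<Rightarrow> complex) \<Rightarrow> complex" where
  "loop_sum N k x = (\<Sum>(i, j)\<in>pairs N. loop_kernel k (x i) (x j))"

lemma loop_sum_0 [simp]: "loop_sum N 0 x = 0"
  by (simp add: loop_sum_def loop_kernel_def case_prod_unfold)

text \<open>Summing the symmetric kernel over all ordered pairs gives twice the sum over
  \<open>pairs N\<close> plus a diagonal of \<open>2 * k\<close> times the power sum; half of that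
  diagonal is the extra term on the left. Expanded in monomials, the same double sum factors into
  products of two power sums, and the extreme splittings contain the power sum of index 0, which is
  \<open>N\<close>.\<close>

lemma loop_sum_eq:
  assumes "0 < k"
  shows "loop_sum N k x + of_nat k * power_sum N k x
    = of_nat N * power_sum N k x + (\<Sum>j=1..<k. power_sum N j x * power_sum N (k - j) x)"
proof -
  let ?P = "\<lambda>k. power_sum N k x"
  let ?S = "\<Sum>j=1..<k. ?P j * ?P (k - j)"
  have diag: "(\<Sum>i<N. loop_kernel k (x i) (x i)) = 2 * (of_nat k * ?P k)"
  proof -
    have "loop_kernel k a a = 2 * (of_nat k * a ^ k)" for a
    proof -
      have "(\<Sum>l<k. a ^ (k - Suc l) * a ^ l) = of_nat k * a ^ (k - 1)"
        by (simp flip: power_add)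
      then show ?thesis using assms
        by (simp add: loop_kernel_def power_eq_if[of a k])
    qed
    then show ?thesis by (simp add: power_sum_def sum_distrib_left)
  qed
  have "(\<Sum>i<N. \<Sum>j<N. loop_kernel k (x i) (x j))
      = (\<Sum>i<N. \<Sum>j<N. \<Sum>l<k. x i ^ Suc l * x j ^ (k - Suc l) + x i ^ l * x j ^ (k - l))"
  proof (intro sum.cong refl)
    fix i j
    have "x j ^ (k - l) = x j * x j ^ (k - Suc l)" if "l < k" for l
      using that by (metis Suc_diff_Suc power_Suc)
    then show "loop_kernel k (x i) (x j) = (\<Sum>l<k. x i ^ Suc l * x j ^ (k - Suc l) + x i ^ l * x j ^ (k - l))"
      unfolding loop_kernel_def sum_distrib_right by (intro sum.cong) (auto simp: algebra_simps)
  qed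
  also have "\<dots> = (\<Sum>l<k. \<Sum>i<N. \<Sum>j<N. x i ^ Suc l * x j ^ (k - Suc l) + x i ^ l * x j ^ (k - l))"
    by (simp only: sum.swap[of _ "{..<k}"])
  also have "\<dots> = (\<Sum>l<k. ?P (Suc l) * ?P (k - Suc l)) + (\<Sum>l<k. ?P l * ?P (k - l))"
    by (simp only: power_sum_def sum_product sum.distrib)
  also have "(\<Sum>l<k. ?P (Suc l) * ?P (k - Suc l)) = (\<Sum>l\<in>{1..<Suc k}. ?P l * ?P (k - l))"
    by (rule sum.reindex_bij_witness[of _ "\<lambda>l. l - 1" Suc]) auto
  also have "\<dots> = of_nat N * ?P k + ?S"
    using assms by (subst sum.atLeastLessThan_Suc) (auto simp: mult.commute)
  also have "(\<Sum>l<k. ?P l * ?P (k - l)) = of_nat N * ?P k + ?S"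
    using assms by (simp add: lessThan_atLeast0 sum.atLeast_Suc_lessThan[of 0 k])
  finally have "2 * (loop_sum N k x + of_nat k * ?P k) = 2 * (of_nat N * ?P k + ?S)"
    using sum_symmetric_pairs[of "\<lambda>i j. loop_kernel k (x i) (x j)" N, OF loop_kernel_commute] diag
    unfolding loop_sum_def by (simp add: algebra_simps)
  then show ?thesis unfolding mult_cancel_left by simp
qed

text \<open>A pair \<open>i\<close>, \<open>j\<close> contributes
  \<open>(x i ^ k - x j ^ k) * dweyl i j x\<close>. Splitting off \<open>x i - x j\<close> and using
  that both points have modulus 1 turns \<open>dweyl\<close> into \<open>x i + x j\<close> times the
  missing factor of the density.\<close>

lemma weyl_loop:
  assumes "torus N x"
  shows "(\<Sum>n<N. x n ^ k * weyl' N n x) = complex_of_real (weyl N x) * loop_sum N k x"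
proof -
  let ?R = "\<lambda>p. \<Prod>q\<in>pairs N - {p}. weyl_factor q x"
  have "(\<Sum>n<N. x n ^ k * weyl' N n x) = (\<Sum>p\<in>pairs N. \<Sum>n<N. x n ^ k * (dweyl_factor n p x * ?R p))"
    unfolding weyl'_def sum_distrib_left by (rule sum.swap)
  also have "\<dots> = (\<Sum>p\<in>pairs N. complex_of_real (weyl N x) * loop_kernel k (x (fst p)) (x (snd p)))"
  proof (rule sum.cong)
    fix p assume p: "p \<in> pairs N"
    then obtain i j where ij: "p = (i, j)" "i < j" "j < N" by (auto simp: pairs_def)
    have c: "x i * cnj (x i) = 1" "x j * cnj (x j) = 1"
      using assms ij by (auto simp: torus_def simp flip: complex_norm_square)
    have "(\<Sum>n<N. x n ^ k * dweyl_factor n p x)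
        = (\<Sum>n<N. (if n = i then x n ^ k * dweyl i j x else 0) + (if n = j then x n ^ k * dweyl j i x else 0))"
      by (intro sum.cong) (auto simp: dweyl_factor_def ij)
    also have "\<dots> = (x i ^ k - x j ^ k) * dweyl i j x"
      using ij by (simp add: sum.distrib dweyl_def algebra_simps)
    also have "\<dots> = (\<Sum>l<k. x j ^ (k - Suc l) * x i ^ l) * ((x i - x j) * dweyl i j x)"
      by (simp add: power_diff_sumr2)
    also have "(x i - x j) * dweyl i j x = (x i + x j) * weyl_factor p x"
      using c unfolding ij dweyl_def weyl_factor_def fst_conv snd_conv by algebra
    finally have "(\<Sum>n<N. x n ^ k * dweyl_factor n p x) = loop_kernel k (x i) (x j) * weyl_factor p x"
      by (simp add: loop_kernel_def)
    then have "(\<Sum>n<N. x n ^ k * (dweyl_factor n p x * ?R p)) = loop_kernel k (x i) (x j) * (weyl_factor p x * ?R p)"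
      by (simp add: mult.assoc[symmetric] flip: sum_distrib_right)
    also have "weyl_factor p x * ?R p = complex_of_real (weyl N x)"
      unfolding weyl_eq_prod using p by (simp add: prod.remove)
    finally show "(\<Sum>n<N. x n ^ k * (dweyl_factor n p x * ?R p))
        = complex_of_real (weyl N x) * loop_kernel k (x (fst p)) (x (snd p))"
      by (simp add: ij)
  qed simp
  finally show ?thesis by (simp add: loop_sum_def sum_distrib_left case_prod_unfold)
qed

lemma nice_power_sum [nice_intros]: "nice N (power_sum N k)"
  unfolding power_sum_def by (intro nice_intros) auto

lemma nice_loop_sum [nice_intros]: "nice N (loop_sum N k)"
  unfolding loop_sum_def loop_kernel_def case_prod_unfold by (intro nice_intros) (auto simp: pairs_def)

lemma torus_loop:
  assumes F: "nice N F" and dF: "\<And>n. n < N \<Longrightarrow> dcirc n F (F' n)" and F': "\<And>n. n < N \<Longrightarrow> nice N (F' n)"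
  shows "(\<integral>x. complex_of_real (weyl N x) * ((of_nat k * power_sum N k x + loop_sum N k x) * F x
            + (\<Sum>n<N. x n ^ k * F' n x)) \<partial>torus_measure N) = 0"
proof -
  let ?W = "\<lambda>x. complex_of_real (weyl N x)"
  \<comment> \<open>\<open>?g n\<close> is the angular derivative of
    \<open>x n ^ k * (F x * ?W x)\<close>, so its integral vanishes.\<close>
  let ?g = "\<lambda>n x. (of_nat k * x n ^ k) * (F x * ?W x) + x n ^ k * (F' n x * ?W x + F x * weyl' N n x)"
  have g: "nice N (?g n)" if "n < N" for n
    using that by (intro nice_intros nice_weyl nice_weyl' F F')
  have g0: "(\<integral>x. ?g n x \<partial>torus_measure N) = 0" if n: "n < N" for n
  proof (rule integral_dcirc[OF _ n g[OF n]])
    show "dcirc n (\<lambda>x. x n ^ k * (F x * ?W x)) (?g n)"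
      by (rule dcirc_cong[OF dcirc_mult[OF dcirc_coord_power[of n n k] dcirc_mult[OF dF[OF n] dcirc_weyl]]]) auto
  qed
  have "AE x in torus_measure N. ?W x * ((of_nat k * power_sum N k x + loop_sum N k x) * F x
            + (\<Sum>n<N. x n ^ k * F' n x)) = (\<Sum>n<N. ?g n x)"
    using AE_torus
  proof eventually_elim
    case (elim x)
    have "(\<Sum>n<N. ?g n x) = of_nat k * power_sum N k x * F x * ?W x
        + (\<Sum>n<N. x n ^ k * F' n x) * ?W x + F x * (\<Sum>n<N. x n ^ k * weyl' N n x)"
      unfolding power_sum_def sum.distrib sum_distrib_left sum_distrib_right
      by (simp add: sum.distrib algebra_simps)
    then show ?case unfolding weyl_loop[OF elim] by (simp add: algebra_simps)
  qed
  then have "(\<integral>x. ?W x * ((of_nat k * power_sum N k x + loop_sum N k x) * F x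
            + (\<Sum>n<N. x n ^ k * F' n x)) \<partial>torus_measure N) = (\<integral>x. (\<Sum>n<N. ?g n x) \<partial>torus_measure N)"
    using F F' g
    by (intro integral_cong_AE borel_measurable_integrable nice_integrable_torus nice_intros nice_weyl nice_weyl') auto
  also have "\<dots> = (\<Sum>n<N. \<integral>x. ?g n x \<partial>torus_measure N)"
    by (intro Bochner_Integration.integral_sum nice_integrable_torus g) auto
  finally show ?thesis using g0 by simp
qed

section \<open>Moments of power sums\<close>

lemma weyl_nonneg: "0 \<le> weyl N x"
  by (simp add: weyl_def prod_nonneg)

lemma integrable_weyl: "integrable (torus_measure N) (weyl N)"
  using integrable_Re[OF nice_integrable_torus[OF nice_weyl[of N]]] by simp

lemma measurable_weyl [measurable]: "weyl N \<in> borel_measurable (torus_measure N)"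
  by (rule borel_measurable_integrable[OF integrable_weyl])

lemma AE_torus_distinct:
  assumes "i < N" "j < N" "i \<noteq> j"
  shows "AE x in torus_measure N. x i \<noteq> x j"
proof -
  interpret product_sigma_finite "\<lambda>_::nat. circle_unif"
    unfolding product_sigma_finite_def
    using prob_space_circle_unif prob_space_imp_sigma_finite by blast
  define I where "I = {..<N} - {i}"
  have I: "{..<N} = insert i I" "finite I" "i \<notin> I" "j \<in> I" using assms by (auto simp: I_def)
  let ?f = "\<lambda>x. indicator {0} (x i - x j) :: ennreal"
  have m: "?f \<in> borel_measurable (torus_measure N)" 
  proof -
    have [measurable]: "(\<lambda>x. x i) \<in> borel_measurable (torus_measure N)"
      "(\<lambda>x. x j) \<in> borel_measurable (torus_measure N)"
      using nice_coord[OF assms(1)] nice_coord[OF assms(2)] by (simp_all add: nice_def)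
    show ?thesis by measurable
  qed
  have "(\<integral>\<^sup>+x. ?f x \<partial>torus_measure N)
      = (\<integral>\<^sup>+x. (\<integral>\<^sup>+y. ?f (x(i := y)) \<partial>circle_unif) \<partial>Pi\<^sub>M I (\<lambda>_. circle_unif))"
    using m unfolding I(1) by (intro product_nn_integral_insert I) auto
  also have "\<dots> = (\<integral>\<^sup>+x. (\<integral>\<^sup>+y. indicator {x j} y \<partial>circle_unif) \<partial>Pi\<^sub>M I (\<lambda>_. circle_unif))"
    using assms by (intro nn_integral_cong) (auto simp: indicator_def)
  also have "\<dots> = 0" by (simp add: emeasure_circle_unif_singleton)
  finally have "AE x in torus_measure N. ?f x = 0"
    using m by (simp add: nn_integral_0_iff_AE)
  then show ?thesis by eventually_elim (auto simp: indicator_def split: if_splits)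
qed

definition weyl_norm :: "nat \<Rightarrow> real" where
  "weyl_norm N = (\<integral>x. weyl N x \<partial>torus_measure N)"

text \<open>The density vanishes only where two coordinates coincide, which is a null set, so its
  integral cannot be 0.\<close>

lemma weyl_norm_pos: "0 < weyl_norm N"
proof -
  interpret prob_space "torus_measure N" by (rule prob_space_torus_measure)
  have "AE x in torus_measure N. \<forall>p\<in>pairs N. x (fst p) \<noteq> x (snd p)"
    by (intro AE_finite_allI finite_pairs AE_torus_distinct) (auto simp: pairs_def)
  then have ne: "AE x in torus_measure N. weyl N x \<noteq> 0"
  proof eventually_elim
    case (elim x)
    then have "complex_of_real (weyl N x) \<noteq> 0"
      unfolding weyl_eq_prod weyl_factor_def by (auto simp flip: complex_cnj_diff)
    then show ?case by simp
  qed
  have "weyl_norm N \<noteq> 0"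
  proof
    assume "weyl_norm N = 0"
    then have "AE x in torus_measure N. weyl N x = 0"
      unfolding weyl_norm_def
      by (subst (asm) integral_nonneg_eq_0_iff_AE) (auto simp: integrable_weyl weyl_nonneg)
    with ne have "AE x in torus_measure N. False" by eventually_elim auto
    then show False by (simp add: AE_False)
  qed
  moreover have "0 \<le> weyl_norm N" unfolding weyl_norm_def by (simp add: weyl_nonneg)
  ultimately show ?thesis by simp
qed

section \<open>The eigenvalue distribution and its expectation functional\<close>

lemma haar_eig_eq: "haar_eig N = density (torus_measure N) (\<lambda>x. ennreal (weyl N x / weyl_norm N))"
  by (simp add: haar_eig_def weyl_norm_def Let_def)

lemma sets_haar_eig [simp, measurable_cong]: "sets (haar_eig N) = sets (torus_measure N)"
  by (simp add: haar_eig_eq)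

lemma prob_space_haar_eig: "prob_space (haar_eig N)"
proof
  have "emeasure (haar_eig N) (space (haar_eig N))
      = (\<integral>\<^sup>+x. ennreal (weyl N x / weyl_norm N) \<partial>torus_measure N)"
    unfolding haar_eig_eq by (simp add: emeasure_density cong: nn_integral_cong)
  also have "\<dots> = ennreal (\<integral>x. weyl N x / weyl_norm N \<partial>torus_measure N)"
    using weyl_norm_pos[of N]
    by (intro nn_integral_eq_integral) (auto simp: integrable_weyl weyl_nonneg)
  also have "\<dots> = 1" using weyl_norm_pos[of N] by (simp flip: weyl_norm_def)
  finally show "emeasure (haar_eig N) (space (haar_eig N)) = 1" .
qed

lemma AE_haar_torus: "AE x in haar_eig N. torus N x"
proof -
  have "AE x in torus_measure N. 0 < ennreal (weyl N x / weyl_norm N) \<longrightarrow> torus N x"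
    using AE_torus by eventually_elim auto
  then show ?thesis unfolding haar_eig_eq by (subst AE_density) auto
qed

lemma nice_measurable_haar: "nice N F \<Longrightarrow> F \<in> borel_measurable (haar_eig N)"
  by (simp add: nice_def cong: measurable_cong_sets)

lemma nice_integrable: "nice N F \<Longrightarrow> integrable (haar_eig N) F"
proof -
  assume F: "nice N F"
  then obtain C where C: "\<forall>x. torus N x \<longrightarrow> cmod (F x) \<le> C" by (auto simp: nice_def)
  interpret prob_space "haar_eig N" by (rule prob_space_haar_eig)
  show ?thesis
  proof (rule integrable_const_bound)
    show "AE x in haar_eig N. cmod (F x) \<le> C"
      using AE_haar_torus by eventually_elim (use C in auto)
  qed (rule nice_measurable_haar[OF F])
qed

abbreviation haar_exp :: "nat \<Rightarrow> ((nat \<Rightarrow> complex) \<Rightarrow> complex) \<Rightarrow> complex" where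
  "haar_exp N F \<equiv> integral\<^sup>L (haar_eig N) F"

lemma haar_exp_eq:
  assumes "nice N F"
  shows "haar_exp N F = (1 / weyl_norm N) *\<^sub>R (\<integral>x. complex_of_real (weyl N x) * F x \<partial>torus_measure N)"
proof -
  have "haar_exp N F = (\<integral>x. (weyl N x / weyl_norm N) *\<^sub>R F x \<partial>torus_measure N)"
    unfolding haar_eig_eq using assms weyl_norm_pos[of N]
    by (subst integral_density) (auto simp: nice_def weyl_nonneg)
  also have "\<dots> = (\<integral>x. (1 / weyl_norm N) *\<^sub>R (complex_of_real (weyl N x) * F x) \<partial>torus_measure N)"
    by (intro Bochner_Integration.integral_cong) (auto simp: scaleR_conv_of_real)
  finally show ?thesis by (simp only: Bochner_Integration.integral_scaleR_right)
qed

lemma haar_exp_cong: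
  assumes "nice N F" "nice N G" "\<And>x. torus N x \<Longrightarrow> F x = G x"
  shows "haar_exp N F = haar_exp N G"
proof (rule integral_cong_AE)
  show "AE x in haar_eig N. F x = G x" using AE_haar_torus by eventually_elim (use assms in auto)
qed (use assms nice_measurable_haar in auto)

lemma haar_exp_const [simp]: "haar_exp N (\<lambda>_. c) = c"
  using prob_space.prob_space[OF prob_space_haar_eig[of N]] by simp

lemma haar_exp_add: "nice N F \<Longrightarrow> nice N G \<Longrightarrow> haar_exp N (\<lambda>x. F x + G x) = haar_exp N F + haar_exp N G"
  by (intro Bochner_Integration.integral_add nice_integrable)

lemma haar_exp_diff: "nice N F \<Longrightarrow> nice N G \<Longrightarrow> haar_exp N (\<lambda>x. F x - G x) = haar_exp N F - haar_exp N G"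
  by (intro Bochner_Integration.integral_diff nice_integrable)

lemma haar_exp_sum: "(\<And>i. i \<in> S \<Longrightarrow> nice N (F i)) \<Longrightarrow> haar_exp N (\<lambda>x. \<Sum>i\<in>S. F i x) = (\<Sum>i\<in>S. haar_exp N (F i))"
  by (intro Bochner_Integration.integral_sum nice_integrable)

lemma haar_exp_sum_mset:
  "(\<And>i. i \<in># S \<Longrightarrow> nice N (F i)) \<Longrightarrow> haar_exp N (\<lambda>x. \<Sum>i\<in>#S. F i x) = (\<Sum>i\<in>#S. haar_exp N (F i))"
  by (induction S) (auto simp: haar_exp_add nice_intros)

lemma haar_loop:
  assumes "nice N F" "\<And>n. n < N \<Longrightarrow> dcirc n F (F' n)" "\<And>n. n < N \<Longrightarrow> nice N (F' n)"
  shows "haar_exp N (\<lambda>x. (of_nat k * power_sum N k x + loop_sum N k x) * F x + (\<Sum>n<N. x n ^ k * F' n x)) = 0"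
proof -
  have "nice N (\<lambda>x. (of_nat k * power_sum N k x + loop_sum N k x) * F x + (\<Sum>n<N. x n ^ k * F' n x))"
    using assms by (intro nice_intros) auto
  from haar_exp_eq[OF this] show ?thesis using torus_loop[OF assms, of k] by simp
qed

section \<open>Loop equations for products of power sums\<close>

definition power_prod :: "nat \<Rightarrow> nat multiset \<Rightarrow> (nat \<Rightarrow> complex) \<Rightarrow> complex" where
  "power_prod N X x = (\<Prod>k\<in>#X. power_sum N k x)"

lemma power_prod_empty [simp]: "power_prod N {#} x = 1"
  by (simp add: power_prod_def)

lemma power_prod_add_mset [simp]: "power_prod N (add_mset k X) x = power_sum N k x * power_prod N X x"
  by (simp add: power_prod_def)

lemma nice_power_prod [nice_intros]: "nice N (power_prod N X)"
  unfolding power_prod_def by (intro nice_intros)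

lemma power_prod_remove: "k \<in># X \<Longrightarrow> power_sum N k x * power_prod N (X - {#k#}) x = power_prod N X x"
  by (metis insert_DiffM power_prod_add_mset)

lemma dcirc_power_sum: "n < N \<Longrightarrow> dcirc n (power_sum N k) (\<lambda>x. of_nat k * x n ^ k)"
  unfolding power_sum_def
  by (rule dcirc_cong[OF dcirc_sum[of "{..<N}", OF dcirc_coord_power]]) (auto simp: sum.delta)

definition dpower_prod :: "nat \<Rightarrow> nat \<Rightarrow> nat multiset \<Rightarrow> (nat \<Rightarrow> complex) \<Rightarrow> complex" where
  "dpower_prod N n X x = (\<Sum>l\<in>#X. of_nat l * x n ^ l * power_prod N (X - {#l#}) x)"

lemma dcirc_power_prod:
  assumes "n < N"
  shows "dcirc n (power_prod N X) (dpower_prod N n X)"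
proof (induction X)
  case empty
  show ?case by (simp add: dpower_prod_def power_prod_def dcirc_const)
next
  case (add k X)
  show ?case
  proof (rule dcirc_cong[OF dcirc_mult[OF dcirc_power_sum[OF assms, of k] add]])
    fix x
    have "(\<Sum>l\<in>#X. of_nat l * x n ^ l * power_prod N (add_mset k X - {#l#}) x)
        = (\<Sum>l\<in>#X. power_sum N k x * (of_nat l * x n ^ l * power_prod N (X - {#l#}) x))"
      by (intro arg_cong[of _ _ sum_mset] image_mset_cong) (auto simp: algebra_simps)
    then show "of_nat k * x n ^ k * power_prod N X x + power_sum N k x * dpower_prod N n X x
        = dpower_prod N n (add_mset k X) x"
      by (simp add: dpower_prod_def sum_mset_distrib_left)
  qed simp
qed

lemma nice_dpower_prod [nice_intros]: "n < N \<Longrightarrow> nice N (dpower_prod N n X)"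
  unfolding dpower_prod_def by (intro nice_intros)

lemma sum_sum_mset_swap: "(\<Sum>i\<in>S. \<Sum>l\<in>#X. f i l) = (\<Sum>l\<in>#X. \<Sum>i\<in>S. f i l)"
  by (induction X) (auto simp: sum.distrib)

lemma cnj_sum_mset: "cnj (\<Sum>l\<in>#X. f l) = (\<Sum>l\<in>#X. cnj (f l))"
  by (induction X) auto

lemma sum_power_dpower_prod:
  "(\<Sum>n<N. x n ^ k * dpower_prod N n X x) = (\<Sum>l\<in>#X. of_nat l * power_prod N (add_mset (k + l) (X - {#l#})) x)"
proof -
  have "(\<Sum>n<N. x n ^ k * dpower_prod N n X x)
      = (\<Sum>l\<in>#X. \<Sum>n<N. x n ^ k * (of_nat l * x n ^ l * power_prod N (X - {#l#}) x))"
    unfolding dpower_prod_def sum_mset_distrib_left by (rule sum_sum_mset_swap)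
  also have "\<dots> = (\<Sum>l\<in>#X. of_nat l * power_prod N (add_mset (k + l) (X - {#l#})) x)"
    by (simp add: power_sum_def sum_distrib_left sum_distrib_right power_add mult_ac)
  finally show ?thesis .
qed

text \<open>The pointwise counterpart of \<open>loop_rest\<close>: the factor left over when a power
  \<open>k\<close> meets a differentiated conjugate power \<open>l\<close>.\<close>

definition mixed_sum :: "nat \<Rightarrow> nat \<Rightarrow> nat \<Rightarrow> (nat \<Rightarrow> complex) \<Rightarrow> complex" where
  "mixed_sum N k l x = (if l < k then power_sum N (k - l) x
     else if l = k then of_nat N else cnj (power_sum N (l - k) x))"

lemma mixed_sum_eq:
  assumes "torus N x"
  shows "(\<Sum>n<N. x n ^ k * cnj (x n) ^ l) = mixed_sum N k l x"
proof -
  have c: "x n ^ m * cnj (x n) ^ m = 1" if "n < N" for n m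
  proof -
    have "x n * cnj (x n) = 1" using assms that by (auto simp: torus_def simp flip: complex_norm_square)
    then show ?thesis by (metis power_mult_distrib power_one)
  qed
  consider "l < k" | "l = k" | "k < l" by linarith
  then show ?thesis
  proof cases
    case 1
    then obtain m where m: "k = l + m" using less_imp_add_positive by blast
    have "x n ^ k * cnj (x n) ^ l = x n ^ (k - l)" if "n < N" for n
    proof -
      have "x n ^ k * cnj (x n) ^ l = (x n ^ l * cnj (x n) ^ l) * x n ^ m"
        by (simp only: m power_add mult_ac)
      then show ?thesis using c[OF that, of l] m by simp
    qed
    then show ?thesis using 1 by (simp add: mixed_sum_def power_sum_def)
  next
    case 2
    then show ?thesis using c by (simp add: mixed_sum_def)
  next
    case 3
    then obtain m where m: "l = k + m" using less_imp_add_positive by blast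
    have "x n ^ k * cnj (x n) ^ l = cnj (x n) ^ (l - k)" if "n < N" for n
    proof -
      have "x n ^ k * cnj (x n) ^ l = (x n ^ k * cnj (x n) ^ k) * cnj (x n) ^ m"
        by (simp only: m power_add mult_ac)
      then show ?thesis using c[OF that, of k] m by simp
    qed
    then show ?thesis using 3 by (simp add: mixed_sum_def power_sum_def)
  qed
qed

lemma nice_mixed_sum [nice_intros]: "nice N (mixed_sum N k l)"
  unfolding mixed_sum_def by (intro nice_intros)

definition haar_mom :: "nat \<Rightarrow> nat multiset \<Rightarrow> nat multiset \<Rightarrow> complex" where
  "haar_mom N X Y = haar_exp N (\<lambda>x. power_prod N X x * cnj (power_prod N Y x))"

text \<open>Kept for all \<open>k\<close>, before \<open>loop_sum\<close> is expanded:
  \<open>k = 0\<close> will give the selection rule for degrees, positive \<open>k\<close> the loop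
  equations.\<close>

lemma haar_loop_power_prod:
  "haar_exp N (\<lambda>x. (of_nat k * power_sum N k x + loop_sum N k x) * (power_prod N X x * cnj (power_prod N Y x))
     + ((\<Sum>l\<in>#X. of_nat l * power_prod N (add_mset (k + l) (X - {#l#})) x) * cnj (power_prod N Y x)
      - (\<Sum>l\<in>#Y. of_nat l * (mixed_sum N k l x * (power_prod N X x * cnj (power_prod N (Y - {#l#}) x)))))) = 0"
proof -
  let ?F = "\<lambda>x. power_prod N X x * cnj (power_prod N Y x)"
  let ?F' = "\<lambda>n x. dpower_prod N n X x * cnj (power_prod N Y x) + power_prod N X x * - cnj (dpower_prod N n Y x)"
  have "haar_exp N (\<lambda>x. (of_nat k * power_sum N k x + loop_sum N k x) * ?F x + (\<Sum>n<N. x n ^ k * ?F' n x)) = 0"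
    by (intro haar_loop nice_intros dcirc_mult dcirc_power_prod dcirc_cnj)
  also have "haar_exp N (\<lambda>x. (of_nat k * power_sum N k x + loop_sum N k x) * ?F x + (\<Sum>n<N. x n ^ k * ?F' n x))
    = haar_exp N (\<lambda>x. (of_nat k * power_sum N k x + loop_sum N k x) * ?F x
     + ((\<Sum>l\<in>#X. of_nat l * power_prod N (add_mset (k + l) (X - {#l#})) x) * cnj (power_prod N Y x)
      - (\<Sum>l\<in>#Y. of_nat l * (mixed_sum N k l x * (power_prod N X x * cnj (power_prod N (Y - {#l#}) x))))))"
  proof (rule haar_exp_cong)
    fix x assume x: "torus N x"
    have "(\<Sum>n<N. x n ^ k * ?F' n x) = (\<Sum>n<N. x n ^ k * dpower_prod N n X x) * cnj (power_prod N Y x)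
        - power_prod N X x * (\<Sum>n<N. x n ^ k * cnj (dpower_prod N n Y x))"
      by (simp add: sum_distrib_left sum_distrib_right sum_subtractf algebra_simps)
    also have "(\<Sum>n<N. x n ^ k * cnj (dpower_prod N n Y x))
        = (\<Sum>l\<in>#Y. \<Sum>n<N. x n ^ k * (of_nat l * cnj (x n) ^ l * cnj (power_prod N (Y - {#l#}) x)))"
      unfolding dpower_prod_def cnj_sum_mset sum_mset_distrib_left complex_cnj_mult complex_cnj_power complex_cnj_of_nat
      by (rule sum_sum_mset_swap)
    also have "\<dots> = (\<Sum>l\<in>#Y. of_nat l * (mixed_sum N k l x * cnj (power_prod N (Y - {#l#}) x)))"
      by (simp add: mixed_sum_eq[OF x, symmetric] sum_distrib_left sum_distrib_right mult_ac)
    also have "power_prod N X x * \<dots>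
        = (\<Sum>l\<in>#Y. of_nat l * (mixed_sum N k l x * (power_prod N X x * cnj (power_prod N (Y - {#l#}) x))))"
      by (simp add: sum_mset_distrib_left mult_ac)
    finally show "(of_nat k * power_sum N k x + loop_sum N k x) * ?F x + (\<Sum>n<N. x n ^ k * ?F' n x)
      = (of_nat k * power_sum N k x + loop_sum N k x) * ?F x
       + ((\<Sum>l\<in>#X. of_nat l * power_prod N (add_mset (k + l) (X - {#l#})) x) * cnj (power_prod N Y x)
        - (\<Sum>l\<in>#Y. of_nat l * (mixed_sum N k l x * (power_prod N X x * cnj (power_prod N (Y - {#l#}) x)))))"
      by (simp only: sum_power_dpower_prod)
  qed (auto intro!: nice_intros)
  finally show ?thesis .
qed

text \<open>Taking \<open>k = 0\<close> expresses invariance under the common rotation of all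
  eigenvalues: the density contributes nothing, and by Euler's identity the integrand is multiplied
  by the difference of the two degrees.\<close>

lemma haar_mom_degree:
  assumes "\<Sum>\<^sub># X \<noteq> \<Sum>\<^sub># Y"
  shows "haar_mom N X Y = 0"
proof -
  let ?F = "\<lambda>x. power_prod N X x * cnj (power_prod N Y x)"
  have "0 = haar_exp N (\<lambda>x. (of_nat 0 * power_sum N 0 x + loop_sum N 0 x) * ?F x
     + ((\<Sum>l\<in>#X. of_nat l * power_prod N (add_mset (0 + l) (X - {#l#})) x) * cnj (power_prod N Y x)
      - (\<Sum>l\<in>#Y. of_nat l * (mixed_sum N 0 l x * (power_prod N X x * cnj (power_prod N (Y - {#l#}) x))))))"
    by (rule haar_loop_power_prod[symmetric])
  also have "\<dots> = haar_exp N (\<lambda>x. (of_nat (\<Sum>\<^sub># X) - of_nat (\<Sum>\<^sub># Y)) * ?F x)"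
  proof (rule haar_exp_cong)
    fix x
    have 1: "(\<Sum>l\<in>#X. of_nat l * power_prod N (add_mset (0 + l) (X - {#l#})) x) = of_nat (\<Sum>\<^sub># X) * power_prod N X x"
    proof -
      have "(\<Sum>l\<in>#X. of_nat l * power_prod N (add_mset (0 + l) (X - {#l#})) x) = (\<Sum>l\<in>#X. of_nat l * power_prod N X x)"
        by (intro arg_cong[of _ _ sum_mset] image_mset_cong) (auto simp: power_prod_remove)
      then show ?thesis by (simp flip: sum_mset_distrib_right add: of_nat_sum_mset)
    qed
    have m: "mixed_sum N 0 l x = cnj (power_sum N l x)" for l
      by (simp add: mixed_sum_def)
    have 2: "(\<Sum>l\<in>#Y. of_nat l * (mixed_sum N 0 l x * (power_prod N X x * cnj (power_prod N (Y - {#l#}) x))))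
        = of_nat (\<Sum>\<^sub># Y) * ?F x"
    proof -
      have "(\<Sum>l\<in>#Y. of_nat l * (mixed_sum N 0 l x * (power_prod N X x * cnj (power_prod N (Y - {#l#}) x))))
          = (\<Sum>l\<in>#Y. of_nat l * ?F x)"
      proof (intro arg_cong[of _ _ sum_mset] image_mset_cong)
        fix l assume "l \<in># Y"
        from power_prod_remove[OF this, of N x] show
          "of_nat l * (mixed_sum N 0 l x * (power_prod N X x * cnj (power_prod N (Y - {#l#}) x))) = of_nat l * ?F x"
          unfolding m by (metis (no_types, lifting) complex_cnj_mult mult.left_commute)
      qed
      then show ?thesis by (simp flip: sum_mset_distrib_right add: of_nat_sum_mset)
    qed
    show "(of_nat 0 * power_sum N 0 x + loop_sum N 0 x) * ?F x
     + ((\<Sum>l\<in>#X. of_nat l * power_prod N (add_mset (0 + l) (X - {#l#})) x) * cnj (power_prod N Y x)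
      - (\<Sum>l\<in>#Y. of_nat l * (mixed_sum N 0 l x * (power_prod N X x * cnj (power_prod N (Y - {#l#}) x)))))
      = (of_nat (\<Sum>\<^sub># X) - of_nat (\<Sum>\<^sub># Y)) * ?F x"
      unfolding 1 2 by (simp add: algebra_simps)
  qed (auto intro!: nice_intros)
  also have "\<dots> = (of_nat (\<Sum>\<^sub># X) - of_nat (\<Sum>\<^sub># Y)) * haar_mom N X Y"
    by (simp add: haar_mom_def)
  finally have z: "0 = (of_nat (\<Sum>\<^sub># X) - of_nat (\<Sum>\<^sub># Y)) * haar_mom N X Y" .
  have "of_nat (\<Sum>\<^sub># X) - of_nat (\<Sum>\<^sub># Y) \<noteq> (0 :: complex)"
    using assms by (simp only: right_minus_eq of_nat_eq_iff not_False_eq_True)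
  with z[symmetric] show ?thesis by (simp only: mult_eq_0_iff simp_thms)
qed

lemma haar_mom_loop:
  assumes "0 < k"
  shows "loop_eq N (haar_mom N) k X Y"
proof -
  let ?c = "\<lambda>x. cnj (power_prod N Y x)"
  have "0 = haar_exp N (\<lambda>x. (of_nat k * power_sum N k x + loop_sum N k x) * (power_prod N X x * ?c x)
     + ((\<Sum>l\<in>#X. of_nat l * power_prod N (add_mset (k + l) (X - {#l#})) x) * ?c x
      - (\<Sum>l\<in>#Y. of_nat l * (mixed_sum N k l x * (power_prod N X x * cnj (power_prod N (Y - {#l#}) x))))))"
    by (rule haar_loop_power_prod[symmetric])
  also have "\<dots> = haar_exp N (\<lambda>x. of_nat N * (power_prod N (add_mset k X) x * ?c x)
     + (\<Sum>j=1..<k. power_prod N (add_mset j (add_mset (k - j) X)) x * ?c x)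
     + (\<Sum>l\<in>#X. of_nat l * (power_prod N (add_mset (k + l) (X - {#l#})) x * ?c x))
     - (\<Sum>l\<in>#Y. of_nat l * (mixed_sum N k l x * (power_prod N X x * cnj (power_prod N (Y - {#l#}) x)))))"
  proof (rule haar_exp_cong)
    fix x
    have e1: "(\<Sum>j=1..<k. power_prod N (add_mset j (add_mset (k - j) X)) x * ?c x)
        = (\<Sum>j=1..<k. power_sum N j x * power_sum N (k - j) x) * (power_prod N X x * ?c x)"
      unfolding sum_distrib_right by (simp add: mult_ac)
    have e2: "(\<Sum>l\<in>#X. of_nat l * (power_prod N (add_mset (k + l) (X - {#l#})) x * ?c x))
        = (\<Sum>l\<in>#X. of_nat l * power_prod N (add_mset (k + l) (X - {#l#})) x) * ?c x"
      unfolding sum_mset_distrib_right by (simp only: mult.assoc)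
    have e3: "of_nat k * power_sum N k x + loop_sum N k x
        = of_nat N * power_sum N k x + (\<Sum>j=1..<k. power_sum N j x * power_sum N (k - j) x)"
      using loop_sum_eq[OF assms, of N x] by (simp only: add.commute)
    have lin: "(n * P + s) * (p * c) + (b - d) = n * ((P * p) * c) + s * (p * c) + b - d"
      for n P s p c b d :: complex by (simp add: algebra_simps)
    show "(of_nat k * power_sum N k x + loop_sum N k x) * (power_prod N X x * ?c x)
     + ((\<Sum>l\<in>#X. of_nat l * power_prod N (add_mset (k + l) (X - {#l#})) x) * ?c x
      - (\<Sum>l\<in>#Y. of_nat l * (mixed_sum N k l x * (power_prod N X x * cnj (power_prod N (Y - {#l#}) x)))))
      = of_nat N * (power_prod N (add_mset k X) x * ?c x)
     + (\<Sum>j=1..<k. power_prod N (add_mset j (add_mset (k - j) X)) x * ?c x)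
     + (\<Sum>l\<in>#X. of_nat l * (power_prod N (add_mset (k + l) (X - {#l#})) x * ?c x))
     - (\<Sum>l\<in>#Y. of_nat l * (mixed_sum N k l x * (power_prod N X x * cnj (power_prod N (Y - {#l#}) x))))"
      unfolding e1 e2 unfolding e3 unfolding power_prod_add_mset by (rule lin)
  qed (auto intro!: nice_intros)
  also have "\<dots> = of_nat N * haar_mom N (add_mset k X) Y
     + (\<Sum>j=1..<k. haar_mom N (add_mset j (add_mset (k - j) X)) Y)
     + (\<Sum>l\<in>#X. of_nat l * haar_mom N (add_mset (k + l) (X - {#l#})) Y)
     - (\<Sum>l\<in>#Y. of_nat l * haar_exp N (\<lambda>x. mixed_sum N k l x * (power_prod N X x * cnj (power_prod N (Y - {#l#}) x))))"
    unfolding haar_mom_def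
    apply (subst haar_exp_diff, intro nice_intros, intro nice_intros)
    apply (subst haar_exp_add, intro nice_intros, intro nice_intros)
    apply (subst haar_exp_add, intro nice_intros, intro nice_intros)
    apply (subst haar_exp_sum, intro nice_intros)
    apply (subst haar_exp_sum_mset, intro nice_intros)
    apply (subst haar_exp_sum_mset, intro nice_intros)
    by (simp only: integral_mult_right_zero)
  also have "(\<Sum>l\<in>#Y. of_nat l * haar_exp N (\<lambda>x. mixed_sum N k l x * (power_prod N X x * cnj (power_prod N (Y - {#l#}) x))))
      = (\<Sum>l\<in>#Y. of_nat l * loop_rest N (haar_mom N) k l X (Y - {#l#}))"
  proof (intro arg_cong[of _ _ sum_mset] image_mset_cong)
    fix l
    show "of_nat l * haar_exp N (\<lambda>x. mixed_sum N k l x * (power_prod N X x * cnj (power_prod N (Y - {#l#}) x)))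
        = of_nat l * loop_rest N (haar_mom N) k l X (Y - {#l#})"
      by (simp add: mixed_sum_def loop_rest_def haar_mom_def mult_ac)
  qed
  finally show ?thesis unfolding loop_eq_def by (subst eq_iff_diff_eq_0) (rule sym)
qed

text \<open>The exact Gaussian moments of Diaconis and Shahshahani. Bounding the degree of
  \<open>Y\<close> alone is enough, as both sides vanish when the degrees differ; this later allows
  arbitrarily high frequencies in the student.\<close>

lemma haar_mom_eq_gmom:
  assumes "0 \<notin># X" "0 \<notin># Y" "\<Sum>\<^sub># Y \<le> N"
  shows "haar_mom N X Y = gmom X Y"
proof (rule loop_eq_unique[OF _ _ _ assms])
  show "haar_mom N {#} {#} = 1"
    unfolding haar_mom_def power_prod_empty complex_cnj_one mult_1_right by (rule haar_exp_const)
qed (auto intro: haar_mom_degree haar_mom_loop)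

section \<open>Wick formula for linear forms\<close>

text \<open>\<open>ip\<close> conjugates its second argument, so the teacher's field is a form in
  conjugated power sums. A truncation of the conjugated student field is a
  \<open>lin_form\<close>.\<close>

definition conj_form :: "nat \<Rightarrow> nat \<Rightarrow> (nat \<Rightarrow> complex) \<Rightarrow> (nat \<Rightarrow> complex) \<Rightarrow> complex" where
  "conj_form N \<kappa> b x = (\<Sum>l=1..\<kappa>. b l * cnj (power_sum N l x))"

definition lin_form :: "nat \<Rightarrow> nat \<Rightarrow> (nat \<Rightarrow> complex) \<Rightarrow> (nat \<Rightarrow> complex) \<Rightarrow> complex" where
  "lin_form N K d x = (\<Sum>l=1..K. d l * power_sum N l x)"

lemma nice_conj_form [nice_intros]: "nice N (conj_form N \<kappa> b)"
  unfolding conj_form_def by (intro nice_intros)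

lemma nice_lin_form [nice_intros]: "nice N (lin_form N K d)"
  unfolding lin_form_def by (intro nice_intros)

definition conj_mom :: "nat \<Rightarrow> nat \<Rightarrow> (nat \<Rightarrow> complex) \<Rightarrow> nat \<Rightarrow> nat multiset \<Rightarrow> nat multiset \<Rightarrow> complex" where
  "conj_mom N \<kappa> b j X Y = haar_exp N (\<lambda>x. power_prod N X x * cnj (power_prod N Y x) * conj_form N \<kappa> b x ^ j)"

lemma conj_mom_0: "conj_mom N \<kappa> b 0 X Y = haar_mom N X Y"
  by (simp add: conj_mom_def haar_mom_def)

lemma conj_mom_Suc: "conj_mom N \<kappa> b (Suc j) X Y = (\<Sum>l=1..\<kappa>. b l * conj_mom N \<kappa> b j X (add_mset l Y))"
proof -
  let ?f = "\<lambda>l x. b l * (power_prod N X x * cnj (power_prod N (add_mset l Y) x) * conj_form N \<kappa> b x ^ j)"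
  have "power_prod N X x * cnj (power_prod N Y x) * conj_form N \<kappa> b x ^ Suc j = (\<Sum>l=1..\<kappa>. ?f l x)" for x
  proof -
    have "power_prod N X x * cnj (power_prod N Y x) * conj_form N \<kappa> b x ^ Suc j
        = conj_form N \<kappa> b x * (power_prod N X x * cnj (power_prod N Y x) * conj_form N \<kappa> b x ^ j)"
      by (simp only: power_Suc mult_ac)
    also have "\<dots> = (\<Sum>l=1..\<kappa>. ?f l x)"
      unfolding conj_form_def[of N \<kappa> b] sum_distrib_right[of _ "{1..\<kappa>}" "_ * _"]
      by (intro sum.cong) (simp_all add: mult_ac)
    finally show ?thesis .
  qed
  then have "conj_mom N \<kappa> b (Suc j) X Y = haar_exp N (\<lambda>x. \<Sum>l=1..\<kappa>. ?f l x)"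
    by (simp only: conj_mom_def)
  also have "\<dots> = (\<Sum>l=1..\<kappa>. haar_exp N (?f l))"
    by (intro haar_exp_sum nice_intros)
  finally show ?thesis by (simp only: conj_mom_def integral_mult_right_zero)
qed

text \<open>The new factor of index \<open>k\<close> contracts either with an explicit entry of
  \<open>Y\<close> or with one of the \<open>j\<close> copies of the form, whose covariance with it
  is \<open>k * b k\<close>. The induction on \<open>j\<close> expands one copy at a time; this
  moves at most \<open>\<kappa>\<close> from \<open>j * \<kappa>\<close> to the degree of
  \<open>Y\<close>, so the budget \<open>N\<close> is preserved.\<close>

lemma conj_mom_add_mset:
  assumes b: "\<And>l. l \<notin> {1..\<kappa>} \<Longrightarrow> b l = 0"
    and "0 \<notin># X" "0 < k" "0 \<notin># Y" "\<Sum>\<^sub># Y + j * \<kappa> \<le> N"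
  shows "conj_mom N \<kappa> b j (add_mset k X) Y = of_nat k * of_nat (count Y k) * conj_mom N \<kappa> b j X (Y - {#k#})
     + of_nat j * (of_nat k * b k) * conj_mom N \<kappa> b (j - 1) X Y"
  using assms(4,5)
proof (induction j arbitrary: Y)
  case 0
  have "\<Sum>\<^sub># (Y - {#k#}) \<le> \<Sum>\<^sub># Y" 
    by (cases "k \<in># Y") (auto dest!: multi_member_split simp: diff_single_trivial)
  then have "\<Sum>\<^sub># (Y - {#k#}) \<le> N" using 0 by simp
  moreover have "0 \<notin># Y - {#k#}" using 0 by (meson in_diffD)
  ultimately show ?case using 0 assms(2,3)
    by (simp add: conj_mom_0 haar_mom_eq_gmom gmom_add_mset_left)
next
  case (Suc j)
  let ?M = "conj_mom N \<kappa> b"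
  have "?M (Suc j) (add_mset k X) Y = (\<Sum>l=1..\<kappa>. b l * ?M j (add_mset k X) (add_mset l Y))"
    by (rule conj_mom_Suc)
  also have "\<dots> = (\<Sum>l=1..\<kappa>. of_nat k * of_nat (count Y k) * (b l * ?M j X (add_mset l (Y - {#k#})))
       + (if l = k then of_nat k * b l * ?M j X Y else 0)
       + of_nat j * (of_nat k * b k) * (b l * ?M (j - 1) X (add_mset l Y)))"
  proof (rule sum.cong)
    fix l assume l: "l \<in> {1..\<kappa>}"
    have IH: "?M j (add_mset k X) (add_mset l Y)
        = of_nat k * of_nat (count (add_mset l Y) k) * ?M j X (add_mset l Y - {#k#})
          + of_nat j * (of_nat k * b k) * ?M (j - 1) X (add_mset l Y)"
      using l Suc.prems by (intro Suc.IH) auto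
    have "of_nat k * of_nat (count (add_mset l Y) k) * ?M j X (add_mset l Y - {#k#})
        = of_nat k * of_nat (count Y k) * ?M j X (add_mset l (Y - {#k#}))
          + (if l = k then of_nat k * ?M j X Y else 0)"
    proof (cases "l = k")
      case True
      then show ?thesis by (cases "k \<in># Y") (simp_all add: algebra_simps not_in_iff)
    next
      case False
      then show ?thesis by (cases "k \<in># Y") (simp_all add: not_in_iff)
    qed
    then show "b l * ?M j (add_mset k X) (add_mset l Y)
      = of_nat k * of_nat (count Y k) * (b l * ?M j X (add_mset l (Y - {#k#})))
       + (if l = k then of_nat k * b l * ?M j X Y else 0)
       + of_nat j * (of_nat k * b k) * (b l * ?M (j - 1) X (add_mset l Y))"
      unfolding IH by (simp add: algebra_simps)
  qed simp
  also have "\<dots> = of_nat k * of_nat (count Y k) * ?M (Suc j) X (Y - {#k#})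
      + (\<Sum>l=1..\<kappa>. if l = k then of_nat k * b l * ?M j X Y else 0)
      + of_nat j * (of_nat k * b k) * (\<Sum>l=1..\<kappa>. b l * ?M (j - 1) X (add_mset l Y))"
    unfolding conj_mom_Suc sum.distrib sum_distrib_left ..
  \<comment> \<open>If \<open>k\<close> exceeds \<open>\<kappa>\<close> the sum is empty of matches,
    and the right-hand side is 0 as well because \<open>b k = 0\<close>.\<close>
  also have "(\<Sum>l=1..\<kappa>. if l = k then of_nat k * b l * ?M j X Y else 0) = of_nat k * b k * ?M j X Y"
    using b[of k] by (auto simp: sum.delta')
  also have "of_nat j * (of_nat k * b k) * (\<Sum>l=1..\<kappa>. b l * ?M (j - 1) X (add_mset l Y))
      = of_nat j * (of_nat k * b k) * ?M j X Y"
    by (cases j) (simp_all add: conj_mom_Suc)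
  finally show ?case by (simp add: algebra_simps)
qed

text \<open>Without unconjugated factors every monomial of the expansion has unequal
  degrees.\<close>

lemma conj_mom_empty:
  assumes "0 \<notin># Y" "j \<noteq> 0 \<or> Y \<noteq> {#}"
  shows "conj_mom N \<kappa> b j {#} Y = 0"
  using assms
proof (induction j arbitrary: Y)
  case 0
  then obtain l Z where "Y = add_mset l Z" by (cases Y) auto
  then have "\<Sum>\<^sub># {#} \<noteq> \<Sum>\<^sub># Y" using 0 by auto
  then show ?case unfolding conj_mom_0 by (rule haar_mom_degree)
next
  case (Suc j)
  then show ?case unfolding conj_mom_Suc by (intro sum.neutral) auto
qed

section \<open>Moments with powers of both linear forms\<close>

definition mixed_mom :: "nat \<Rightarrow> nat \<Rightarrow> (nat \<Rightarrow> complex) \<Rightarrow> nat \<Rightarrow> (nat \<Rightarrow> complex) \<Rightarrow> nat \<Rightarrow> nat \<Rightarrow> nat multiset \<Rightarrow> complex" where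
  "mixed_mom N \<kappa> b K d i j X = haar_exp N (\<lambda>x. power_prod N X x * lin_form N K d x ^ i * conj_form N \<kappa> b x ^ j)"

lemma mixed_mom_0: "mixed_mom N \<kappa> b K d 0 j X = conj_mom N \<kappa> b j X {#}"
  by (simp add: mixed_mom_def conj_mom_def)

lemma mixed_mom_Suc:
  "mixed_mom N \<kappa> b K d (Suc i) j X = (\<Sum>l=1..K. d l * mixed_mom N \<kappa> b K d i j (add_mset l X))"
proof -
  let ?f = "\<lambda>l x. d l * (power_prod N (add_mset l X) x * lin_form N K d x ^ i * conj_form N \<kappa> b x ^ j)"
  have "power_prod N X x * lin_form N K d x ^ Suc i * conj_form N \<kappa> b x ^ j = (\<Sum>l=1..K. ?f l x)" for x
  proof -
    have "power_prod N X x * lin_form N K d x ^ Suc i * conj_form N \<kappa> b x ^ j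
        = lin_form N K d x * (power_prod N X x * lin_form N K d x ^ i * conj_form N \<kappa> b x ^ j)"
      by (simp only: power_Suc mult_ac)
    also have "\<dots> = (\<Sum>l=1..K. ?f l x)"
      unfolding lin_form_def[of N K d] sum_distrib_right[of _ "{1..K}" "_ * _"]
      by (intro sum.cong) (simp_all add: mult_ac)
    finally show ?thesis .
  qed
  then have "mixed_mom N \<kappa> b K d (Suc i) j X = haar_exp N (\<lambda>x. \<Sum>l=1..K. ?f l x)"
    by (simp only: mixed_mom_def)
  also have "\<dots> = (\<Sum>l=1..K. haar_exp N (?f l))"
    by (intro haar_exp_sum nice_intros)
  finally show ?thesis by (simp only: mixed_mom_def integral_mult_right_zero)
qed

text \<open>Two unconjugated power sums never contract with each other, so the factor of index
  \<open>k\<close> passes through the powers of \<open>lin_form\<close> and meets only the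
  \<open>j\<close> conjugate forms.\<close>

lemma mixed_mom_add_mset:
  assumes b: "\<And>l. l \<notin> {1..\<kappa>} \<Longrightarrow> b l = 0" and "0 \<notin># X" "0 < k" "j * \<kappa> \<le> N"
  shows "mixed_mom N \<kappa> b K d i j (add_mset k X) = of_nat j * (of_nat k * b k) * mixed_mom N \<kappa> b K d i (j - 1) X"
  using assms(2)
proof (induction i arbitrary: X)
  case 0
  then show ?case unfolding mixed_mom_0 using assms
    by (subst conj_mom_add_mset) auto
next
  case (Suc i)
  have "mixed_mom N \<kappa> b K d (Suc i) j (add_mset k X)
      = (\<Sum>l=1..K. d l * mixed_mom N \<kappa> b K d i j (add_mset k (add_mset l X)))"
    by (simp only: mixed_mom_Suc add_mset_commute[of k])
  also have "\<dots> = (\<Sum>l=1..K. d l * (of_nat j * (of_nat k * b k) * mixed_mom N \<kappa> b K d i (j - 1) (add_mset l X)))"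
    using Suc by (intro sum.cong refl arg_cong2[of _ _ _ _ "(*)"] Suc.IH) auto
  finally show ?case by (simp add: mixed_mom_Suc sum_distrib_left mult_ac)
qed

text \<open>The linear factors are removed one at a time, each contracting with one of the remaining
  conjugate forms at covariance \<open>?c\<close>; the numbers of choices multiply to a factorial.
  If \<open>j\<close> and \<open>s\<close> differ, unpaired factors remain and the moment is 0. The
  budget concerns the conjugate side only, so \<open>K\<close> may later tend to infinity.\<close>

lemma haar_wick:
  assumes b: "\<And>l. l \<notin> {1..\<kappa>} \<Longrightarrow> b l = 0" and "j * \<kappa> \<le> N"
  shows "haar_exp N (\<lambda>x. conj_form N \<kappa> b x ^ j * lin_form N K d x ^ s)
    = (if j = s then fact s * (\<Sum>l=1..K. d l * of_nat l * b l) ^ s else 0)"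
proof -
  let ?c = "\<Sum>l=1..K. d l * of_nat l * b l"
  have "mixed_mom N \<kappa> b K d s j {#} = (if j = s then fact s * ?c ^ s else 0)"
    using assms(2)
  proof (induction s arbitrary: j)
    case 0
    show ?case
    proof (cases "j = 0")
      case True
      then show ?thesis unfolding mixed_mom_0 conj_mom_def
        by (simp add: prob_space.prob_space[OF prob_space_haar_eig])
    next
      case False
      then show ?thesis unfolding mixed_mom_0 by (simp add: conj_mom_empty)
    qed
  next
    case (Suc s)
    have "mixed_mom N \<kappa> b K d (Suc s) j {#}
        = (\<Sum>l=1..K. d l * (of_nat j * (of_nat l * b l) * mixed_mom N \<kappa> b K d s (j - 1) {#}))"
      unfolding mixed_mom_Suc using Suc.prems b
      by (intro sum.cong refl arg_cong2[of _ _ _ _ "(*)"] mixed_mom_add_mset) auto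
    also have "\<dots> = of_nat j * ?c * mixed_mom N \<kappa> b K d s (j - 1) {#}"
      by (simp add: sum_distrib_left sum_distrib_right mult_ac)
    \<comment> \<open>For \<open>j = 0\<close> truncated subtraction can make
      \<open>j - 1 = s\<close> true; the prefactor \<open>of_nat j\<close> then removes the spurious
      value.\<close>
    also have "mixed_mom N \<kappa> b K d s (j - 1) {#} = (if j - 1 = s then fact s * ?c ^ s else 0)"
      using Suc.prems by (intro Suc.IH) (auto simp: diff_mult_distrib)
    finally show ?case by (cases j) (auto simp: algebra_simps)
  qed
  then show ?thesis by (simp add: mixed_mom_def mult.commute)
qed

section \<open>Dyadic blocks\<close>

lemma AE_summable_integrable_suminf:
  fixes f :: "nat \<Rightarrow> 'a \<Rightarrow> real"
  assumes f: "\<And>i. integrable M (f i)" and nonneg: "\<And>i x. 0 \<le> f i x"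
    and sum: "summable (\<lambda>i. \<integral>x. f i x \<partial>M)"
  shows "AE x in M. summable (\<lambda>i. f i x)" "integrable M (\<lambda>x. \<Sum>i. f i x)"
proof -
  have [measurable]: "\<And>i. f i \<in> borel_measurable M" using f by auto
  have "(\<integral>\<^sup>+x. (\<Sum>i. ennreal (f i x)) \<partial>M) = (\<Sum>i. \<integral>\<^sup>+x. ennreal (f i x) \<partial>M)"
    by (rule nn_integral_suminf) measurable
  also have "\<dots> = (\<Sum>i. ennreal (\<integral>x. f i x \<partial>M))"
    using f nonneg by (intro suminf_cong nn_integral_eq_integral) auto
  also have "\<dots> = ennreal (\<Sum>i. \<integral>x. f i x \<partial>M)"
    using sum nonneg by (intro suminf_ennreal2) auto
  finally have "(\<integral>\<^sup>+x. (\<Sum>i. ennreal (f i x)) \<partial>M) \<noteq> \<infinity>" by simp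
  then have "AE x in M. (\<Sum>i. ennreal (f i x)) \<noteq> \<infinity>"
    by (intro nn_integral_PInf_AE) auto
  then show s: "AE x in M. summable (\<lambda>i. f i x)"
    by eventually_elim (use nonneg in \<open>auto intro: summable_suminf_not_top\<close>)
  show "integrable M (\<lambda>x. \<Sum>i. f i x)"
    using s sum nonneg f by (intro integrable_suminf) auto
qed

text \<open>Index 0 lies in no block, hence the assumption \<open>t 0 = 0\<close> in the lemmas on
  partial sums.\<close>

definition dyad :: "(nat \<Rightarrow> 'a) \<Rightarrow> nat \<Rightarrow> 'a::real_normed_vector" where
  "dyad t j = (\<Sum>k=2^j..<2^Suc j. t k)"

lemma sum_lessThan_power2:
  assumes "t 0 = 0"
  shows "(\<Sum>k<2^J. t k) = (\<Sum>j<J. dyad t j)"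
proof (induction J)
  case 0
  show ?case using assms by simp
next
  case (Suc J)
  have "(\<Sum>k<2^Suc J. t k) = (\<Sum>k<2^J. t k) + (\<Sum>k=2^J..<2^Suc J. t k)"
    unfolding lessThan_atLeast0 by (rule sum.atLeastLessThan_concat[symmetric]) auto
  then show ?case using Suc by (simp add: dyad_def)
qed

lemma norm_sum_le_dyad:
  assumes "n \<le> 2^Suc J"
  shows "norm (\<Sum>k=2^J..<n. t k) \<le> dyad (\<lambda>k. norm (t k)) J"
proof -
  have "norm (\<Sum>k=2^J..<n. t k) \<le> (\<Sum>k=2^J..<n. norm (t k))" by (rule norm_sum)
  also have "\<dots> \<le> dyad (\<lambda>k. norm (t k)) J"
    unfolding dyad_def using assms by (intro sum_mono2) auto
  finally show ?thesis .
qed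

lemma dyadic_partial_sum:
  assumes "t 0 = 0" "0 < n"
  shows "\<exists>J. 2^J \<le> n \<and> n < 2^Suc J
    \<and> norm ((\<Sum>k<n. t k) - (\<Sum>j<J. dyad t j)) \<le> dyad (\<lambda>k. norm (t k)) J"
proof -
  obtain J where J: "2^J \<le> n" "n < 2^(J + 1)" using ex_power_ivl1[of 2 n] assms by auto
  have "(\<Sum>k<n. t k) = (\<Sum>k<2^J. t k) + (\<Sum>k=2^J..<n. t k)"
    unfolding lessThan_atLeast0 using J by (intro sum.atLeastLessThan_concat[symmetric]) auto
  then have "(\<Sum>k<n. t k) - (\<Sum>j<J. dyad t j) = (\<Sum>k=2^J..<n. t k)"
    by (simp add: sum_lessThan_power2[of t, OF assms(1)])
  then show ?thesis using J norm_sum_le_dyad[of n J t] by auto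
qed

text \<open>Convergence of the block sums settles the partial sums at powers of two; in between, the
  error is at most the absolute mass of a single block. Absolute summability of \<open>t\<close>
  itself, which the student's series need not have, is thereby avoided.\<close>

lemma summable_dyadic:
  fixes t :: "nat \<Rightarrow> 'a::banach"
  assumes t0: "t 0 = 0" and B: "summable (dyad t)" and G: "dyad (\<lambda>k. norm (t k)) \<longlonglongrightarrow> 0"
  shows "summable t"
proof -
  have "(\<lambda>n. \<Sum>k<n. t k) \<longlonglongrightarrow> suminf (dyad t)"
  proof (rule LIMSEQ_I)
    fix e :: real assume e: "0 < e"
    have "(\<lambda>J. \<Sum>j<J. dyad t j) \<longlonglongrightarrow> suminf (dyad t)" using B by (rule summable_LIMSEQ)
    from LIMSEQ_D[OF this, of "e/2"] e obtain J1 where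
      J1: "\<And>J. J \<ge> J1 \<Longrightarrow> norm ((\<Sum>j<J. dyad t j) - suminf (dyad t)) < e/2" by auto
    from LIMSEQ_D[OF G, of "e/2"] e obtain J2 where
      J2: "\<And>J. J \<ge> J2 \<Longrightarrow> norm (dyad (\<lambda>k. norm (t k)) J) < e/2" by auto
    show "\<exists>n0. \<forall>n\<ge>n0. norm ((\<Sum>k<n. t k) - suminf (dyad t)) < e"
    proof (intro exI allI impI)
      fix n :: nat assume n: "2^(max J1 J2) \<le> n"
      then have "0 < n" by (metis gr0I not_less_iff_gr_or_eq power_not_zero le_zero_eq zero_neq_numeral)
      from dyadic_partial_sum[of t n, OF t0 this] obtain J where J: "n < 2^Suc J"
        "norm ((\<Sum>k<n. t k) - (\<Sum>j<J. dyad t j)) \<le> dyad (\<lambda>k. norm (t k)) J" by blast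
      have "(2::nat)^(max J1 J2) < 2^Suc J" using n J(1) by (rule le_less_trans)
      then have "max J1 J2 < Suc J" by (rule power_less_imp_less_exp[rotated]) simp
      then have JJ: "J1 \<le> J" "J2 \<le> J" by auto
      have "norm ((\<Sum>k<n. t k) - suminf (dyad t))
          \<le> norm ((\<Sum>k<n. t k) - (\<Sum>j<J. dyad t j)) + norm ((\<Sum>j<J. dyad t j) - suminf (dyad t))"
        using norm_triangle_ineq[of "(\<Sum>k<n. t k) - (\<Sum>j<J. dyad t j)" "(\<Sum>j<J. dyad t j) - suminf (dyad t)"]
        by simp
      also have "\<dots> < e/2 + e/2"
        using J(2) J1[OF JJ(1)] J2[OF JJ(2)] by (intro add_strict_mono) auto
      finally show "norm ((\<Sum>k<n. t k) - suminf (dyad t)) < e" by simp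
    qed
  qed
  then show ?thesis unfolding summable_iff_convergent convergent_def by blast
qed

text \<open>A bound uniform in \<open>n\<close>, as required of a dominating function: complete
  blocks first, then \<open>C\<close> for the incomplete last one.\<close>

lemma norm_partial_sum_dyadic_le:
  fixes t :: "nat \<Rightarrow> 'a::banach"
  assumes t0: "t 0 = 0" and B: "summable (\<lambda>j. norm (dyad t j))" and G: "\<And>j. dyad (\<lambda>k. norm (t k)) j \<le> C"
  shows "norm (\<Sum>k<n. t k) \<le> (\<Sum>j. norm (dyad t j)) + C"
proof (cases "n = 0")
  case True
  have "0 \<le> dyad (\<lambda>k. norm (t k)) 0" unfolding dyad_def by (intro sum_nonneg) auto
  with G[of 0] have "0 \<le> C" by simp
  then show ?thesis using True B by (simp add: suminf_nonneg)
next
  case False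
  then obtain J where J: "norm ((\<Sum>k<n. t k) - (\<Sum>j<J. dyad t j)) \<le> dyad (\<lambda>k. norm (t k)) J"
    using dyadic_partial_sum[of t n, OF t0] by auto
  have "norm (\<Sum>k<n. t k) \<le> norm (\<Sum>j<J. dyad t j) + norm ((\<Sum>k<n. t k) - (\<Sum>j<J. dyad t j))"
    using norm_triangle_sub by blast
  also have "norm (\<Sum>j<J. dyad t j) \<le> (\<Sum>j<J. norm (dyad t j))" by (rule norm_sum)
  also have "\<dots> \<le> (\<Sum>j. norm (dyad t j))" using B by (intro sum_le_suminf) auto
  finally show ?thesis using J G[of J] by linarith
qed

lemma dyad_tendsto_0:
  assumes "summable f"
  shows "dyad f \<longlonglongrightarrow> 0"
proof -
  have S: "(\<lambda>n. \<Sum>k<n. f k) \<longlonglongrightarrow> suminf f" using assms by (rule summable_LIMSEQ)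
  have m: "strict_mono (\<lambda>j. 2^j :: nat)" by (auto intro: strict_monoI)
  have "(\<lambda>j. \<Sum>k<2^j. f k) \<longlonglongrightarrow> suminf f"
    using LIMSEQ_subseq_LIMSEQ[OF S m] by (simp add: o_def)
  from tendsto_diff[OF LIMSEQ_Suc[OF this] this]
  have "(\<lambda>j. (\<Sum>k<2^Suc j. f k) - (\<Sum>k<2^j. f k)) \<longlonglongrightarrow> 0" by simp
  moreover have "(\<Sum>k<2^Suc j. f k) - (\<Sum>k<2^j. f k) = dyad f j" for j
  proof -
    have "(\<Sum>k<2^Suc j. f k) = (\<Sum>k<2^j. f k) + dyad f j"
      unfolding lessThan_atLeast0 dyad_def by (rule sum.atLeastLessThan_concat[symmetric]) auto
    then show ?thesis by simp
  qed
  ultimately show ?thesis by simp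
qed

text \<open>Cauchy-Schwarz within a block: it has \<open>2 ^ j\<close> indices, each with
  \<open>1 / k\<close> at most \<open>1 / 2 ^ j\<close>, so these weights sum to at most 1.\<close>

lemma dyad_div_sqrt_le:
  assumes "\<And>k. 0 \<le> f k"
  shows "dyad (\<lambda>k. f k / sqrt (real k)) j \<le> sqrt (dyad (\<lambda>k. (f k)\<^sup>2) j)"
proof (rule real_le_rsqrt)
  let ?A = "{2^j..<2^Suc j} :: nat set"
  have "(\<Sum>k\<in>?A. f k * (1 / sqrt (real k)))\<^sup>2 \<le> (\<Sum>k\<in>?A. (f k)\<^sup>2) * (\<Sum>k\<in>?A. (1 / sqrt (real k))\<^sup>2)"
    by (rule Cauchy_Schwarz_ineq_sum)
  also have "(\<Sum>k\<in>?A. (1 / sqrt (real k))\<^sup>2) \<le> (\<Sum>k\<in>?A. 1 / 2^j)"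
  proof (rule sum_mono)
    fix k assume "k \<in> ?A"
    then have "2^j \<le> k" by simp
    then have "(2::real)^j \<le> real k" by (metis of_nat_le_iff of_nat_numeral of_nat_power)
    then show "(1 / sqrt (real k))\<^sup>2 \<le> 1 / 2^j"
      by (simp add: power_divide frac_le)
  qed
  also have "(\<Sum>k\<in>?A. 1 / 2^j) = (1::real)" by simp
  finally show "(dyad (\<lambda>k. f k / sqrt (real k)) j)\<^sup>2 \<le> dyad (\<lambda>k. (f k)\<^sup>2) j"
    unfolding dyad_def by (simp add: sum_nonneg mult_left_mono)
qed

section \<open>Convergence of the student field\<close>

lemma haar_exp_norm_le:
  assumes "nice N F" "\<And>x. torus N x \<Longrightarrow> cmod (F x) \<le> C"
  shows "cmod (haar_exp N F) \<le> C"
proof -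
  have "cmod (haar_exp N F) \<le> (\<integral>x. cmod (F x) \<partial>haar_eig N)" by (rule integral_norm_bound)
  also have "\<dots> \<le> (\<integral>x. C \<partial>haar_eig N)"
  proof (rule integral_mono_AE)
    show "AE x in haar_eig N. cmod (F x) \<le> C"
      using AE_haar_torus by eventually_elim (use assms in auto)
    show "integrable (haar_eig N) (\<lambda>x. C)"
      using prob_space_haar_eig[of N] by (simp add: prob_space_def finite_measure.integrable_const)
  qed (use nice_integrable[OF assms(1)] in auto)
  also have "\<dots> = C" by (simp add: prob_space.prob_space[OF prob_space_haar_eig])
  finally show ?thesis .
qed

lemma norm_power_sum_le: "torus N x \<Longrightarrow> cmod (power_sum N k x) \<le> real N"
  unfolding power_sum_def torus_def
  by (rule order_trans[OF norm_sum]) (simp add: norm_power)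

lemma psum_eq: "psum N k x = power_sum N k x / complex_of_real (sqrt (real k))"
  by (simp add: psum_def power_sum_def)

lemma nice_psum [nice_intros]: "nice N (psum N k)"
  unfolding psum_def by (intro nice_intros) auto

lemma norm_psum_le: "torus N x \<Longrightarrow> cmod (psum N k x) \<le> real N / sqrt (real k)"
  using norm_power_sum_le[of N x k] by (simp add: psum_eq norm_divide divide_right_mono)

text \<open>Orthogonality comes from unequal degrees alone and so extends to frequencies beyond
  \<open>N\<close>.\<close>

lemma haar_exp_psum_mult_cnj:
  "k \<noteq> l \<Longrightarrow> haar_exp N (\<lambda>x. psum N k x * cnj (psum N l x)) = 0"
proof -
  assume "k \<noteq> l"
  then have "haar_mom N {#k#} {#l#} = 0" by (intro haar_mom_degree) auto
  then have "haar_exp N (\<lambda>x. power_sum N k x * cnj (power_sum N l x)) = 0" by (simp add: haar_mom_def)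
  moreover have "(\<lambda>x. psum N k x * cnj (psum N l x)) = (\<lambda>x. power_sum N k x * cnj (power_sum N l x)
      * (1 / (complex_of_real (sqrt (real k)) * complex_of_real (sqrt (real l)))))"
    by (simp add: psum_eq fun_eq_iff)
  ultimately show ?thesis by (simp only: integral_mult_left_zero mult_zero_left)
qed

lemma sqnorm_nonneg: "sq_summable u \<Longrightarrow> 0 \<le> sqnorm u"
  unfolding sqnorm_def sq_summable_def by (intro suminf_nonneg) auto

context
  fixes N :: nat and u :: "nat \<Rightarrow> complex"
  assumes u0: "u 0 = 0" and u2: "sq_summable u"
begin

private definition "trm x k = u k * cnj (psum N k x)"

private lemma trm_0: "trm x 0 = 0"
  by (simp add: trm_def u0)

private lemma nice_dyad_trm: "nice N (\<lambda>x. dyad (trm x) j)"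
  unfolding dyad_def trm_def by (intro nice_intros)

private lemma dyad_sq_le: "dyad (\<lambda>k. (cmod (u k))\<^sup>2) j \<le> sqnorm u"
  unfolding dyad_def sqnorm_def using u2 unfolding sq_summable_def by (intro sum_le_suminf) auto

private lemma norm_trm_le: "torus N x \<Longrightarrow> cmod (trm x k) \<le> real N * (cmod (u k) / sqrt (real k))"
proof -
  assume x: "torus N x"
  have "cmod (trm x k) = cmod (u k) * cmod (psum N k x)" by (simp add: trm_def norm_mult)
  also have "\<dots> \<le> cmod (u k) * (real N / sqrt (real k))"
    by (intro mult_left_mono norm_psum_le x) auto
  finally show ?thesis by (simp add: mult.commute)
qed

private lemma dyad_norm_trm_le:
  "torus N x \<Longrightarrow> dyad (\<lambda>k. cmod (trm x k)) j \<le> real N * sqrt (dyad (\<lambda>k. (cmod (u k))\<^sup>2) j)"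
proof -
  assume x: "torus N x"
  have "dyad (\<lambda>k. cmod (trm x k)) j \<le> real N * dyad (\<lambda>k. cmod (u k) / sqrt (real k)) j"
    unfolding dyad_def sum_distrib_left by (intro sum_mono norm_trm_le x)
  also have "\<dots> \<le> real N * sqrt (dyad (\<lambda>k. (cmod (u k))\<^sup>2) j)"
    by (intro mult_left_mono dyad_div_sqrt_le) auto
  finally show ?thesis .
qed

private lemma dyad_norm_trm_le':
  "torus N x \<Longrightarrow> dyad (\<lambda>k. cmod (trm x k)) j \<le> real N * sqrt (sqnorm u)"
  using dyad_norm_trm_le[of x j] dyad_sq_le[of j]
  by (meson mult_left_mono of_nat_0_le_iff order_trans real_sqrt_le_mono)

private lemma norm_dyad_trm_le: "torus N x \<Longrightarrow> cmod (dyad (trm x) j) \<le> real N * sqrt (sqnorm u)"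
  using dyad_norm_trm_le'[of x j] norm_sum[of "trm x" "{2^j..<2^Suc j}"] by (simp add: dyad_def)

text \<open>Orthogonality leaves the diagonal, where the crude bound \<open>N\<^sup>2 / k\<close>
  for the second moment of \<open>psum N k\<close> suffices: only the decay in \<open>j\<close>
  matters.\<close>

private lemma dyad_trm_L2:
  "(\<integral>x. (cmod (dyad (trm x) j))\<^sup>2 \<partial>haar_eig N) \<le> (real N)\<^sup>2 * sqnorm u / 2^j"
proof -
  let ?A = "{2^j..<2^Suc j} :: nat set"
  let ?p = "\<lambda>k l x. psum N l x * cnj (psum N k x)"
  have sq: "complex_of_real ((cmod (dyad (trm x) j))\<^sup>2) = (\<Sum>k\<in>?A. \<Sum>l\<in>?A. (u k * cnj (u l)) * ?p k l x)" for x
    unfolding complex_norm_square dyad_def cnj_sum sum_product trm_def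
    by (intro sum.cong refl) (simp add: mult_ac)
  have "complex_of_real (\<integral>x. (cmod (dyad (trm x) j))\<^sup>2 \<partial>haar_eig N)
      = haar_exp N (\<lambda>x. \<Sum>k\<in>?A. \<Sum>l\<in>?A. (u k * cnj (u l)) * ?p k l x)"
    unfolding integral_complex_of_real[symmetric] sq ..
  also have "\<dots> = (\<Sum>k\<in>?A. haar_exp N (\<lambda>x. \<Sum>l\<in>?A. (u k * cnj (u l)) * ?p k l x))"
    by (intro haar_exp_sum nice_intros)
  also have "\<dots> = (\<Sum>k\<in>?A. \<Sum>l\<in>?A. haar_exp N (\<lambda>x. (u k * cnj (u l)) * ?p k l x))"
    by (intro sum.cong refl haar_exp_sum nice_intros)
  also have "\<dots> = (\<Sum>k\<in>?A. (u k * cnj (u k)) * haar_exp N (?p k k))"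
  proof (intro sum.cong refl)
    fix k assume k: "k \<in> ?A"
    have "(\<Sum>l\<in>?A. haar_exp N (\<lambda>x. (u k * cnj (u l)) * ?p k l x))
        = (\<Sum>l\<in>?A. if l = k then (u k * cnj (u k)) * haar_exp N (?p k k) else 0)"
      by (intro sum.cong refl) (auto simp: haar_exp_psum_mult_cnj)
    then show "(\<Sum>l\<in>?A. haar_exp N (\<lambda>x. (u k * cnj (u l)) * ?p k l x)) = (u k * cnj (u k)) * haar_exp N (?p k k)"
      using k by simp
  qed
  finally have "(\<integral>x. (cmod (dyad (trm x) j))\<^sup>2 \<partial>haar_eig N)
      = Re (\<Sum>k\<in>?A. (u k * cnj (u k)) * haar_exp N (?p k k))"
    by (metis Re_complex_of_real)
  also have "\<dots> \<le> cmod (\<Sum>k\<in>?A. (u k * cnj (u k)) * haar_exp N (?p k k))" by (rule complex_Re_le_cmod)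
  also have "\<dots> \<le> (\<Sum>k\<in>?A. (cmod (u k))\<^sup>2 * ((real N)\<^sup>2 / 2^j))"
  proof (rule sum_norm_le)
    fix k assume k: "k \<in> ?A"
    then have "2^j \<le> k" by simp
    then have k': "(2::real)^j \<le> real k" by (metis of_nat_le_iff of_nat_numeral of_nat_power)
    have "cmod (haar_exp N (?p k k)) \<le> (real N)\<^sup>2 / 2^j"
    proof (rule haar_exp_norm_le)
      fix x assume x: "torus N x"
      have "cmod (?p k k x) = (cmod (psum N k x))\<^sup>2" by (simp add: norm_mult power2_eq_square)
      also have "\<dots> \<le> (real N / sqrt (real k))\<^sup>2" by (intro power_mono norm_psum_le x) auto
      also have "\<dots> = (real N)\<^sup>2 / real k" by (simp add: power_divide)
      also have "\<dots> \<le> (real N)\<^sup>2 / 2^j" 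
        using k' less_le_trans[OF _ k', of 0] by (intro divide_left_mono mult_pos_pos) auto
      finally show "cmod (?p k k x) \<le> (real N)\<^sup>2 / 2^j" .
    qed (intro nice_intros)
    then show "cmod ((u k * cnj (u k)) * haar_exp N (?p k k)) \<le> (cmod (u k))\<^sup>2 * ((real N)\<^sup>2 / 2^j)"
      unfolding norm_mult complex_mod_cnj power2_eq_square[of "cmod (u k)"] by (intro mult_left_mono) auto
  qed
  also have "\<dots> = dyad (\<lambda>k. (cmod (u k))\<^sup>2) j * ((real N)\<^sup>2 / 2^j)"
    unfolding dyad_def sum_distrib_right ..
  also have "\<dots> \<le> sqnorm u * ((real N)\<^sup>2 / 2^j)" by (intro mult_right_mono dyad_sq_le) auto
  finally show ?thesis by (simp add: mult_ac)
qed

text \<open>On each dyadic block the sup norm stays bounded while the squared \<open>L\<^sup>2\<close> norm decays like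
  \<open>2\<^sup>-\<^sup>j\<close>, so \<open>\<Sum>j. sqrt 2 ^ j * |B\<^sub>j| ^ q\<close> is integrable and forces geometric decay of \<open>|B\<^sub>j|\<close>
  almost everywhere.\<close>
private lemma dyad_trm_weighted:
  assumes "2 \<le> q"
  defines "f \<equiv> \<lambda>j x. sqrt 2 ^ j * cmod (dyad (trm x) j) ^ q"
  shows "AE x in haar_eig N. summable (\<lambda>j. f j x)" "integrable (haar_eig N) (\<lambda>x. \<Sum>j. f j x)"
proof -
  let ?C = "real N * sqrt (sqnorm u)"
  have B: "integrable (haar_eig N) (\<lambda>x. cmod (dyad (trm x) j) ^ m)" for j m
    using integrable_norm[OF nice_integrable[OF nice_power[OF nice_dyad_trm[of j], of m]]]
    by (simp add: norm_power)
  have f: "integrable (haar_eig N) (f j)" for j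
    unfolding f_def by (intro integrable_mult_right B)
  have f0: "0 \<le> f j x" for j x by (simp add: f_def)
  have le: "(\<integral>x. f j x \<partial>haar_eig N) \<le> ?C ^ (q - 2) * ((real N)\<^sup>2 * sqnorm u) * (1 / sqrt 2) ^ j" for j
  proof -
    have "(\<integral>x. f j x \<partial>haar_eig N) = sqrt 2 ^ j * (\<integral>x. cmod (dyad (trm x) j) ^ q \<partial>haar_eig N)"
      by (simp add: f_def)
    \<comment> \<open>Interpolation: \<open>q - 2\<close> factors are absorbed by the sup bound
      \<open>?C\<close>, the other two are left for the second moment.\<close>
    also have "(\<integral>x. cmod (dyad (trm x) j) ^ q \<partial>haar_eig N)
        \<le> (\<integral>x. ?C ^ (q - 2) * (cmod (dyad (trm x) j))\<^sup>2 \<partial>haar_eig N)"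
    proof (rule integral_mono_AE)
      show "AE x in haar_eig N. cmod (dyad (trm x) j) ^ q \<le> ?C ^ (q - 2) * (cmod (dyad (trm x) j))\<^sup>2"
        using AE_haar_torus
      proof eventually_elim
        case (elim x)
        have "cmod (dyad (trm x) j) ^ q = cmod (dyad (trm x) j) ^ (q - 2) * (cmod (dyad (trm x) j))\<^sup>2"
          by (simp only: power_add[symmetric] le_add_diff_inverse2[OF assms(1)])
        also have "\<dots> \<le> ?C ^ (q - 2) * (cmod (dyad (trm x) j))\<^sup>2"
          using norm_dyad_trm_le[OF elim] by (intro mult_right_mono power_mono) auto
        finally show ?case .
      qed
    qed (intro integrable_mult_right B)+
    also have "\<dots> = ?C ^ (q - 2) * (\<integral>x. (cmod (dyad (trm x) j))\<^sup>2 \<partial>haar_eig N)" by simp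
    also have "\<dots> \<le> ?C ^ (q - 2) * ((real N)\<^sup>2 * sqnorm u / 2^j)"
      using sqnorm_nonneg[OF u2] by (intro mult_left_mono dyad_trm_L2) auto
    finally have "(\<integral>x. f j x \<partial>haar_eig N) \<le> sqrt 2 ^ j * (?C ^ (q - 2) * ((real N)\<^sup>2 * sqnorm u / 2^j))"
      by (simp add: mult_left_mono)
    \<comment> \<open>The weight \<open>sqrt 2 ^ j\<close> spends only part of the decay
      \<open>1 / 2 ^ j\<close> and leaves a convergent geometric series.\<close>
    also have "\<dots> = ?C ^ (q - 2) * ((real N)\<^sup>2 * sqnorm u) * (sqrt 2 ^ j / 2 ^ j)" by simp
    also have "sqrt 2 ^ j / 2 ^ j = (sqrt 2 / 2) ^ j" by (simp only: power_divide)
    also have "sqrt 2 / 2 = 1 / sqrt 2" by (simp add: field_simps)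
    finally show ?thesis .
  qed
  have s: "summable (\<lambda>j. \<integral>x. f j x \<partial>haar_eig N)"
  proof (rule summable_comparison_test')
    show "summable (\<lambda>j. ?C ^ (q - 2) * ((real N)\<^sup>2 * sqnorm u) * (1 / sqrt 2) ^ j)"
      by (intro summable_mult summable_geometric) auto
    show "norm (\<integral>x. f j x \<partial>haar_eig N) \<le> ?C ^ (q - 2) * ((real N)\<^sup>2 * sqnorm u) * (1 / sqrt 2) ^ j" if "0 \<le> j" for j
      using le[of j] f0 by simp
  qed
  show "AE x in haar_eig N. summable (\<lambda>j. f j x)" "integrable (haar_eig N) (\<lambda>x. \<Sum>j. f j x)"
    by (rule AE_summable_integrable_suminf[OF f f0 s])+
qed

text \<open>The expectation contains the \<open>s\<close>-th power of the field, so a single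
  integrable function must dominate the \<open>s\<close>-th powers of all partial sums.\<close>

private lemma trm_dominated:
  "\<exists>D. integrable (haar_eig N) D \<and>
     (AE x in haar_eig N. summable (trm x) \<and> (\<forall>n. cmod (\<Sum>k<n. trm x k) ^ s \<le> D x))"
proof -
  \<comment> \<open>The exponent has to be at least 2 for the interpolation and at least
    \<open>s\<close> for the final domination.\<close>
  define q where "q = s + 2"
  define f where "f j x = sqrt 2 ^ j * cmod (dyad (trm x) j) ^ q" for j x
  define W where "W x = (\<Sum>j. f j x)" for x
  \<comment> \<open>Each term of \<open>W\<close> is at most \<open>W\<close>, so
    \<open>|B_j| ^ q\<close> is at most \<open>W * (1 / sqrt 2) ^ j\<close>; taking
    \<open>q\<close>-th roots gives geometric decay with ratio \<open>\<rho>\<close>.\<close>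
  define \<rho> where "\<rho> = root q (1 / sqrt 2)"
  define C where "C = real N * sqrt (sqnorm u)"
  have q: "2 \<le> q" "s \<le> q" "0 < q" by (auto simp: q_def)
  have \<rho>: "0 \<le> \<rho>" "\<rho> < 1" "\<rho> ^ q = 1 / sqrt 2"
    using q real_root_less_iff[of q "1 / sqrt 2" 1] by (auto simp: \<rho>_def)
  have C: "0 \<le> C" using sqnorm_nonneg[OF u2] by (simp add: C_def)
  define D where "D x = (1 / (1 - \<rho>) + C) ^ s * (1 + W x)" for x
  have fAE: "AE x in haar_eig N. summable (\<lambda>j. f j x)" and fW: "integrable (haar_eig N) W"
    using dyad_trm_weighted[OF q(1)] unfolding f_def W_def by auto
  have "integrable (haar_eig N) D"
    unfolding D_def using fW prob_space_haar_eig[of N]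
    by (intro integrable_mult_right Bochner_Integration.integrable_add)
      (auto simp: prob_space_def finite_measure.integrable_const)
  moreover have "AE x in haar_eig N. summable (trm x) \<and> (\<forall>n. cmod (\<Sum>k<n. trm x k) ^ s \<le> D x)"
    using AE_haar_torus fAE
  proof eventually_elim
    case (elim x)
    define R where "R = root q (W x)"
    have f0: "0 \<le> f j x" for j by (simp add: f_def)
    have fle: "f j x \<le> W x" for j
      unfolding W_def using sum_le_suminf[OF elim(2), of "{j}"] f0 by auto
    have W0: "0 \<le> W x" using fle[of 0] f0[of 0] by simp
    have R: "0 \<le> R" "R ^ q = W x" using W0 q by (auto simp: R_def)
    have Ble: "cmod (dyad (trm x) j) \<le> R * \<rho> ^ j" for j
    proof -
      have "cmod (dyad (trm x) j) ^ q = f j x * (1 / sqrt 2) ^ j"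
        by (simp add: f_def power_divide)
      also have "\<dots> \<le> W x * (1 / sqrt 2) ^ j" by (intro mult_right_mono fle) auto
      also have "\<dots> = (R * \<rho> ^ j) ^ q"
        unfolding power_mult_distrib R(2) \<rho>(3)[symmetric] by (simp only: power_mult[symmetric] mult.commute)
      finally show ?thesis
        using R \<rho> q by (subst (asm) power_mono_iff) auto
    qed
    have geo: "summable (\<lambda>j. R * \<rho> ^ j)" using \<rho> by (intro summable_mult summable_geometric) auto
    have Bs: "summable (\<lambda>j. cmod (dyad (trm x) j))"
      by (rule summable_comparison_test'[OF geo, of 0]) (use Ble in auto)
    have G: "dyad (\<lambda>k. cmod (trm x k)) j \<le> C" for j
      unfolding C_def by (rule dyad_norm_trm_le'[OF elim(1)])
    have "dyad (\<lambda>k. cmod (trm x k)) \<longlonglongrightarrow> 0"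
    proof (rule tendsto_sandwich[of "\<lambda>_. 0" _ _ "\<lambda>j. real N * sqrt (dyad (\<lambda>k. (cmod (u k))\<^sup>2) j)"])
      have "(\<lambda>j. real N * sqrt (dyad (\<lambda>k. (cmod (u k))\<^sup>2) j)) \<longlonglongrightarrow> real N * sqrt 0"
        using u2 by (intro tendsto_intros dyad_tendsto_0) (simp add: sq_summable_def)
      then show "(\<lambda>j. real N * sqrt (dyad (\<lambda>k. (cmod (u k))\<^sup>2) j)) \<longlonglongrightarrow> 0" by simp
      show "\<forall>\<^sub>F j in sequentially. dyad (\<lambda>k. cmod (trm x k)) j \<le> real N * sqrt (dyad (\<lambda>k. (cmod (u k))\<^sup>2) j)"
        by (intro always_eventually allI dyad_norm_trm_le elim)
      show "\<forall>\<^sub>F j in sequentially. 0 \<le> dyad (\<lambda>k. cmod (trm x k)) j"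
        unfolding dyad_def by (intro always_eventually allI sum_nonneg norm_ge_zero)
    qed simp
    then have "summable (trm x)"
      by (rule summable_dyadic[of "trm x", OF trm_0 summable_norm_cancel[OF Bs]])
    moreover have "cmod (\<Sum>k<n. trm x k) ^ s \<le> D x" for n
    proof -
      \<comment> \<open>Enlarging \<open>R\<close> to at least 1 makes its powers increase with the
        exponent, so \<open>m ^ s\<close> is at most \<open>m ^ q\<close> and hence at most
        \<open>1 + W x\<close>; it also lets \<open>C\<close> be absorbed into
        \<open>C * m\<close>.\<close>
      define m where "m = max 1 R"
      have m: "1 \<le> m" "R \<le> m" by (auto simp: m_def)
      have "cmod (\<Sum>k<n. trm x k) \<le> (\<Sum>j. cmod (dyad (trm x) j)) + C"
        by (rule norm_partial_sum_dyadic_le[of "trm x", OF trm_0 Bs G])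
      also have "(\<Sum>j. cmod (dyad (trm x) j)) \<le> (\<Sum>j. R * \<rho> ^ j)"
        by (rule suminf_le[OF Ble Bs geo])
      also have "\<dots> = R * (1 / (1 - \<rho>))"
        using \<rho> by (subst suminf_mult) (auto simp: suminf_geometric)
      also have "R * (1 / (1 - \<rho>)) \<le> m * (1 / (1 - \<rho>))"
        using m \<rho> by (intro mult_right_mono) auto
      also have "m * (1 / (1 - \<rho>)) + C \<le> (1 / (1 - \<rho>) + C) * m"
        using m C mult_left_mono[of 1 m C] by (simp add: algebra_simps)
      finally have "cmod (\<Sum>k<n. trm x k) ^ s \<le> ((1 / (1 - \<rho>) + C) * m) ^ s"
        by (intro power_mono) auto
      also have "\<dots> = (1 / (1 - \<rho>) + C) ^ s * m ^ s" by (rule power_mult_distrib)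
      also have "\<dots> \<le> (1 / (1 - \<rho>) + C) ^ s * (1 + W x)"
      proof (rule mult_left_mono)
        have "m ^ s \<le> m ^ q" using m q by (intro power_increasing) auto
        also have "m ^ q \<le> 1 + W x"
          using R(2) W0 by (cases "1 \<le> R") (auto simp: m_def max_def)
        finally show "m ^ s \<le> 1 + W x" .
        show "0 \<le> (1 / (1 - \<rho>) + C) ^ s" using \<rho> C by simp
      qed
      finally show ?thesis by (simp add: D_def)
    qed
    ultimately show ?case by blast
  qed
  ultimately show ?thesis by blast
qed

text \<open>Dominated convergence transfers Wick's formula from truncated student fields, which are
  polynomials, to the full series. \<open>F\<close> will be a power of the teacher's field.\<close>

lemma haar_exp_ip_limit:
  assumes F: "nice N F"
  shows "integrable (haar_eig N) (\<lambda>x. F x * cnj (ip u (pvec N x)) ^ s)"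
    and "(\<lambda>n. haar_exp N (\<lambda>x. F x * cnj (\<Sum>k<n. u k * cnj (psum N k x)) ^ s))
       \<longlonglongrightarrow> haar_exp N (\<lambda>x. F x * cnj (ip u (pvec N x)) ^ s)"
proof -
  from trm_dominated[of s] obtain D where D: "integrable (haar_eig N) D"
    and DA: "AE x in haar_eig N. summable (trm x) \<and> (\<forall>n. cmod (\<Sum>k<n. trm x k) ^ s \<le> D x)"
    by blast
  from F obtain C where C: "\<And>x. torus N x \<Longrightarrow> cmod (F x) \<le> C" by (auto simp: nice_def)
  let ?S = "\<lambda>n x. F x * cnj (\<Sum>k<n. trm x k) ^ s"
  let ?f = "\<lambda>x. F x * cnj (ip u (pvec N x)) ^ s"
  have ipt: "ip u (pvec N x) = (\<Sum>k. trm x k)" for x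
    by (simp add: ip_def pvec_def trm_def)
  have mt: "(\<lambda>x. trm x k) \<in> borel_measurable (haar_eig N)" for k
    by (rule nice_measurable_haar) (unfold trm_def, intro nice_intros)
  have mc: "cnj \<in> borel_measurable borel" by (intro borel_measurable_continuous_onI continuous_intros)
  have mS: "?S n \<in> borel_measurable (haar_eig N)" for n
    by (rule nice_measurable_haar) (unfold trm_def, intro nice_intros F)
  have "(\<lambda>x. cnj (\<Sum>k. trm x k)) \<in> borel_measurable (haar_eig N)"
    by (rule measurable_compose[OF borel_measurable_suminf[OF mt] mc])
  then have mf: "?f \<in> borel_measurable (haar_eig N)"
    unfolding ipt using nice_measurable_haar[OF F] by measurable
  have lim: "AE x in haar_eig N. (\<lambda>n. ?S n x) \<longlonglongrightarrow> ?f x"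
    using DA
  proof eventually_elim
    case (elim x)
    then have "(\<lambda>n. \<Sum>k<n. trm x k) \<longlonglongrightarrow> (\<Sum>k. trm x k)" by (intro summable_LIMSEQ) auto
    then show ?case unfolding ipt by (intro tendsto_intros)
  qed
  have bound: "AE x in haar_eig N. norm (?S n x) \<le> C * D x" for n
    using DA AE_haar_torus
  proof eventually_elim
    case (elim x)
    have "norm (?S n x) = cmod (F x) * cmod (\<Sum>k<n. trm x k) ^ s"
      by (simp only: norm_mult norm_power complex_mod_cnj)
    also have "\<dots> \<le> C * D x"
      using elim C[OF elim(2)] norm_ge_zero[of "F x"]
      by (intro mult_mono) (auto intro: order_trans[OF norm_ge_zero])
    finally show ?case .
  qed
  have CD: "integrable (haar_eig N) (\<lambda>x. C * D x)" using D by simp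
  show "integrable (haar_eig N) ?f"
    by (rule integrable_dominated_convergence[OF mf mS CD lim bound])
  show "(\<lambda>n. haar_exp N (\<lambda>x. F x * cnj (\<Sum>k<n. u k * cnj (psum N k x)) ^ s)) \<longlonglongrightarrow> haar_exp N ?f"
    using integral_dominated_convergence[OF mf mS CD lim bound] by (simp add: trm_def)
qed

end

section \<open>The population loss\<close>

lemma ip_eq_sum:
  assumes "\<forall>k. k \<notin> {1..\<kappa>} \<longrightarrow> h k = 0"
  shows "ip h v = (\<Sum>l=1..\<kappa>. h l * cnj (v l))"
  unfolding ip_def using assms by (intro suminf_finite) auto

text \<open>Since \<open>h\<close> is supported up to \<open>\<kappa>\<close>, the covariance with a
  truncated student field no longer changes once the truncation reaches \<open>\<kappa>\<close>. The
  approximating sequence is eventually constant, which determines its limit.\<close>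

lemma haar_exp_ip_power:
  assumes h: "\<forall>k. k \<notin> {1..\<kappa>} \<longrightarrow> h k = 0" and j: "j * \<kappa> \<le> N"
    and u: "u 0 = 0" "sq_summable u"
  shows "haar_exp N (\<lambda>x. ip h (pvec N x) ^ j * cnj (ip u (pvec N x)) ^ s)
    = (if j = s then fact s * ip h u ^ s else 0)"
proof -
  \<comment> \<open>Both coefficient sequences carry the \<open>1 / sqrt l\<close> of
    \<open>p_l\<close>; together they cancel the variance \<open>l\<close>.\<close>
  define b where "b l = h l / complex_of_real (sqrt (real l))" for l
  define d where "d l = cnj (u l) / complex_of_real (sqrt (real l))" for l
  have H: "ip h (pvec N x) = conj_form N \<kappa> b x" for x
    unfolding ip_eq_sum[OF h] conj_form_def pvec_def b_def psum_eq by simp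
  have L: "cnj (\<Sum>k<Suc n. u k * cnj (psum N k x)) = lin_form N n d x" for n x
  proof -
    have "(\<Sum>k<Suc n. u k * cnj (psum N k x)) = (\<Sum>k=1..n. u k * cnj (psum N k x))"
      by (rule sum.mono_neutral_right) (use u in \<open>auto simp: Suc_le_eq less_Suc_eq_le intro!: gr0I\<close>)
    then show ?thesis by (simp add: lin_form_def d_def psum_eq)
  qed
  have F: "nice N (\<lambda>x. ip h (pvec N x) ^ j)" unfolding H by (intro nice_intros)
  have "(\<lambda>n. haar_exp N (\<lambda>x. conj_form N \<kappa> b x ^ j * lin_form N n d x ^ s))
      \<longlonglongrightarrow> haar_exp N (\<lambda>x. ip h (pvec N x) ^ j * cnj (ip u (pvec N x)) ^ s)"
    using LIMSEQ_Suc[OF haar_exp_ip_limit(2)[OF u F, of s]] unfolding L H[symmetric] .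
  moreover have "(\<lambda>n. haar_exp N (\<lambda>x. conj_form N \<kappa> b x ^ j * lin_form N n d x ^ s))
      \<longlonglongrightarrow> (if j = s then fact s * ip h u ^ s else 0)"
  proof (rule tendsto_eventually)
    show "\<forall>\<^sub>F n in sequentially. haar_exp N (\<lambda>x. conj_form N \<kappa> b x ^ j * lin_form N n d x ^ s)
        = (if j = s then fact s * ip h u ^ s else 0)"
      using eventually_ge_at_top[of \<kappa>]
    proof eventually_elim
      case (elim n)
      have "(\<Sum>l=1..n. d l * of_nat l * b l) = (\<Sum>l=1..n. h l * cnj (u l))"
      proof (rule sum.cong)
        fix l assume "l \<in> {1..n}"
        then have "of_nat l = complex_of_real (sqrt (real l)) * complex_of_real (sqrt (real l))"
          and "complex_of_real (sqrt (real l)) \<noteq> 0"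
          by (simp_all flip: of_real_mult)
        then show "d l * of_nat l * b l = h l * cnj (u l)" by (simp add: d_def b_def)
      qed simp
      also have "\<dots> = (\<Sum>l=1..\<kappa>. h l * cnj (u l))"
        using elim h by (intro sum.mono_neutral_right) auto
      also have "\<dots> = ip h u" by (simp only: ip_eq_sum[OF h])
      finally show ?case
        using haar_wick[of \<kappa> b j N n d s] h j by (simp add: b_def)
    qed
  qed
  ultimately show ?thesis by (rule LIMSEQ_unique)
qed

lemma Kcut_square_le: "Kcut N * Kcut N \<le> N"
proof -
  have "real (Kcut N) \<le> sqrt (real N)" by (simp add: Kcut_def)
  then have "real (Kcut N) * real (Kcut N) \<le> sqrt (real N) * sqrt (real N)" by (intro mult_mono) auto
  then have "real (Kcut N * Kcut N) \<le> real N" by simp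
  then show ?thesis by (simp only: of_nat_le_iff)
qed

lemma info_exp_props:
  assumes "\<exists>j. 1 \<le> j \<and> j \<le> Kcut N \<and> \<alpha> j \<noteq> 0"
  shows "1 \<le> info_exp N \<alpha>" "info_exp N \<alpha> \<le> Kcut N" "\<alpha> (info_exp N \<alpha>) \<noteq> 0"
  using LeastI_ex[OF assms] unfolding info_exp_def by auto

text \<open>The monomial link of the student selects the teacher's term of order \<open>s\<close>.
  The two factors \<open>1 / sqrt (fact s)\<close> cancel the number of pairings, and the student's
  phase turns \<open>\<alpha> s\<close> into its modulus.\<close>

lemma EV_teacher_student:
  assumes s: "\<exists>j. 1 \<le> j \<and> j \<le> Kcut N \<and> \<alpha> j \<noteq> 0"
    and h: "\<forall>k. k \<notin> {1..Kcut N} \<longrightarrow> h k = 0" and u: "u 0 = 0" "sq_summable u"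
  shows "EV N (\<lambda>x. - Re (teacher N \<alpha> (ip h (pvec N x)) * cnj (student N \<alpha> (ip u (pvec N x)))))
    = - (cmod (\<alpha> (info_exp N \<alpha>)) * Re (ip h u ^ info_exp N \<alpha>))"
proof -
  define s where "s = info_exp N \<alpha>"
  let ?\<kappa> = "Kcut N"
  define a where "a j = \<alpha> j / complex_of_real (sqrt (fact j)) * cnj (\<alpha> s / complex_of_real (cmod (\<alpha> s) * sqrt (fact s)))" for j
  let ?T = "\<lambda>j x. ip h (pvec N x) ^ j * cnj (ip u (pvec N x)) ^ s"
  note sp = info_exp_props[OF s, folded s_def]
  have jN: "j * ?\<kappa> \<le> N" if "j \<le> ?\<kappa>" for j
    using Kcut_square_le[of N] mult_le_mono1[OF that, of ?\<kappa>] by linarith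
  have nice: "nice N (\<lambda>x. ip h (pvec N x) ^ j)" for j
    unfolding ip_eq_sum[OF h] pvec_def by (intro nice_intros)
  have int: "integrable (haar_eig N) (?T j)" for j
    by (rule haar_exp_ip_limit(1)[OF u nice])
  have eq: "teacher N \<alpha> (ip h (pvec N x)) * cnj (student N \<alpha> (ip u (pvec N x))) = (\<Sum>j=1..?\<kappa>. a j * ?T j x)" for x
    unfolding teacher_def student_def Let_def s_def[symmetric] sum_distrib_right a_def
    by (intro sum.cong refl) (simp only: complex_cnj_mult complex_cnj_power mult_ac)
  have "EV N (\<lambda>x. - Re (teacher N \<alpha> (ip h (pvec N x)) * cnj (student N \<alpha> (ip u (pvec N x)))))
      = - Re (haar_exp N (\<lambda>x. \<Sum>j=1..?\<kappa>. a j * ?T j x))"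
    unfolding EV_def eq using int by (subst integral_minus, subst integral_Re) auto
  also have "haar_exp N (\<lambda>x. \<Sum>j=1..?\<kappa>. a j * ?T j x) = (\<Sum>j=1..?\<kappa>. a j * haar_exp N (?T j))"
    using int by (subst Bochner_Integration.integral_sum) auto
  also have "\<dots> = (\<Sum>j=1..?\<kappa>. if j = s then a s * (fact s * ip h u ^ s) else 0)"
    by (intro sum.cong refl) (use haar_exp_ip_power[OF h jN u] in auto)
  also have "\<dots> = a s * (fact s * ip h u ^ s)" using sp by simp
  also have "\<dots> = complex_of_real (cmod (\<alpha> s)) * ip h u ^ s"
  proof -
    have f: "complex_of_real (sqrt (fact s)) * complex_of_real (sqrt (fact s)) = fact s"
      by (simp flip: of_real_mult)
    have f0: "complex_of_real (sqrt (fact s)) \<noteq> 0" by simp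
    have "\<alpha> s * cnj (\<alpha> s) = complex_of_real (cmod (\<alpha> s)) * complex_of_real (cmod (\<alpha> s))"
      unfolding complex_norm_square[symmetric] by (simp add: power2_eq_square)
    then have "a s * fact s = complex_of_real (cmod (\<alpha> s))"
      unfolding f[symmetric] using f0 sp(3) by (simp add: a_def field_simps)
    then show ?thesis by (simp only: mult.assoc[symmetric])
  qed
  finally show ?thesis unfolding s_def by simp
qed

section \<open>Polar coordinates\<close>

lemma Re_power_eq: "Re (z ^ s) = cmod z ^ s * cos (real s * Arg z)"
proof -
  have "z ^ s = rcis (cmod z ^ s) (real s * Arg z)"
    by (metis DeMoivre2 rcis_cmod_Arg)
  then show ?thesis by simp
qed

text \<open>\<open>p\<close> plays the role of \<open>1 - \<delta>\<close>. \<open>Arg\<close> jumps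
  across the negative real axis, but as \<open>s\<close> is an integer,
  \<open>cos (s * Arg m)\<close> equals \<open>Re (m ^ s) / |m| ^ s\<close>, which is differentiable
  away from 0.\<close>

lemma polar_flow:
  fixes m :: "real \<Rightarrow> complex" and Q :: "real \<Rightarrow> real"
  assumes s: "1 \<le> s"
    and m': "(m has_vector_derivative cnj (m t) ^ (s - 1) * of_real p - of_real (Q t ^ (s - 1)) * m t) (at t)"
    and Q': "(Q has_real_derivative 2 * Re (m t ^ s) - 2 * Q t ^ s) (at t)"
  defines "r \<equiv> cmod (m t)" and "\<theta> \<equiv> Arg (m t)"
  shows "((\<lambda>\<tau>. Q \<tau> - (cmod (m \<tau>))\<^sup>2) has_real_derivative
          2 * (1 - p) * r ^ s * cos (real s * \<theta>) - 2 * Q t ^ (s - 1) * (Q t - r\<^sup>2)) (at t)"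
    and "m t \<noteq> 0 \<Longrightarrow> ((\<lambda>\<tau>. cmod (m \<tau>)) has_real_derivative
          p * r ^ (s - 1) * cos (real s * \<theta>) - Q t ^ (s - 1) * r) (at t)"
    and "m t \<noteq> 0 \<Longrightarrow> ((\<lambda>\<tau>. cos (real s * Arg (m \<tau>))) has_real_derivative
          p * real s * r powr (real s - 2) * (1 - (cos (real s * \<theta>))\<^sup>2)) (at t)"
proof -
  obtain n where n: "s = Suc n" using s by (cases s) auto
  have s1: "s - 1 = n" "s - Suc 0 = n" and rs: "r ^ s = r ^ n * r" and Qs: "Q t ^ s = Q t ^ n * Q t" by (simp_all add: n)
  define c where "c = cos (real s * \<theta>)"
  define d where "d = cnj (m t) ^ (s - 1) * of_real p - of_real (Q t ^ (s - 1)) * m t"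
  have X: "Re (m t ^ s) = r ^ s * c" unfolding c_def r_def \<theta>_def by (rule Re_power_eq)
  have mm: "Re (m t * cnj (m t)) = r\<^sup>2" unfolding r_def complex_norm_square[symmetric] by simp
  have ip: "m t \<bullet> d = p * r ^ s * c - Q t ^ (s - 1) * r\<^sup>2"
  proof -
    have "m t \<bullet> d = Re (cnj (m t) * d)" by (simp add: inner_complex_def)
    also have "cnj (m t) * d = of_real p * cnj (m t ^ s) - of_real (Q t ^ (s - 1)) * (m t * cnj (m t))"
      by (simp add: d_def n algebra_simps)
    also have "Re \<dots> = p * Re (m t ^ s) - Q t ^ (s - 1) * Re (m t * cnj (m t))"
      by (simp only: minus_complex.sel times_complex.sel cnj.sel Re_complex_of_real Im_complex_of_real)
    finally show ?thesis unfolding X mm by simp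
  qed
  have md: "(m has_vector_derivative d) (at t)" using m' unfolding d_def .
  have n2: "((\<lambda>\<tau>. (cmod (m \<tau>))\<^sup>2) has_real_derivative 2 * (p * r ^ s * c - Q t ^ (s - 1) * r\<^sup>2)) (at t)"
  proof -
    have "((\<lambda>\<tau>. m \<tau> \<bullet> m \<tau>) has_derivative (\<lambda>h. m t \<bullet> (h *\<^sub>R d) + (h *\<^sub>R d) \<bullet> m t)) (at t)"
      using md unfolding has_vector_derivative_def by (intro has_derivative_inner)
    then have "((\<lambda>\<tau>. m \<tau> \<bullet> m \<tau>) has_derivative (\<lambda>h. (2 * (m t \<bullet> d)) * h)) (at t)"
      by (simp add: inner_commute mult_ac)
    then show ?thesis unfolding ip has_field_derivative_def dot_square_norm .
  qed
  show "((\<lambda>\<tau>. Q \<tau> - (cmod (m \<tau>))\<^sup>2) has_real_derivative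
          2 * (1 - p) * r ^ s * cos (real s * \<theta>) - 2 * Q t ^ (s - 1) * (Q t - r\<^sup>2)) (at t)"
    by (rule DERIV_cong[OF DERIV_diff[OF Q' n2]])
      (unfold X c_def[symmetric] Qs s1, simp add: algebra_simps)
  assume m0: "m t \<noteq> 0"
  then have r: "0 < r" by (simp add: r_def)
  show rd: "((\<lambda>\<tau>. cmod (m \<tau>)) has_real_derivative
          p * r ^ (s - 1) * cos (real s * \<theta>) - Q t ^ (s - 1) * r) (at t)"
  proof -
    have "((\<lambda>\<tau>. sqrt ((cmod (m \<tau>))\<^sup>2)) has_real_derivative
        (inverse (sqrt ((cmod (m t))\<^sup>2)) / 2) * (2 * (p * r ^ s * c - Q t ^ (s - 1) * r\<^sup>2))) (at t)"
      by (rule DERIV_chain2[OF DERIV_real_sqrt n2]) (use m0 in simp)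
    then have "((\<lambda>\<tau>. cmod (m \<tau>)) has_real_derivative
        (inverse r / 2) * (2 * (p * r ^ s * c - Q t ^ (s - 1) * r\<^sup>2))) (at t)"
      unfolding real_sqrt_abs abs_norm_cancel r_def .
    then show ?thesis
      by (rule DERIV_cong)
        (use r in \<open>unfold c_def[symmetric] s1 rs, simp add: field_simps power2_eq_square\<close>)
  qed
  define X' where "X' = real s * (p * (r ^ n)\<^sup>2 - Q t ^ (s - 1) * (r ^ s * c))"
  have Xd: "((\<lambda>\<tau>. Re (m \<tau> ^ s)) has_real_derivative X') (at t)"
  proof -
    have "((\<lambda>z. z ^ s) has_field_derivative of_nat s * m t ^ (s - 1)) (at (m t))"
      by (auto intro!: derivative_eq_intros)
    from field_vector_diff_chain_at[OF md this]
    have "((\<lambda>\<tau>. m \<tau> ^ s) has_vector_derivative d * (of_nat s * m t ^ (s - 1))) (at t)"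
      by (simp add: o_def)
    then have "((\<lambda>\<tau>. Re (m \<tau> ^ s)) has_vector_derivative Re (d * (of_nat s * m t ^ (s - 1)))) (at t)"
      by (rule bounded_linear.has_vector_derivative[OF bounded_linear_Re])
    moreover have "Re (d * (of_nat s * m t ^ (s - 1))) = X'"
    proof -
      have "d * (of_nat s * m t ^ (s - 1))
          = of_real (real s * p) * (m t * cnj (m t)) ^ n - of_real (real s * Q t ^ (s - 1)) * m t ^ s"
        by (simp add: d_def n power_mult_distrib algebra_simps)
      also have "(m t * cnj (m t)) ^ n = of_real ((r ^ n)\<^sup>2)"
        unfolding r_def complex_norm_square[symmetric] by (simp add: power_mult[symmetric] mult.commute)
      finally have e: "d * (of_nat s * m t ^ (s - 1)) = of_real (real s * p) * of_real ((r ^ n)\<^sup>2)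
          - of_real (real s * Q t ^ (s - 1)) * m t ^ s" .
      show ?thesis unfolding e minus_complex.sel times_complex.sel Re_complex_of_real Im_complex_of_real X X'_def
        by (simp add: algebra_simps)
    qed
    ultimately show ?thesis by (simp add: has_real_derivative_iff_has_vector_derivative)
  qed
  have "((\<lambda>\<tau>. cmod (m \<tau>) ^ s) has_real_derivative
      real s * (p * r ^ n * c - Q t ^ (s - 1) * r) * r ^ n) (at t)"
    by (rule DERIV_cong[OF DERIV_power[OF rd, of s]])
      (unfold c_def[symmetric] r_def[symmetric] s1, simp add: algebra_simps)
  from DERIV_divide[OF Xd this] r
  have quot: "((\<lambda>\<tau>. Re (m \<tau> ^ s) / cmod (m \<tau>) ^ s) has_real_derivative
      (X' * r ^ s - (r ^ s * c) * (real s * (p * r ^ n * c - Q t ^ (s - 1) * r) * r ^ n)) / (r ^ s * r ^ s)) (at t)"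
    unfolding X r_def[symmetric] by simp
  \<comment> \<open>The terms with \<open>Q\<close> cancel: a radial contraction does not change the
    angle.\<close>
  have val: "(X' * r ^ s - (r ^ s * c) * (real s * (p * r ^ n * c - Q t ^ (s - 1) * r) * r ^ n)) / (r ^ s * r ^ s)
      = p * real s * r powr (real s - 2) * (1 - c\<^sup>2)"
  proof -
    \<comment> \<open>The exponent \<open>s - 2\<close> is negative for \<open>s = 1\<close>, hence
      the real power; as a quotient it is \<open>r ^ (s - 1) / r\<close>.\<close>
    have pw: "r powr (real s - 2) = r ^ n / r"
      using r by (simp add: powr_diff powr_realpow rs power2_eq_square)
    have "r ^ n \<noteq> 0" using r by simp
    then show ?thesis unfolding pw X'_def s1 rs using r
      by (simp add: field_simps power2_eq_square)
  qed
  \<comment> \<open>At \<open>m = 0\<close> the quotient is 0 by convention while the cosine is 1,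
    so the two agree only on a neighbourhood where \<open>m\<close> stays nonzero.\<close>
  have "isCont m t" using md by (rule has_vector_derivative_continuous)
  then have "\<forall>\<^sub>F \<tau> in nhds t. m \<tau> \<noteq> 0"
    using m0 unfolding isCont_def by (simp add: eventually_nhds_conv_at tendsto_imp_eventually_ne)
  then have ev: "\<forall>\<^sub>F \<tau> in nhds t. Re (m \<tau> ^ s) / cmod (m \<tau>) ^ s = cos (real s * Arg (m \<tau>))"
    by eventually_elim (simp add: Re_power_eq)
  show "((\<lambda>\<tau>. cos (real s * Arg (m \<tau>))) has_real_derivative
          p * real s * r powr (real s - 2) * (1 - (cos (real s * \<theta>))\<^sup>2)) (at t)"
    using DERIV_cong_ev[OF refl ev refl, THEN iffD1, OF quot[unfolded val]] unfolding c_def .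
qed

section \<open>Square-summable sequences and the matrix A\<close>

lemma summable_ip:
  assumes "sq_summable u" "sq_summable v"
  shows "summable (\<lambda>i. u i * cnj (v i))"
proof (rule summable_comparison_test')
  show "summable (\<lambda>i. (cmod (u i))\<^sup>2 + (cmod (v i))\<^sup>2)"
    using assms unfolding sq_summable_def by (rule summable_add)
  fix i
  have "0 \<le> cmod (u i) * cmod (v i)" by simp
  with sum_squares_bound[of "cmod (u i)" "cmod (v i)"]
  have "cmod (u i) * cmod (v i) \<le> (cmod (u i))\<^sup>2 + (cmod (v i))\<^sup>2" by linarith
  then show "norm (u i * cnj (v i)) \<le> (cmod (u i))\<^sup>2 + (cmod (v i))\<^sup>2" by (simp add: norm_mult)
qed

lemma sq_summable_add:
  assumes "sq_summable u" "sq_summable v"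
  shows "sq_summable (\<lambda>i. u i + v i)"
  unfolding sq_summable_def
proof (rule summable_comparison_test')
  show "summable (\<lambda>i. 2 * (cmod (u i))\<^sup>2 + 2 * (cmod (v i))\<^sup>2)"
    using assms unfolding sq_summable_def by (intro summable_add summable_mult)
  fix i
  have "(cmod (u i + v i))\<^sup>2 \<le> (cmod (u i) + cmod (v i))\<^sup>2"
    by (intro power_mono norm_triangle_ineq) auto
  also have "\<dots> \<le> 2 * (cmod (u i))\<^sup>2 + 2 * (cmod (v i))\<^sup>2"
    using sum_squares_bound[of "cmod (u i)" "cmod (v i)"] by (simp add: power2_sum)
  finally show "norm ((cmod (u i + v i))\<^sup>2) \<le> 2 * (cmod (u i))\<^sup>2 + 2 * (cmod (v i))\<^sup>2" by simp
qed

lemma sq_summable_scale: "sq_summable u \<Longrightarrow> sq_summable (\<lambda>i. z * u i)"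
  unfolding sq_summable_def by (simp add: norm_mult power_mult_distrib summable_mult)

lemma sq_summable_diff: "sq_summable u \<Longrightarrow> sq_summable v \<Longrightarrow> sq_summable (\<lambda>i. u i - v i)"
  using sq_summable_add[of u "\<lambda>i. - 1 * v i"] sq_summable_scale[of v "- 1"] by simp

lemma sq_summable_sum: "(\<And>j. j \<in> S \<Longrightarrow> sq_summable (f j)) \<Longrightarrow> sq_summable (\<lambda>i. \<Sum>j\<in>S. f j i)"
proof (induction S rule: infinite_finite_induct)
  case (insert j S)
  then show ?case by (simp add: sq_summable_add)
qed (simp_all add: sq_summable_def)

lemma cnj_ip: "sq_summable u \<Longrightarrow> sq_summable v \<Longrightarrow> cnj (ip u v) = ip v u"
  unfolding ip_def
  by (subst bounded_linear.suminf[OF bounded_linear_cnj summable_ip]) (auto simp: mult.commute)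

lemma ip_self: "sq_summable u \<Longrightarrow> ip u u = complex_of_real (sqnorm u)"
  unfolding ip_def sqnorm_def sq_summable_def
  by (subst suminf_of_real) (auto simp: complex_norm_square simp flip: of_real_power)

lemma ip_diff_left:
  "sq_summable u \<Longrightarrow> sq_summable v \<Longrightarrow> sq_summable w \<Longrightarrow> ip (\<lambda>i. u i - v i) w = ip u w - ip v w"
  unfolding ip_def by (subst suminf_diff) (auto simp: summable_ip algebra_simps)

lemma ip_scale_left: "sq_summable u \<Longrightarrow> sq_summable w \<Longrightarrow> ip (\<lambda>i. z * u i) w = z * ip u w"
  unfolding ip_def by (subst suminf_mult[symmetric]) (auto simp: summable_ip mult.assoc)

lemma ip_sum_left:
  assumes "\<And>j. j \<in> S \<Longrightarrow> sq_summable (f j)" "sq_summable w"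
  shows "ip (\<lambda>i. \<Sum>j\<in>S. f j i) w = (\<Sum>j\<in>S. ip (f j) w)"
  unfolding ip_def sum_distrib_right using assms by (intro suminf_sum summable_ip)

lemma ip_diff_right:
  "sq_summable u \<Longrightarrow> sq_summable v \<Longrightarrow> sq_summable w \<Longrightarrow> ip w (\<lambda>i. u i - v i) = ip w u - ip w v"
  using arg_cong[OF ip_diff_left[of u v w], of cnj] by (simp add: cnj_ip sq_summable_diff)

lemma ip_scale_right: "sq_summable u \<Longrightarrow> sq_summable w \<Longrightarrow> ip w (\<lambda>i. z * u i) = cnj z * ip w u"
  using arg_cong[OF ip_scale_left[of u w z], of cnj] by (simp add: cnj_ip sq_summable_scale)

lemma sqnorm_eq_0D:
  assumes "sq_summable u" "sqnorm u = 0"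
  shows "u i = 0"
proof -
  have "(\<forall>n. (cmod (u n))\<^sup>2 = 0)"
    using assms suminf_eq_zero_iff[of "\<lambda>i. (cmod (u i))\<^sup>2"] unfolding sqnorm_def sq_summable_def by auto
  then show ?thesis by simp
qed

text \<open>A candidate has to be supplied; it is the only one, because the difference of two
  candidates lies in \<open>S\<close> and is orthogonal to itself.\<close>

lemma proj_eqI:
  assumes S: "\<And>z. z \<in> S \<Longrightarrow> sq_summable z" "\<And>y z. y \<in> S \<Longrightarrow> z \<in> S \<Longrightarrow> (\<lambda>i. y i - z i) \<in> S"
    and u: "sq_summable u" and y: "y \<in> S" "\<And>z. z \<in> S \<Longrightarrow> ip (\<lambda>i. u i - y i) z = 0"
  shows "proj S u = y"
  unfolding proj_def
proof (rule the_equality)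
  show "y \<in> S \<and> (\<forall>z\<in>S. ip (\<lambda>i. u i - y i) z = 0)" using y by blast
next
  fix y' assume y': "y' \<in> S \<and> (\<forall>z\<in>S. ip (\<lambda>i. u i - y' i) z = 0)"
  let ?d = "\<lambda>i. y' i - y i"
  have d: "?d \<in> S" using S(2)[of y' y] y y' by simp
  have sq: "sq_summable ?d" "sq_summable y" "sq_summable y'" using S(1) d y(1) y' by simp_all
  have "ip (\<lambda>i. u i - y i) ?d = 0" "ip (\<lambda>i. u i - y' i) ?d = 0" using y(2)[OF d] y' d by simp_all
  then have "ip ?d ?d = 0" using sq u by (simp add: ip_diff_left)
  then have "sqnorm ?d = 0" using ip_self[OF sq(1)] by simp
  from sqnorm_eq_0D[OF sq(1) this] show "y' = y" by (simp add: fun_eq_iff)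
qed

text \<open>Pythagoras. It expresses \<open>v\<close> as \<open>Q - r\<^sup>2\<close>, so that only
  \<open>m\<close> and \<open>Q\<close> have to be followed along the flow.\<close>

lemma proj_orth_compl:
  assumes u: "u 0 = 0" "sq_summable u" and h: "h 0 = 0" "sq_summable h" "sqnorm h = 1"
  shows "sqnorm (proj (orth_compl h) u) = sqnorm u - (cmod (ip u h))\<^sup>2"
proof -
  let ?y = "\<lambda>i. u i - ip u h * h i"
  have hh: "ip h h = 1" using ip_self[OF h(2)] h(3) by simp
  have sc: "sq_summable (\<lambda>i. ip u h * h i)" using h by (intro sq_summable_scale)
  have y: "sq_summable ?y" using u sc by (intro sq_summable_diff)
  have "proj (orth_compl h) u = ?y"
  proof (rule proj_eqI)
    show "?y \<in> orth_compl h"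
      using u h y sc hh by (auto simp: orth_compl_def l2_def ip_diff_left ip_scale_left)
    show "ip (\<lambda>i. u i - ?y i) z = 0" if "z \<in> orth_compl h" for z
    proof -
      have z: "sq_summable z" "ip z h = 0" using that by (auto simp: orth_compl_def l2_def)
      have "ip h z = 0" using cnj_ip[OF z(1) h(2)] z(2) by simp
      then show ?thesis using z h by (simp add: ip_scale_left)
    qed
  qed (use u h in \<open>auto simp: orth_compl_def l2_def sq_summable_diff ip_diff_left\<close>)
  moreover have "complex_of_real (sqnorm ?y) = complex_of_real (sqnorm u - (cmod (ip u h))\<^sup>2)"
  proof -
    have "complex_of_real (sqnorm ?y) = ip ?y ?y" using ip_self[OF y] by simp
    also have "\<dots> = ip u u - cnj (ip u h) * ip u h - (ip u h * ip h u - ip u h * (cnj (ip u h) * ip h h))"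
      using u h sc y by (simp add: ip_diff_left ip_diff_right ip_scale_left ip_scale_right)
    also have "\<dots> = complex_of_real (sqnorm u - (cmod (ip u h))\<^sup>2)"
      using cnj_ip[OF u(2) h(2)] unfolding hh ip_self[OF u(2)] of_real_diff complex_norm_square by (simp add: mult.commute)
    finally show ?thesis .
  qed
  ultimately show ?thesis unfolding of_real_eq_iff by simp
qed

text \<open>The Hermitian pairing, needed because the overlap is complex. Its real part is
  \<open>\<bullet>\<close>, the pairing on the real coordinates of \<open>w\<close> in which the
  gradient is taken.\<close>

definition hip :: "complex^'m \<Rightarrow> complex^'m \<Rightarrow> complex" where
  "hip x y = (\<Sum>i\<in>UNIV. x $ i * cnj (y $ i))"

lemma inner_eq_Re_hip: "x \<bullet> y = Re (hip x y)"
  by (simp add: inner_vec_def hip_def inner_complex_def)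

lemma cnj_hip: "cnj (hip x y) = hip y x"
  by (simp add: hip_def mult.commute)

lemma hip_add_left: "hip (x + y) z = hip x z + hip y z"
  by (simp add: hip_def sum.distrib algebra_simps)

lemma hip_diff_left: "hip (x - y) z = hip x z - hip y z"
  by (simp add: hip_def sum_subtractf algebra_simps)

lemma hip_scaleR_left: "hip (r *\<^sub>R x) z = of_real r * hip x z"
  by (simp add: hip_def sum_distrib_left scaleR_conv_of_real[where 'a = complex] mult.assoc)

lemma hip_smult_left: "hip (k *s x) z = k * hip x z"
  by (simp add: hip_def sum_distrib_left mult.assoc)

lemma bounded_linear_hip_left: "bounded_linear (\<lambda>x. hip x z)"
  by (intro linear_conv_bounded_linear[THEN iffD1] linearI)
    (simp_all add: hip_add_left hip_scaleR_left scaleR_conv_of_real[where 'a = complex])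

lemma bounded_linear_matrix_vector_mult:
  fixes K :: "complex^'m::finite^'m"
  shows "bounded_linear (\<lambda>x. K *v x)"
proof (intro linear_conv_bounded_linear[THEN iffD1] linearI)
  show "K *v (r *\<^sub>R x) = r *\<^sub>R (K *v x)" for r x
    by (simp add: vec_eq_iff matrix_vector_mult_def scaleR_conv_of_real[where 'a = complex] sum_distrib_left mult_ac)
qed (simp add: matrix_vector_right_distrib)

lemma matrix_inv_invertible:
  assumes "invertible A"
  shows "A ** matrix_inv A = mat 1" "matrix_inv A ** A = mat 1"
  using someI_ex[OF assms[unfolded invertible_def]] unfolding matrix_inv_def by auto

section \<open>The columns of A, its adjoint and its Gram matrix\<close>

lemma Amul_0: "Amul c a w 0 = 0"
  by (simp add: Amul_def Amat_def)

lemma Amul_eq: "Amul c a w = (\<lambda>k. \<Sum>m\<in>UNIV. w $ m * Amat c a k m)"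
  by (simp add: Amul_def mult.commute)

context
  fixes c :: "nat \<Rightarrow> complex" and a :: "'m::finite \<Rightarrow> complex"
  assumes A_l2: "\<forall>m. sq_summable (\<lambda>k. Amat c a k m)"
begin

lemma sq_summable_Amul: "sq_summable (Amul c a w)"
  unfolding Amul_eq using A_l2 by (intro sq_summable_sum sq_summable_scale) auto

lemma ip_Amul_left: "sq_summable v \<Longrightarrow> ip (Amul c a w) v = (\<Sum>m\<in>UNIV. w $ m * ip (\<lambda>k. Amat c a k m) v)"
  unfolding Amul_eq using A_l2 by (subst ip_sum_left) (auto simp: sq_summable_scale ip_scale_left)

definition Adag :: "(nat \<Rightarrow> complex) \<Rightarrow> complex^'m" where
  "Adag v = (\<chi> m. ip v (\<lambda>k. Amat c a k m))"

lemma ip_Amul_eq_hip: "sq_summable v \<Longrightarrow> ip (Amul c a w) v = hip w (Adag v)"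
  using A_l2 by (simp add: ip_Amul_left hip_def Adag_def cnj_ip)

lemma Adag_Amul: "Adag (Amul c a w) = AdagA c a *v w"
  using A_l2 by (simp add: Adag_def vec_eq_iff matrix_vector_mult_def AdagA_def ip_Amul_left)
    (simp add: ip_def mult.commute)

lemma hip_AdagA: "hip (AdagA c a *v x) y = ip (Amul c a x) (Amul c a y)"
  unfolding Adag_Amul[symmetric]
  using ip_Amul_eq_hip[OF sq_summable_Amul, of y x] cnj_ip[OF sq_summable_Amul sq_summable_Amul, of y x]
  by (simp add: cnj_hip)

lemma hip_AdagA_commute: "hip (AdagA c a *v x) y = hip x (AdagA c a *v y)"
  using cnj_ip[OF sq_summable_Amul sq_summable_Amul, of y x]
  by (simp only: hip_AdagA[symmetric] cnj_hip)

lemma sqnorm_Amul: "sqnorm (Amul c a w) = (AdagA c a *v w) \<bullet> w"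
  using ip_self[OF sq_summable_Amul, of w] unfolding inner_eq_Re_hip hip_AdagA by simp

text \<open>Normal equations: the projection of \<open>h\<close> onto the range is the image of the
  vector \<open>b0\<close> that the Gram matrix maps to \<open>Adag h\<close>, and the squared norm
  of that image is the pairing of \<open>b0\<close> with \<open>Adag h\<close>.\<close>

lemma one_minus_delta:
  assumes "invertible (AdagA c a)" "sq_summable h"
  shows "hip (matrix_inv (AdagA c a) *v Adag h) (Adag h) = of_real (1 - delta c a h)"
proof -
  define b0 where "b0 = matrix_inv (AdagA c a) *v Adag h"
  have Kb: "AdagA c a *v b0 = Adag h"
    unfolding b0_def matrix_vector_mul_assoc matrix_inv_invertible[OF assms(1)] by simp
  have "proj (rangeA c a) h = Amul c a b0"
  proof (rule proj_eqI)
    show "(\<lambda>i. y i - z i) \<in> rangeA c a" if yz: "y \<in> rangeA c a" "z \<in> rangeA c a" for y z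
    proof -
      obtain v w where "y = Amul c a v" "z = Amul c a w" using yz by (auto simp: rangeA_def)
      then have "(\<lambda>i. y i - z i) = Amul c a (v - w)"
        by (simp add: Amul_def fun_eq_iff sum_subtractf algebra_simps)
      then show ?thesis by (auto simp: rangeA_def)
    qed
    show "ip (\<lambda>i. h i - Amul c a b0 i) z = 0" if z: "z \<in> rangeA c a" for z
    proof -
      obtain w where w: "z = Amul c a w" using z by (auto simp: rangeA_def)
      have "ip h z = hip (Adag h) w"
        using ip_Amul_eq_hip[OF assms(2), of w] cnj_ip[OF sq_summable_Amul assms(2), of w]
        by (simp add: w cnj_hip)
      also have "\<dots> = ip (Amul c a b0) z" unfolding w hip_AdagA[symmetric] Kb ..
      finally show ?thesis using assms(2) by (simp add: ip_diff_left sq_summable_Amul w)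
    qed
  qed (use assms sq_summable_Amul in \<open>auto simp: rangeA_def\<close>)
  then have "of_real (1 - delta c a h) = ip (Amul c a b0) (Amul c a b0)"
    by (simp add: delta_def ip_self sq_summable_Amul)
  also have "\<dots> = hip b0 (Adag h)"
    unfolding hip_AdagA[symmetric] by (subst hip_AdagA_commute) (simp only: Kb)
  finally show ?thesis by (simp add: b0_def)
qed

end

section \<open>The flow\<close>

lemma loss_eq:
  fixes a :: "'m::finite \<Rightarrow> complex"
  assumes "\<exists>j. 1 \<le> j \<and> j \<le> Kcut N \<and> \<alpha> j \<noteq> 0"
    and "\<forall>k. k \<notin> {1..Kcut N} \<longrightarrow> h k = 0" "sq_summable h"
    and "\<forall>m. sq_summable (\<lambda>k. Amat c a k m)"
  defines "s \<equiv> info_exp N \<alpha>"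
  shows "loss N \<alpha> h c a w = cmod (\<alpha> s) * ((1 / 2) * ((AdagA c a *v w) \<bullet> w) ^ s - Re (hip w (Adag c a h) ^ s))"
proof -
  have "ip h (Amul c a w) = cnj (hip w (Adag c a h))"
    using cnj_ip[OF sq_summable_Amul[OF assms(4)] assms(3), of w] ip_Amul_eq_hip[OF assms(4,3), of w] by simp
  then have "Re (ip h (Amul c a w) ^ s) = Re (hip w (Adag c a h) ^ s)"
    by (simp flip: complex_cnj_power)
  then show ?thesis
    unfolding loss_def EV_teacher_student[OF assms(1,2) Amul_0 sq_summable_Amul[OF assms(4)]]
      sqnorm_Amul[OF assms(4)] s_def by (simp add: algebra_simps)
qed

text \<open>Self-adjointness of \<open>K\<close> merges the two halves of the derivative of the
  quadratic form. Moving the complex scalar \<open>hip w B ^ (s - 1)\<close> to the gradient side of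
  the pairing conjugates it.\<close>

lemma loss_has_derivative:
  fixes a :: "'m::finite \<Rightarrow> complex"
  assumes "\<exists>j. 1 \<le> j \<and> j \<le> Kcut N \<and> \<alpha> j \<noteq> 0"
    and "\<forall>k. k \<notin> {1..Kcut N} \<longrightarrow> h k = 0" "sq_summable h"
    and A: "\<forall>m. sq_summable (\<lambda>k. Amat c a k m)"
  defines "s \<equiv> info_exp N \<alpha>" and "K \<equiv> AdagA c a" and "B \<equiv> Adag c a h"
  shows "(loss N \<alpha> h c a has_derivative
     (\<lambda>v. ((real s * cmod (\<alpha> s)) *\<^sub>R (((K *v w) \<bullet> w) ^ (s - 1) *\<^sub>R (K *v w) - cnj (hip w B) ^ (s - 1) *s B)) \<bullet> v)) (at w)"
proof -
  have d1: "((\<lambda>w. hip w B) has_derivative (\<lambda>v. hip v B)) (at w)"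
    by (rule bounded_linear_imp_has_derivative[OF bounded_linear_hip_left])
  have d2: "((\<lambda>w. Re (hip w B ^ s)) has_derivative (\<lambda>v. Re (of_nat s * hip v B * hip w B ^ (s - 1)))) (at w)"
    by (rule bounded_linear.has_derivative[OF bounded_linear_Re has_derivative_power[OF d1]])
  have d3: "((\<lambda>w. (K *v w) \<bullet> w) has_derivative (\<lambda>v. (K *v w) \<bullet> v + (K *v v) \<bullet> w)) (at w)"
    by (intro has_derivative_inner bounded_linear_imp_has_derivative[OF bounded_linear_matrix_vector_mult] has_derivative_ident)
  have d4: "((\<lambda>w. cmod (\<alpha> s) * ((1 / 2) * ((K *v w) \<bullet> w) ^ s - Re (hip w B ^ s))) has_derivative
      (\<lambda>v. cmod (\<alpha> s) * ((1 / 2) * (of_nat s * ((K *v w) \<bullet> v + (K *v v) \<bullet> w) * ((K *v w) \<bullet> w) ^ (s - 1))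
        - Re (of_nat s * hip v B * hip w B ^ (s - 1))))) (at w)"
    by (intro has_derivative_mult_right has_derivative_diff has_derivative_power d2 d3)
  have "cmod (\<alpha> s) * ((1 / 2) * (of_nat s * ((K *v w) \<bullet> v + (K *v v) \<bullet> w) * ((K *v w) \<bullet> w) ^ (s - 1))
        - Re (of_nat s * hip v B * hip w B ^ (s - 1)))
     = ((real s * cmod (\<alpha> s)) *\<^sub>R (((K *v w) \<bullet> w) ^ (s - 1) *\<^sub>R (K *v w) - cnj (hip w B) ^ (s - 1) *s B)) \<bullet> v" for v
  proof -
    have 1: "(K *v v) \<bullet> w = (K *v w) \<bullet> v"
      unfolding inner_commute[of "K *v w" v]
      unfolding inner_eq_Re_hip K_def hip_AdagA_commute[OF A, of v] ..
    have "Re (of_nat s * hip v B * hip w B ^ (s - 1)) = real s * Re (hip v B * hip w B ^ (s - 1))"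
      by (simp add: mult.assoc)
    also have "hip v B * hip w B ^ (s - 1) = cnj (hip (cnj (hip w B) ^ (s - 1) *s B) v)"
      by (simp add: hip_smult_left cnj_hip mult.commute)
    finally have 2: "Re (of_nat s * hip v B * hip w B ^ (s - 1)) = real s * ((cnj (hip w B) ^ (s - 1) *s B) \<bullet> v)"
      by (simp add: inner_eq_Re_hip)
    show ?thesis unfolding 1 2 by (simp add: inner_diff_left algebra_simps)
  qed
  with d4 show ?thesis
    unfolding loss_eq[OF assms(1-4), folded s_def K_def B_def] by (simp only:)
qed

text \<open>\<open>G t\<close> is the gradient in the real coordinates: \<open>\<bullet>\<close>
  adds the products of real parts and of imaginary parts, so \<open>G\<close> is the vector with
  real and imaginary parts given by the two partial gradients. The two polar equations are asserted
  where \<open>m\<close> is nonzero, the equation for \<open>v\<close> everywhere.\<close>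

theorem theorem4p1:
  fixes N :: nat and \<alpha> h c :: "nat \<Rightarrow> complex" and a :: "'m::finite \<Rightarrow> complex"
    and w G :: "real \<Rightarrow> complex^'m" and I :: "real set"
  assumes s_exists: "\<exists>j. 1 \<le> j \<and> j \<le> Kcut N \<and> \<alpha> j \<noteq> 0"
    and h_unit: "sqnorm h = 1"
    and h_supp: "\<forall>k. k \<notin> {1..Kcut N} \<longrightarrow> h k = 0"
    and a_circle: "\<forall>m. cmod (a m) = 1"
    and A_l2: "\<forall>m. sq_summable (\<lambda>k. Amat c a k m)"
    and AA_inv: "invertible (AdagA c a)"
    and I_open: "open I"
    and grad: "\<forall>t\<in>I. (loss N \<alpha> h c a has_derivative (\<lambda>u. G t \<bullet> u)) (at (w t))"
    and flow: "\<forall>t\<in>I. (w has_vector_derivative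
                 (- (1 / (real (info_exp N \<alpha>) * cmod (\<alpha> (info_exp N \<alpha>))))) *\<^sub>R
                   (matrix_inv (AdagA c a) *v G t)) (at t)"
  shows "\<forall>t\<in>I.
     (let s = info_exp N \<alpha>; \<delta> = delta c a h;
          m = overlap c a h (w t); r = cmod m; \<theta> = Arg m; v = vstat c a h (w t) in
       ((\<lambda>\<tau>. vstat c a h (w \<tau>)) has_real_derivative
          (2 * \<delta> * r ^ s * cos (real s * \<theta>) - 2 * (v + r\<^sup>2) ^ (s - 1) * v)) (at t)
       \<and> (m \<noteq> 0 \<longrightarrow>
          ((\<lambda>\<tau>. cmod (overlap c a h (w \<tau>))) has_real_derivative
             ((1 - \<delta>) * r ^ (s - 1) * cos (real s * \<theta>) - (v + r\<^sup>2) ^ (s - 1) * r)) (at t)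
          \<and> ((\<lambda>\<tau>. cos (real s * Arg (overlap c a h (w \<tau>)))) has_real_derivative
             ((1 - \<delta>) * real s * r powr (real s - 2) * (1 - (cos (real s * \<theta>))\<^sup>2))) (at t)))"
proof
  fix t assume t: "t \<in> I"
  define s where "s = info_exp N \<alpha>"
  define K where "K = AdagA c a"
  define B where "B = Adag c a h"
  define b0 where "b0 = matrix_inv K *v B"
  define Q where "Q \<tau> = (K *v w \<tau>) \<bullet> w \<tau>" for \<tau>
  note sp = info_exp_props[OF s_exists, folded s_def]
  have h2: "sq_summable h"
    unfolding sq_summable_def by (rule summable_finite[of "{1..Kcut N}"]) (use h_supp in auto)
  have h0: "h 0 = 0" using h_supp by simp
  have m: "overlap c a h v = hip v B" for v
    unfolding overlap_def B_def by (rule ip_Amul_eq_hip[OF A_l2 h2])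
  have v: "vstat c a h (w \<tau>) = Q \<tau> - (cmod (hip (w \<tau>) B))\<^sup>2" for \<tau>
    unfolding vstat_def Q_def K_def sqnorm_Amul[OF A_l2, symmetric] m[symmetric] overlap_def
    by (rule proj_orth_compl[OF Amul_0 sq_summable_Amul[OF A_l2] h0 h2 h_unit])
  have p: "hip b0 B = of_real (1 - delta c a h)"
    unfolding b0_def B_def K_def by (rule one_minus_delta[OF A_l2 AA_inv h2])
  note inv = matrix_inv_invertible[OF AA_inv, folded K_def]
  have Kb: "K *v b0 = B" unfolding b0_def matrix_vector_mul_assoc inv by simp
  define M where "M = cnj (hip (w t) B) ^ (s - 1)"
  define w' where "w' = M *s b0 - Q t ^ (s - 1) *\<^sub>R w t"
  \<comment> \<open>Uniqueness of the Frechet derivative identifies \<open>G t\<close> with the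
    explicit gradient.\<close>
  have "(\<lambda>u. G t \<bullet> u) = (\<lambda>v. ((real s * cmod (\<alpha> s)) *\<^sub>R (Q t ^ (s - 1) *\<^sub>R (K *v w t) - M *s B)) \<bullet> v)"
    unfolding Q_def M_def
    by (rule has_derivative_unique[OF bspec[OF grad t]
          loss_has_derivative[OF s_exists h_supp h2 A_l2, of "w t", folded s_def K_def B_def]])
  then have G: "G t = (real s * cmod (\<alpha> s)) *\<^sub>R (Q t ^ (s - 1) *\<^sub>R (K *v w t) - M *s B)"
    by (metis vector_eq_rdot)
  \<comment> \<open>The inverse Gram matrix turns \<open>K w\<close> into \<open>w\<close> and
    \<open>B\<close> into \<open>b0\<close>; the factor \<open>s * |\<alpha>\<^sub>s|\<close> will
    cancel against the step size of the flow.\<close>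
  have "matrix_inv K *v G t = - ((real s * cmod (\<alpha> s)) *\<^sub>R w')"
  proof -
    interpret bounded_linear "\<lambda>x. matrix_inv K *v x" by (rule bounded_linear_matrix_vector_mult)
    have "matrix_inv K *v (K *v w t) = w t" unfolding matrix_vector_mul_assoc inv by simp
    then show ?thesis
      unfolding G scaleR diff vector_scalar_commute b0_def[symmetric] w'_def
      by (simp add: scaleR_diff_right)
  qed
  then have wd: "(w has_vector_derivative w') (at t)"
    using bspec[OF flow t] sp unfolding s_def[symmetric] K_def[symmetric] by simp
  \<comment> \<open>The equation for \<open>m\<close> closes because \<open>hip b0 B\<close> is the
    real constant \<open>1 - \<delta>\<close>.\<close>
  have md: "((\<lambda>\<tau>. hip (w \<tau>) B) has_vector_derivative
      cnj (hip (w t) B) ^ (s - 1) * of_real (1 - delta c a h) - of_real (Q t ^ (s - 1)) * hip (w t) B) (at t)"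
    using bounded_linear.has_vector_derivative[OF bounded_linear_hip_left wd, of B]
    unfolding w'_def hip_diff_left hip_smult_left hip_scaleR_left p M_def .
  have "((\<lambda>\<tau>. (K *v w \<tau>) \<bullet> w \<tau>) has_derivative
      (\<lambda>x. (K *v w t) \<bullet> (x *\<^sub>R w') + (x *\<^sub>R (K *v w')) \<bullet> w t)) (at t)"
    using wd bounded_linear.has_vector_derivative[OF bounded_linear_matrix_vector_mult wd, of K]
    unfolding has_vector_derivative_def by (intro has_derivative_inner)
  moreover have "(K *v w t) \<bullet> (x *\<^sub>R w') + (x *\<^sub>R (K *v w')) \<bullet> w t
      = (2 * Re (hip (w t) B ^ s) - 2 * Q t ^ s) * x" for x
  proof -
    have 1: "(K *v w') \<bullet> w t = Re (hip w' (K *v w t))"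
      unfolding inner_eq_Re_hip K_def hip_AdagA_commute[OF A_l2] ..
    have 2: "(K *v w t) \<bullet> w' = Re (hip w' (K *v w t))"
      unfolding inner_commute[of "K *v w t" w'] by (rule inner_eq_Re_hip)
    have "hip b0 (K *v w t) = hip (K *v b0) (w t)"
      unfolding K_def by (rule hip_AdagA_commute[OF A_l2, symmetric])
    also have "\<dots> = cnj (hip (w t) B)" by (simp add: Kb cnj_hip)
    finally have "hip w' (K *v w t) = M * cnj (hip (w t) B) - of_real (Q t ^ (s - 1)) * hip (w t) (K *v w t)"
      by (simp only: w'_def hip_diff_left hip_smult_left hip_scaleR_left)
    also have "M * cnj (hip (w t) B) = cnj (hip (w t) B ^ s)"
      using sp(1) by (cases s) (simp_all add: M_def)
    finally have "Re (hip w' (K *v w t)) = Re (hip (w t) B ^ s) - Q t ^ (s - 1) * Re (hip (w t) (K *v w t))"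
      by (simp only: minus_complex.sel times_complex.sel cnj.sel Re_complex_of_real Im_complex_of_real)
    also have "Re (hip (w t) (K *v w t)) = Q t"
      unfolding Q_def inner_commute[of "K *v w t" "w t"] by (rule inner_eq_Re_hip[symmetric])
    also have "Q t ^ (s - 1) * Q t = Q t ^ s" using sp(1) by (cases s) simp_all
    finally have 3: "Re (hip w' (K *v w t)) = Re (hip (w t) B ^ s) - Q t ^ s" .
    show ?thesis unfolding inner_scaleR_left inner_scaleR_right 1 2 3 by (simp add: algebra_simps)
  qed
  ultimately have Qd: "(Q has_real_derivative 2 * Re (hip (w t) B ^ s) - 2 * Q t ^ s) (at t)"
    unfolding has_field_derivative_def Q_def[abs_def] by simp
  show "let s = info_exp N \<alpha>; \<delta> = delta c a h;
          m = overlap c a h (w t); r = cmod m; \<theta> = Arg m; v = vstat c a h (w t) in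
       ((\<lambda>\<tau>. vstat c a h (w \<tau>)) has_real_derivative
          (2 * \<delta> * r ^ s * cos (real s * \<theta>) - 2 * (v + r\<^sup>2) ^ (s - 1) * v)) (at t)
       \<and> (m \<noteq> 0 \<longrightarrow>
          ((\<lambda>\<tau>. cmod (overlap c a h (w \<tau>))) has_real_derivative
             ((1 - \<delta>) * r ^ (s - 1) * cos (real s * \<theta>) - (v + r\<^sup>2) ^ (s - 1) * r)) (at t)
          \<and> ((\<lambda>\<tau>. cos (real s * Arg (overlap c a h (w \<tau>)))) has_real_derivative
             ((1 - \<delta>) * real s * r powr (real s - 2) * (1 - (cos (real s * \<theta>))\<^sup>2))) (at t))"
    \<comment> \<open>Here \<open>p = 1 - \<delta>\<close>, and \<open>v + r\<^sup>2\<close> is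
      \<open>Q\<close>.\<close>
    using polar_flow[OF sp(1) md Qd]
    unfolding Let_def m v s_def[symmetric] by simp
qed

end
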